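(* For a commensurate $k$-th nearest neighbor lattice $\Gamma^{k}\subset\Gamma\subset\mathbb R^n$, the family of Hamiltonians $H^{(k)}:T^n\to\mathrm{Herm}_d$ is the pull-back of the original lattice Hamiltonian $H:T^n\to\mathrm{Herm}_d$ under the diagonal scaling map $$(\theta_1,\dots,\theta_n)\mapsto l(k)(\theta_1,\dots,\theta_n),$$ whose degree is $l(k)^n$, and hence has Chern classes scaled by $l(k)^n$.
   Context: $T^n=(\mathbb R/2\pi\mathbb Z)^n$ with coordinates $\theta_1,\dots,\theta_n$, and $\mathrm{Herm}_d$ is the space of Hermitian $d\times d$ matrices. The original lattice (tight-binding) Hamiltonian $H$ of $\Gamma$ is a family of Hermitian $d\times d$ matrices over momentum space $T^n$ whose entries are sums of translation operators along the edge (nearest neighbor) vectors $v_j$ of $\Gamma$; in momentum space the translation operators $U_j$ become characters $e^{i\theta_j}$. $\Gamma^{k}$ is the sublattice of $k$-th nearest neighbors. If it is generated by vectors $w_i=\sum_j a_{ji}v_j$, the $k$-th nearest neighbor Hamiltonian $H^{(k)}$ is given by hopping along the $w_i$, i.e. the translation along $w_i$ is $\prod_jU_j^{a_{ji}}$. The sublattice $\Gamma^{k}$ is called commensurate if $\Gamma^{k}=l(k)\Gamma$, where $l(k)$ is the distance of the $k$-th nearest neighbors; in this case $w_i=l(k)v_i$. The pull-back of the family $H$ along $f:T^n\to T^n$ is $H\circ f$. The Chern classes of a family are those of the bundles of eigenstates over $T^n$ which it defines.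
   Formalization: Chern classes are shown to be pulled back along the scaling map in every degree, but scaled by l(k)^n only in top degree 2j=n; in other degrees that scaling is false (n=3, cubic lattice, l=2: c_1 can be scaled by 4, not 8). l(k) is measured in edge lengths. *)

theory Defs
  imports "HOL-Analysis.Analysis" "HOL-Combinatorics.Permutations"
begin

section \<open>Lattices and their sublattices of k-th nearest neighbours\<close>

definition lattice_basis :: "('n::finite \<Rightarrow> real^'n) \<Rightarrow> (real^'n) set \<Rightarrow> bool" where
  "lattice_basis v \<Gamma> \<longleftrightarrow> inj v \<and> independent (range v) \<and>
     \<Gamma> = {\<Sum>j\<in>UNIV. of_int (c j) *\<^sub>R v j | c :: 'n \<Rightarrow> int. True}"

definition lattice_generated :: "(real^'n::finite) set \<Rightarrow> (real^'n) set" where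
  "lattice_generated S =
     {\<Sum>s\<in>F. of_int (c s) *\<^sub>R s | F (c :: real^'n \<Rightarrow> int). finite F \<and> F \<subseteq> S}"

text \<open>A lattice looks the same from each of its points, so distances are measured from the origin.
  The distances are counted from \<open>k = 1\<close>, without multiplicity.\<close>

definition neighbour_distance :: "(real^'n::finite) set \<Rightarrow> nat \<Rightarrow> real" where
  "neighbour_distance \<Gamma> k = (THE r. r \<in> norm ` (\<Gamma> - {0}) \<and>
     finite {s \<in> norm ` (\<Gamma> - {0}). s < r} \<and>
     Suc (card {s \<in> norm ` (\<Gamma> - {0}). s < r}) = k)"

definition neighbours :: "(real^'n::finite) set \<Rightarrow> nat \<Rightarrow> (real^'n) set" where
  "neighbours \<Gamma> k = {g \<in> \<Gamma>. norm g = neighbour_distance \<Gamma> k}"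

definition neighbour_sublattice :: "(real^'n::finite) set \<Rightarrow> nat \<Rightarrow> (real^'n) set" where
  "neighbour_sublattice \<Gamma> k = lattice_generated (neighbours \<Gamma> k)"

text \<open>The number \<open>l(k)\<close> is the distance of the k-th nearest neighbours in units of the edge length of
  the lattice, i.e. of the distance of nearest neighbours; without this normalisation the condition
  \<open>\<Gamma>\<^sup>k = l(k) \<Gamma>\<close> would not be invariant under a change of the unit of length.\<close>

definition neighbour_scale :: "(real^'n::finite) set \<Rightarrow> nat \<Rightarrow> real" where
  "neighbour_scale \<Gamma> k = neighbour_distance \<Gamma> k / neighbour_distance \<Gamma> 1"

definition commensurate :: "(real^'n::finite) set \<Rightarrow> nat \<Rightarrow> bool" where
  "commensurate \<Gamma> k \<longleftrightarrow> neighbour_sublattice \<Gamma> k = (\<lambda>g. neighbour_scale \<Gamma> k *\<^sub>R g) ` \<Gamma>"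


section \<open>The torus\<close>

definition torus_rel :: "real^'n::finite \<Rightarrow> real^'n \<Rightarrow> bool" where
  "torus_rel x y \<longleftrightarrow> (\<forall>i. \<exists>m::int. x $ i - y $ i = 2 * pi * of_int m)"

lemma equivp_torus_rel: "equivp torus_rel"
proof (rule equivpI)
  show "reflp torus_rel"
    unfolding reflp_def torus_rel_def by (metis diff_self mult_zero_right of_int_0)
  show "symp torus_rel"
    unfolding symp_def torus_rel_def by (metis minus_diff_eq mult_minus_right of_int_minus)
  show "transp torus_rel"
  proof (rule transpI)
    fix x y z :: "real^'n" assume *: "torus_rel x y" "torus_rel y z"
    show "torus_rel x z"
      unfolding torus_rel_def
    proof
      fix i
      obtain m m' :: int where "x $ i - y $ i = 2 * pi * of_int m" "y $ i - z $ i = 2 * pi * of_int m'"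
        using * unfolding torus_rel_def by blast
      then have "x $ i - z $ i = 2 * pi * of_int (m + m')" by (simp add: algebra_simps)
      then show "\<exists>m::int. x $ i - z $ i = 2 * pi * of_int m" by blast
    qed
  qed
qed

quotient_type (overloaded) 'n torus = "real^'n::finite" / torus_rel
  by (rule equivp_torus_rel)

lift_definition torus_character :: "'n::finite torus \<Rightarrow> 'n \<Rightarrow> complex" is "\<lambda>\<theta> j. cis (\<theta> $ j)"
proof -
  fix x y :: "real^'n" assume *: "torus_rel x y"
  show "(\<lambda>j. cis (x $ j)) = (\<lambda>j. cis (y $ j))"
  proof
    fix j
    obtain m :: int where "x $ j - y $ j = 2 * pi * of_int m"
      using * unfolding torus_rel_def by blast
    then have "x $ j = y $ j + 2 * pi * of_int m" by simp
    then show "cis (x $ j) = cis (y $ j)"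
      by (simp add: cis_mult [symmetric] cis_multiple_2pi)
  qed
qed

lift_definition torus_scale :: "nat \<Rightarrow> 'n::finite torus \<Rightarrow> 'n torus" is "\<lambda>N \<theta>. of_nat N *\<^sub>R \<theta>"
proof -
  fix N :: nat and x y :: "real^'n" assume *: "torus_rel x y"
  show "torus_rel (of_nat N *\<^sub>R x) (of_nat N *\<^sub>R y)"
    unfolding torus_rel_def
  proof
    fix i
    obtain m :: int where "x $ i - y $ i = 2 * pi * of_int m"
      using * unfolding torus_rel_def by blast
    then have "(of_nat N *\<^sub>R x) $ i - (of_nat N *\<^sub>R y) $ i = 2 * pi * of_int (int N * m)"
      by (simp add: right_diff_distrib [symmetric])
    then show "\<exists>m::int. (of_nat N *\<^sub>R x) $ i - (of_nat N *\<^sub>R y) $ i = 2 * pi * of_int m" by blast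
  qed
qed


section \<open>Differentiation on the torus, and the degree\<close>

text \<open>The tangent spaces are identified with \<open>real^'n\<close> through the covering map \<open>abs_torus\<close>. All
  notions below are independent of the representative \<open>rep_torus p\<close>.\<close>

definition torus_deriv ::
    "('n::finite torus \<Rightarrow> 'b::real_normed_vector) \<Rightarrow> 'n torus \<Rightarrow> real^'n \<Rightarrow> 'b" where
  "torus_deriv g p u = frechet_derivative (\<lambda>x. g (abs_torus x)) (at (rep_torus p)) u"

text \<open>Two continuous lifts of the same map differ by a constant, so they have the same differential.\<close>

definition torus_lift :: "('n::finite torus \<Rightarrow> 'n torus) \<Rightarrow> real^'n \<Rightarrow> real^'n" where
  "torus_lift f = (SOME F. continuous_on UNIV F \<and> (\<forall>x. f (abs_torus x) = abs_torus (F x)))"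

definition torus_map_deriv :: "('n::finite torus \<Rightarrow> 'n torus) \<Rightarrow> 'n torus \<Rightarrow> real^'n \<Rightarrow> real^'n" where
  "torus_map_deriv f p = frechet_derivative (torus_lift f) (at (rep_torus p))"

definition torus_regular_value :: "('n::finite torus \<Rightarrow> 'n torus) \<Rightarrow> 'n torus \<Rightarrow> bool" where
  "torus_regular_value f q \<longleftrightarrow> (\<forall>p. f p = q \<longrightarrow>
     torus_lift f differentiable at (rep_torus p) \<and> det (matrix (torus_map_deriv f p)) \<noteq> 0)"

text \<open>The degree of a smooth self-map: the number of preimages of any regular value, counted with
  the sign of the Jacobian determinant.\<close>

definition torus_degree :: "('n::finite torus \<Rightarrow> 'n torus) \<Rightarrow> int" where
  "torus_degree f = (THE d. \<forall>q. torus_regular_value f q \<longrightarrow>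
     of_int d = (\<Sum>p\<in>f -` {q}. sgn (det (matrix (torus_map_deriv f p)))))"


section \<open>Hamiltonians\<close>

definition hermitian :: "complex^'d^'d \<Rightarrow> bool" where
  "hermitian A \<longleftrightarrow> (\<forall>a b. A $ a $ b = cnj (A $ b $ a))"

definition lattice_coords :: "('n::finite \<Rightarrow> real^'n) \<Rightarrow> real^'n \<Rightarrow> 'n \<Rightarrow> int" where
  "lattice_coords v g = (THE c. g = (\<Sum>j\<in>UNIV. of_int (c j) *\<^sub>R v j))"

text \<open>Translation along \<open>g = \<Sum>\<^sub>j a\<^sub>j v\<^sub>j\<close> in momentum space, i.e. \<open>\<Prod>\<^sub>j U\<^sub>j\<^bsup>a\<^sub>j\<^esup>\<close> with \<open>U\<^sub>j = exp (i \<theta>\<^sub>j)\<close>.\<close>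

definition translation :: "('n::finite \<Rightarrow> real^'n) \<Rightarrow> real^'n \<Rightarrow> 'n torus \<Rightarrow> complex" where
  "translation v g \<theta> = (\<Prod>j\<in>UNIV. torus_character \<theta> j powi lattice_coords v g j)"

text \<open>The number \<open>t a b e\<close> is the coefficient of the translation along \<open>e\<close> in the \<open>(a, b)\<close> entry.
  The zero vector accounts for constant entries, i.e. for hoppings within a unit cell.\<close>

definition hoppings :: "(real^'n::finite) set \<Rightarrow> (real^'n) set" where
  "hoppings \<Gamma> = insert 0 (neighbours \<Gamma> 1)"

definition lattice_hamiltonian ::
    "(real^'n::finite) set \<Rightarrow> ('n \<Rightarrow> real^'n) \<Rightarrow> ('d \<Rightarrow> 'd \<Rightarrow> real^'n \<Rightarrow> complex)
       \<Rightarrow> 'n torus \<Rightarrow> complex^'d^'d" where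
  "lattice_hamiltonian \<Gamma> v t \<theta> = (\<chi> a b. \<Sum>e\<in>hoppings \<Gamma>. t a b e * translation v e \<theta>)"

text \<open>Hopping along \<open>w\<^sub>i\<close> in place of \<open>v\<^sub>i\<close>; the translations are still expressed
  in the operators \<open>U\<^sub>j\<close> of the original lattice.\<close>

definition neighbour_hamiltonian ::
    "(real^'n::finite) set \<Rightarrow> ('n \<Rightarrow> real^'n) \<Rightarrow> ('n \<Rightarrow> real^'n)
       \<Rightarrow> ('d \<Rightarrow> 'd \<Rightarrow> real^'n \<Rightarrow> complex) \<Rightarrow> 'n torus \<Rightarrow> complex^'d^'d" where
  "neighbour_hamiltonian \<Gamma> v w t \<theta> = (\<chi> a b. \<Sum>e\<in>hoppings \<Gamma>.
     t a b e * translation v (\<Sum>i\<in>UNIV. of_int (lattice_coords v e i) *\<^sub>R w i) \<theta>)"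


section \<open>Bundles of eigenstates\<close>

definition eigenspace :: "complex^'d^'d \<Rightarrow> real \<Rightarrow> (complex^'d::finite) set" where
  "eigenspace A x = {z. A *v z = of_real x *s z}"

definition eigenvalue_count :: "complex^'d^'d::finite \<Rightarrow> real \<Rightarrow> nat" where
  "eigenvalue_count A x = (\<Sum>y | y \<le> x \<and> eigenspace A y \<noteq> {0}. vec.dim (eigenspace A y))"

text \<open>For a Hermitian matrix: the i-th smallest eigenvalue, \<open>1 \<le> i \<le> CARD('d)\<close>, counted with
  multiplicity.\<close>

definition band :: "complex^'d^'d::finite \<Rightarrow> nat \<Rightarrow> real" where
  "band A i = (LEAST x. i \<le> eigenvalue_count A x)"

text \<open>The eigenstates of the bands in \<open>B\<close> form a vector bundle over the whole torus if these bands
  nowhere touch the other ones. A single band that is nowhere degenerate gives a line bundle.\<close>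

definition isolated_bands :: "('n::finite torus \<Rightarrow> complex^'d^'d::finite) \<Rightarrow> nat set \<Rightarrow> bool" where
  "isolated_bands H B \<longleftrightarrow> B \<subseteq> {1..CARD('d)} \<and>
     (\<forall>\<theta>. \<forall>i\<in>B. \<forall>j\<in>{1..CARD('d)} - B. band (H \<theta>) i \<noteq> band (H \<theta>) j)"

definition eigenbundle ::
    "('n::finite torus \<Rightarrow> complex^'d^'d::finite) \<Rightarrow> nat set \<Rightarrow> 'n torus \<Rightarrow> (complex^'d) set" where
  "eigenbundle H B \<theta> = vec.span (\<Union>i\<in>B. eigenspace (H \<theta>) (band (H \<theta>) i))"

definition orthogonal_projection :: "(complex^'d) set \<Rightarrow> complex^'d^'d::finite" where
  "orthogonal_projection E = (THE P. P ** P = P \<and> hermitian P \<and> range ((*v) P) = E)"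


section \<open>Differential forms and de Rham cohomology of the torus\<close>

text \<open>A form of degree \<open>p\<close> takes as arguments the first \<open>p\<close> members of a sequence of tangent vectors.
  Complex coefficients are used.\<close>

type_synonym 'n form = "'n torus \<Rightarrow> (nat \<Rightarrow> real^'n) \<Rightarrow> complex"

fun C_k :: "nat \<Rightarrow> (real^'n::finite \<Rightarrow> complex) \<Rightarrow> bool" where
  "C_k 0 g \<longleftrightarrow> continuous_on UNIV g"
| "C_k (Suc m) g \<longleftrightarrow> (\<forall>x. g differentiable at x) \<and>
     (\<forall>u. C_k m (\<lambda>x. frechet_derivative g (at x) u))"

definition smooth_form :: "nat \<Rightarrow> 'n::finite form \<Rightarrow> bool" where
  "smooth_form p \<omega> \<longleftrightarrow>
     (\<forall>V m. C_k m (\<lambda>x. \<omega> (abs_torus x) V)) \<and>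
     (\<forall>\<theta> V W. (\<forall>i<p. V i = W i) \<longrightarrow> \<omega> \<theta> V = \<omega> \<theta> W) \<and>
     (\<forall>\<theta> V. \<forall>i<p. linear (\<lambda>u. \<omega> \<theta> (V(i := u)))) \<and>
     (\<forall>\<theta> V i j. i < j \<and> j < p \<and> V i = V j \<longrightarrow> \<omega> \<theta> V = 0)"

definition omit :: "nat \<Rightarrow> (nat \<Rightarrow> 'a) \<Rightarrow> nat \<Rightarrow> 'a" where
  "omit i V = (\<lambda>j. if j < i then V j else V (Suc j))"

text \<open>Translation invariant vector fields commute, so there are no bracket terms.\<close>

definition exterior_derivative :: "nat \<Rightarrow> 'n::finite form \<Rightarrow> 'n form" where
  "exterior_derivative p \<omega> = (\<lambda>\<theta> V. \<Sum>i\<le>p. (-1) ^ i * torus_deriv (\<lambda>\<eta>. \<omega> \<eta> (omit i V)) \<theta> (V i))"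

definition exact_form :: "nat \<Rightarrow> 'n::finite form \<Rightarrow> bool" where
  "exact_form p \<omega> \<longleftrightarrow> (case p of 0 \<Rightarrow> \<omega> = (\<lambda>\<theta> V. 0)
     | Suc q \<Rightarrow> \<exists>\<eta>. smooth_form q \<eta> \<and> \<omega> = exterior_derivative q \<eta>)"

text \<open>The class of a closed form modulo exact forms, and the map of cohomology
  induced by a linear map of forms that preserves closed and exact forms.\<close>

definition deRham_class :: "nat \<Rightarrow> 'n::finite form \<Rightarrow> 'n form set" where
  "deRham_class p \<omega> = {\<omega>'. exact_form p (\<lambda>\<theta> V. \<omega>' \<theta> V - \<omega> \<theta> V)}"

definition class_map :: "nat \<Rightarrow> ('n::finite form \<Rightarrow> 'n form) \<Rightarrow> 'n form set \<Rightarrow> 'n form set" where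
  "class_map p \<Phi> C = (\<Union>\<omega>\<in>C. deRham_class p (\<Phi> \<omega>))"

definition pullback_form :: "('n::finite torus \<Rightarrow> 'n torus) \<Rightarrow> 'n form \<Rightarrow> 'n form" where
  "pullback_form f \<omega> = (\<lambda>\<theta> V. \<omega> (f \<theta>) (\<lambda>i. torus_map_deriv f \<theta> (V i)))"

definition scale_form :: "complex \<Rightarrow> 'n::finite form \<Rightarrow> 'n form" where
  "scale_form c \<omega> = (\<lambda>\<theta> V. c * \<omega> \<theta> V)"

abbreviation pullback_class ::
    "('n::finite torus \<Rightarrow> 'n torus) \<Rightarrow> nat \<Rightarrow> 'n form set \<Rightarrow> 'n form set" where
  "pullback_class f p \<equiv> class_map p (pullback_form f)"

abbreviation scale_class :: "complex \<Rightarrow> nat \<Rightarrow> 'n::finite form set \<Rightarrow> 'n form set" where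
  "scale_class c p \<equiv> class_map p (scale_form c)"


section \<open>Chern classes\<close>

text \<open>The curvature \<open>P dP \<and> dP P\<close> of the connection \<open>P d\<close> (Berry connection) on the bundle with fibres
  \<open>range (P \<theta>)\<close>, extended by zero to the orthogonal complement.\<close>

definition berry_curvature ::
    "('n::finite torus \<Rightarrow> complex^'d^'d::finite) \<Rightarrow> 'n torus \<Rightarrow> real^'n \<Rightarrow> real^'n \<Rightarrow> complex^'d^'d"
  where
  "berry_curvature P \<theta> u v = P \<theta> ** (torus_deriv P \<theta> u ** torus_deriv P \<theta> v
     - torus_deriv P \<theta> v ** torus_deriv P \<theta> u) ** P \<theta>"

definition wedge_2forms :: "nat \<Rightarrow> (nat \<Rightarrow> 'a \<Rightarrow> 'a \<Rightarrow> complex) \<Rightarrow> (nat \<Rightarrow> 'a) \<Rightarrow> complex" where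
  "wedge_2forms j \<alpha> V = (\<Sum>\<tau> | \<tau> permutes {..<2 * j}.
     of_int (sign \<tau>) * (\<Prod>m<j. \<alpha> m (V (\<tau> (2 * m))) (V (\<tau> (2 * m + 1))))) / 2 ^ j"

text \<open>The part of degree \<open>2 j\<close> of \<open>det (1 + i F / (2 \<pi>))\<close>, where \<open>F\<close> is the curvature. The j-th
  elementary symmetric polynomial of the eigenvalues of a matrix \<open>X\<close> is
  \<open>1 / j! \<Sum>\<^sub>a \<Sum>\<^sub>\<sigma> sign \<sigma> \<Prod>\<^sub>m X (a m) (a (\<sigma> m))\<close>; here the product is the wedge product.\<close>

definition chern_form ::
    "('n::finite torus \<Rightarrow> complex^'d^'d::finite) \<Rightarrow> nat \<Rightarrow> 'n form" where
  "chern_form P j = (\<lambda>\<theta> V. (\<i> / (2 * of_real pi)) ^ j / fact j *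
     (\<Sum>a\<in>{..<j} \<rightarrow>\<^sub>E UNIV. \<Sum>\<sigma> | \<sigma> permutes {..<j}. of_int (sign \<sigma>) *
        wedge_2forms j (\<lambda>m u v. berry_curvature P \<theta> u v $ a m $ a (\<sigma> m)) V))"

text \<open>The cohomology of the torus has no torsion, so no information on the integral Chern classes is
  lost in de Rham cohomology.\<close>

definition chern_class ::
    "('n::finite torus \<Rightarrow> complex^'d^'d::finite) \<Rightarrow> nat set \<Rightarrow> nat \<Rightarrow> 'n form set" where
  "chern_class H B j =
     deRham_class (2 * j) (chern_form (\<lambda>\<theta>. orthogonal_projection (eigenbundle H B \<theta>)) j)"

end

theory Submission
  imports Defs
begin

text \<open>
  Commensurability puts \<open>l v\<^sub>i\<close> into the lattice, so \<open>l\<close> is an integer, and the translation along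
  \<open>l v\<^sub>i\<close> is the \<open>l\<close>-th power of the one along \<open>v\<^sub>i\<close>; this is the pull-back statement. All lifts
  of the scaling map differ from multiplication by \<open>l\<close> by a constant, and every point has \<open>l ^ n\<close>
  preimages of sign \<open>1\<close>.

  The statement on Chern classes needs that the projection \<open>P\<close> to isolated bands is smooth. It is
  continuous since the bands are (Weyl's inequality). The equation \<open>H P = P H\<close> then gives
  \<open>[H, dP] = [P, dH]\<close>, and the commutator with \<open>H\<close> is invertible on matrices that are off-diagonal
  with respect to \<open>P\<close>. So \<open>dP\<close> exists and is as smooth as \<open>P\<close>, and \<open>P\<close> is smooth by bootstrapping.
  Hence the Chern forms are smooth and natural under the scaling map.

  In top degree the pull-back of \<open>\<omega>\<close> is \<open>l ^ n\<close> times the form \<open>\<omega> (l \<theta>)\<close>, and \<open>\<omega> (l \<theta>) - \<omega> \<theta>\<close> is exact: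
  scaling one coordinate at a time, it is a sum of derivatives in coordinate directions of smooth forms of
  top degree, which are exact by Cartan's formula.
\<close>

section \<open>Functions of class \<open>C\<^sup>k\<close>\<close>

text \<open>Bands inside \<open>B\<close> may cross each other, so in general neither single bands
  nor eigenvectors can be differentiated; only the projection to the whole block can. Its smoothness
  carries both Chern statements: \<open>torus_deriv\<close> is a chosen derivative, meaningful only
  where one exists, and \<open>exact_form\<close> asks for smooth primitives. Continuity has to come
  first, because the remainder in the differentiated equation for \<open>P\<close> is small only if
  the increment of \<open>P\<close> is. In degree \<open>p\<close> the arguments of a form
  contribute the factor \<open>l ^ p\<close> to the pull-back, so \<open>l ^ n\<close> belongs to
  \<open>2 * j = n\<close>. The equality of classes there rests on an explicit primitive. Its
  difficulty is periodicity: the primitive of a periodic function along a coordinate is in general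
  not periodic, and the one used is built so that the growth over a period cancels.\<close>

abbreviation dir_deriv :: "('a::real_normed_vector \<Rightarrow> 'b::real_normed_vector) \<Rightarrow> 'a \<Rightarrow> 'a \<Rightarrow> 'b" where
  "dir_deriv g u x \<equiv> frechet_derivative g (at x) u"

lemma dir_deriv_eq: "(g has_derivative g') (at x) \<Longrightarrow> dir_deriv g u x = g' u"
  using frechet_derivative_at by metis

lemma differentiable_imp_has_dir_deriv:
  "g differentiable at x \<Longrightarrow> (g has_derivative (\<lambda>u. dir_deriv g u x)) (at x)"
  using frechet_derivative_works by auto

lemma C_k_SucI:
  assumes "\<And>x. (g has_derivative g' x) (at x)" "\<And>u. C_k m (\<lambda>x. g' x u)"
  shows "C_k (Suc m) g"
proof -
  have "g differentiable at x" for x using assms(1) differentiable_def by blast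
  moreover have "dir_deriv g u = (\<lambda>x. g' x u)" for u
    using assms(1) by (auto simp: dir_deriv_eq)
  ultimately show ?thesis using assms(2) by simp
qed

lemma C_k_SucD:
  assumes "C_k (Suc m) g"
  shows "(g has_derivative (\<lambda>u. dir_deriv g u x)) (at x)" "C_k m (dir_deriv g u)"
  using assms by (auto intro: differentiable_imp_has_dir_deriv)

lemma C_k_decrease: "C_k (Suc m) g \<Longrightarrow> C_k m g"
proof (induction m arbitrary: g)
  case 0
  then show ?case
    by (auto intro!: differentiable_imp_continuous_on simp: differentiable_on_def)
next
  case (Suc m)
  show ?case by (rule C_k_SucI[OF C_k_SucD(1)[OF Suc.prems]]) (metis Suc C_k_SucD(2))
qed

lemma C_k_imp_continuous: "C_k m g \<Longrightarrow> continuous_on UNIV g"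
  by (induction m) (auto simp del: C_k.simps(2) dest: C_k_decrease)

lemma C_k_const [simp]: "C_k m (\<lambda>x. c)"
proof (induction m arbitrary: c)
  case (Suc m)
  show ?case by (rule C_k_SucI[where g' = "\<lambda>_ _. 0"]) (auto intro: Suc)
qed simp

lemma C_k_add: "C_k m f \<Longrightarrow> C_k m g \<Longrightarrow> C_k m (\<lambda>x. f x + g x)"
proof (induction m arbitrary: f g)
  case 0
  then show ?case by (auto intro: continuous_intros)
next
  case (Suc m)
  show ?case
    by (rule C_k_SucI[OF has_derivative_add[OF C_k_SucD(1)[OF Suc.prems(1)] C_k_SucD(1)[OF Suc.prems(2)]]])
      (intro Suc.IH C_k_SucD(2) Suc.prems)
qed

lemma C_k_mult: "C_k m f \<Longrightarrow> C_k m g \<Longrightarrow> C_k m (\<lambda>x. f x * g x)"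
proof (induction m arbitrary: f g)
  case 0
  then show ?case by (auto intro: continuous_intros)
next
  case (Suc m)
  show ?case
    by (rule C_k_SucI[OF has_derivative_mult[OF C_k_SucD(1)[OF Suc.prems(1)] C_k_SucD(1)[OF Suc.prems(2)]]])
      (intro C_k_add Suc.IH C_k_SucD(2) Suc.prems C_k_decrease)
qed

lemma C_k_minus: "C_k m f \<Longrightarrow> C_k m (\<lambda>x. - f x)"
  using C_k_mult[of m "\<lambda>_. -1" f] by simp

lemma C_k_diff: "C_k m f \<Longrightarrow> C_k m g \<Longrightarrow> C_k m (\<lambda>x. f x - g x)"
  using C_k_add[OF _ C_k_minus] by fastforce

lemma C_k_sum: "(\<And>i. i \<in> I \<Longrightarrow> C_k m (f i)) \<Longrightarrow> C_k m (\<lambda>x. \<Sum>i\<in>I. f i x)"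
  by (induction I rule: infinite_finite_induct) (auto intro: C_k_add)

lemma C_k_prod: "(\<And>i. i \<in> I \<Longrightarrow> C_k m (f i)) \<Longrightarrow> C_k m (\<lambda>x. \<Prod>i\<in>I. f i x)"
  by (induction I rule: infinite_finite_induct) (auto intro: C_k_mult)

lemma C_k_inverse: "C_k m f \<Longrightarrow> (\<And>x. f x \<noteq> 0) \<Longrightarrow> C_k m (\<lambda>x. inverse (f x))"
proof (induction m)
  case 0
  then show ?case by (auto intro: continuous_intros)
next
  case (Suc m)
  show ?case
    by (rule C_k_SucI[OF Deriv.has_derivative_inverse[OF Suc.prems(2) C_k_SucD(1)[OF Suc.prems(1)]]])
      (intro C_k_minus C_k_mult C_k_SucD(2) Suc C_k_decrease)
qed

lemma C_k_divide: "C_k m f \<Longrightarrow> C_k m g \<Longrightarrow> (\<And>x. g x \<noteq> 0) \<Longrightarrow> C_k m (\<lambda>x. f x / g x)"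
  unfolding divide_inverse by (intro C_k_mult C_k_inverse)

lemma C_k_compose_linear:
  assumes "linear (L :: real^'n::finite \<Rightarrow> real^'n)"
  shows "C_k m g \<Longrightarrow> C_k m (\<lambda>x. g (L x))"
proof (induction m arbitrary: g)
  case 0
  then show ?case
    using linear_continuous_on[OF assms[unfolded linear_conv_bounded_linear], of UNIV]
    by (auto intro: continuous_on_compose2)
next
  case (Suc m)
  have "(L has_derivative L) (at x)" for x
    using assms by (simp add: bounded_linear_imp_has_derivative linear_conv_bounded_linear)
  then have "((\<lambda>x. g (L x)) has_derivative (\<lambda>u. dir_deriv g (L u) (L x))) (at x)" for x
    using has_derivative_compose[OF _ C_k_SucD(1)[OF Suc.prems]] by blast
  then show ?case
    by (rule C_k_SucI) (rule Suc.IH C_k_SucD(2) Suc.prems)+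
qed

lemma C_k_linear:
  assumes "linear (f :: real^'n::finite \<Rightarrow> complex)"
  shows "C_k m f"
proof (cases m)
  case 0
  then show ?thesis using assms by (simp add: linear_continuous_on linear_conv_bounded_linear)
next
  case (Suc k)
  show ?thesis unfolding Suc
    by (rule C_k_SucI[where g' = "\<lambda>_. f"])
      (use assms in \<open>auto simp: bounded_linear_imp_has_derivative linear_conv_bounded_linear\<close>)
qed

lemma C_k_cis_linear:
  assumes "linear (f :: real^'n::finite \<Rightarrow> real)"
  shows "C_k m (\<lambda>x. cis (f x))"
proof (induction m)
  case 0
  have "continuous_on UNIV f"
    using assms by (simp add: linear_continuous_on linear_conv_bounded_linear)
  then show ?case by (auto simp: cis_conv_exp intro!: continuous_intros)
next
  case (Suc m)
  have f: "(f has_derivative f) (at x)" for x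
    using assms by (simp add: bounded_linear_imp_has_derivative linear_conv_bounded_linear)
  have "((\<lambda>x. \<i> * complex_of_real (f x)) has_derivative (\<lambda>u. \<i> * of_real (f u))) (at x)" for x
    by (intro has_derivative_mult_right has_derivative_of_real f)
  moreover have "(exp has_derivative (\<lambda>u. exp z * u)) (at z)" for z :: complex
    using DERIV_exp[of z] by (simp add: has_field_derivative_def)
  ultimately have "((\<lambda>x. cis (f x)) has_derivative (\<lambda>u. cis (f x) * (\<i> * of_real (f u)))) (at x)" for x
    unfolding cis_conv_exp by (rule has_derivative_compose)
  then show ?case
    by (rule C_k_SucI) (intro C_k_mult C_k_const Suc)
qed

lemma C_k_det:
  fixes A :: "real^'n::finite \<Rightarrow> complex^'m::finite^'m"
  assumes "\<And>i j. C_k k (\<lambda>x. A x $ i $ j)"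
  shows "C_k k (\<lambda>x. det (A x))"
  unfolding det_def by (intro C_k_sum C_k_mult C_k_const C_k_prod assms)

text \<open>By Cramer's rule the solution is a quotient of determinants in the coefficients, so it
  inherits their regularity. This serves both for the continuity of the projection and for the
  regularity of its derivative.\<close>

lemma C_k_linear_system:
  fixes A :: "real^'n::finite \<Rightarrow> complex^'m::finite^'m"
  assumes "\<And>i j. C_k k (\<lambda>x. A x $ i $ j)" "\<And>i. C_k k (\<lambda>x. b x $ i)"
    and "\<And>x. A x *v y x = b x" "\<And>x. det (A x) \<noteq> 0"
  shows "C_k k (\<lambda>x. y x $ i)"
proof -
  have "y x $ i = det (\<chi> a c. if c = i then b x $ a else A x $ a $ c) / det (A x)" for x
    using cramer[OF assms(4), of x "y x" "b x"] assms(3)[of x] by simp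
  moreover have "C_k k (\<lambda>x. (\<chi> a c. if c = i then b x $ a else A x $ a $ c) $ r $ s)" for r s
    using assms(1,2) by (cases "s = i") auto
  ultimately show ?thesis
    by (simp only:) (intro C_k_divide C_k_det assms)
qed

section \<open>Hermitian matrices and their bands\<close>

lemma of_real_smult: "(of_real r :: complex) *s z = r *\<^sub>R z"
  by (simp add: vec_eq_iff complex_eq_iff)

lemma vec_subspace_imp_subspace: "vec.subspace (S :: (complex^'d) set) \<Longrightarrow> subspace S"
  unfolding subspace_def vec.subspace_def of_real_smult[symmetric] by blast

lemma inner_i_smult: "w \<bullet> (\<i> *s z) = ((- \<i>) *s w) \<bullet> (z :: complex^'d)"
  by (simp add: inner_vec_def inner_complex_def algebra_simps)

lemma smult_conv: "c *s (z :: complex^'d) = Re c *\<^sub>R z + Im c *\<^sub>R (\<i> *s z)"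
  by (simp add: vec_eq_iff complex_eq_iff)

text \<open>The product \<open>\<bullet>\<close> on \<open>complex^'d\<close> is the real part of
  the Hermitian one; self-adjointness and orthogonality are meant in this real sense
  throughout.\<close>

lemma hermitian_inner:
  assumes "hermitian (A :: complex^'d^'d::finite)"
  shows "(A *v z) \<bullet> w = z \<bullet> (A *v w)"
proof -
  have *: "(a * b) \<bullet> c = b \<bullet> (cnj a * c)" for a b c :: complex
    by (simp add: inner_complex_def algebra_simps)
  have h: "cnj (A $ i $ j) = A $ j $ i" for i j
    by (metis assms hermitian_def)
  have "(A *v z) \<bullet> w = (\<Sum>i\<in>UNIV. \<Sum>j\<in>UNIV. z $ j \<bullet> (cnj (A $ i $ j) * w $ i))"
    by (simp add: inner_vec_def matrix_vector_mult_def inner_sum_left *)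
  also have "\<dots> = (\<Sum>i\<in>UNIV. \<Sum>j\<in>UNIV. z $ j \<bullet> (A $ j $ i * w $ i))"
    by (simp add: h)
  also have "\<dots> = z \<bullet> (A *v w)"
    by (subst sum.swap) (simp add: inner_vec_def matrix_vector_mult_def inner_sum_right)
  finally show ?thesis .
qed

text \<open>The vector \<open>axis a 1\<close> detects the real part of an entry; the real inner
  product sees the imaginary part only through \<open>axis a \<i>\<close>.\<close>

lemma hermitianI:
  assumes *: "\<And>z w. ((A :: complex^'d^'d::finite) *v z) \<bullet> w = z \<bullet> (A *v w)"
  shows "hermitian A"
  unfolding hermitian_def
proof (intro allI)
  fix a b
  have A: "(A *v axis j c) $ i = A $ i $ j * c" for i j c
    by (simp add: matrix_vector_mult_def axis_def if_distrib[of "\<lambda>x. _ * x"] cong: if_cong)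
  have "Re (A $ a $ b) = Re (A $ b $ a)"
    using *[of "axis b 1" "axis a 1"]
    by (simp add: inner_axis inner_commute[of "axis b 1"] A inner_complex_def)
  moreover have "Im (A $ a $ b) = - Im (A $ b $ a)"
    using *[of "axis b 1" "axis a \<i>"]
    by (simp add: inner_axis inner_commute[of "axis b 1"] A inner_complex_def)
  ultimately show "A $ a $ b = cnj (A $ b $ a)"
    by (simp add: complex_eq_iff)
qed

text \<open>A maximiser of the Rayleigh quotient on the unit sphere of an invariant subspace is an
  eigenvector.\<close>

lemma hermitian_eigenvector_in_invariant_subspace:
  assumes A: "hermitian (A :: complex^'d^'d::finite)" and S: "subspace S"
    and inv: "\<And>z. z \<in> S \<Longrightarrow> A *v z \<in> S" and ne: "S \<noteq> {0}"
  obtains r z where "z \<in> S" "z \<noteq> 0" "A *v z = r *\<^sub>R z"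
proof -
  let ?f = "\<lambda>z. z \<bullet> (A *v z)"
  have lin: "linear ((*v) A)"
    by (rule linearI) (auto simp: matrix_vector_right_distrib of_real_smult[symmetric] vec.scale)
  have cont: "continuous_on X ((*v) A)" for X
    by (simp add: lin linear_continuous_on linear_conv_bounded_linear[symmetric])
  have "compact (S \<inter> sphere 0 1)"
    by (simp add: S closed_subspace closed_Int_compact)
  moreover have "S \<inter> sphere 0 1 \<noteq> {}"
  proof -
    obtain z where "z \<in> S" "z \<noteq> 0" using ne S subspace_0 by blast
    then have "(1 / norm z) *\<^sub>R z \<in> S \<inter> sphere 0 1" using S by (simp add: subspace_scale)
    then show ?thesis by blast
  qed
  ultimately obtain z where "z \<in> S \<inter> sphere 0 1" "\<forall>w\<in>S \<inter> sphere 0 1. ?f w \<le> ?f z"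
    using continuous_attains_sup[OF _ _ continuous_on_inner[OF continuous_on_id cont], of "S \<inter> sphere 0 1"]
    by blast
  then have z: "z \<in> S" "norm z = 1"
    and max: "\<And>w. w \<in> S \<Longrightarrow> norm w = 1 \<Longrightarrow> ?f w \<le> ?f z"
    by auto
  define r where "r = ?f z"
  have le: "?f w \<le> r * (w \<bullet> w)" if "w \<in> S" for w
  proof (cases "w = 0")
    case False
    have "?f ((1 / norm w) *\<^sub>R w) \<le> r"
      unfolding r_def using that False S by (intro max) (auto simp: subspace_scale)
    then have "?f w / (norm w)\<^sup>2 \<le> r"
      by (simp add: linear_scale[OF lin] power2_eq_square)
    then show ?thesis using False by (simp add: field_simps power2_norm_eq_inner)
  qed simp
  define w where "w = A *v z - r *\<^sub>R z"
  have w: "w \<in> S" using z inv S by (simp add: w_def subspace_diff subspace_scale)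
  \<comment> \<open>The maximum property at \<open>z + t *\<^sub>R w\<close>. Since \<open>w\<close>
    is the residual, the term of first order in \<open>t\<close> is
    \<open>2 * t * (w \<bullet> w)\<close>, which a maximum excludes unless
    \<open>w = 0\<close>.\<close>
  have key: "2 * t * (w \<bullet> w) + t\<^sup>2 * (?f w - r * (w \<bullet> w)) \<le> 0" for t
  proof -
    have a: "?f (z + t *\<^sub>R w) \<le> r * ((z + t *\<^sub>R w) \<bullet> (z + t *\<^sub>R w))"
      using z w S by (intro le) (simp add: subspace_add subspace_scale)
    have b: "?f (z + t *\<^sub>R w) = r + 2 * t * (w \<bullet> (A *v z)) + t\<^sup>2 * ?f w"
      using hermitian_inner[OF A, of z w]
      by (simp add: r_def linear_add[OF lin] linear_scale[OF lin] algebra_simps inner_commute power2_eq_square)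
    have c: "(z + t *\<^sub>R w) \<bullet> (z + t *\<^sub>R w) = 1 + 2 * t * (w \<bullet> z) + t\<^sup>2 * (w \<bullet> w)"
      using z power2_norm_eq_inner[of z] by (simp add: algebra_simps inner_commute power2_eq_square)
    have "w \<bullet> w = w \<bullet> (A *v z) - r * (w \<bullet> z)"
      by (subst (2) w_def) (simp add: inner_diff_right)
    then have "t * (w \<bullet> w) = t * (w \<bullet> (A *v z) - r * (w \<bullet> z))"
      by (rule arg_cong)
    then show ?thesis using a[unfolded b c] by (simp add: algebra_simps)
  qed
  have "w = 0"
  proof (rule ccontr)
    assume "w \<noteq> 0"
    then have pos: "w \<bullet> w > 0" by simp
    define c where "c = r * (w \<bullet> w) - ?f w"
    \<comment> \<open>\<open>key\<close> reads
      \<open>2 * t * (w \<bullet> w) \<le> t\<^sup>2 * c\<close>. This choice makes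
      \<open>t * c\<close> smaller than \<open>w \<bullet> w\<close>; the summand \<open>1\<close>
      keeps the denominator positive when \<open>c = 0\<close>.\<close>
    define t where "t = (w \<bullet> w) / (c + 1)"
    have "c \<ge> 0" using le[OF w] by (simp add: c_def)
    then have "t > 0" "t * c < w \<bullet> w" using pos by (auto simp: t_def field_simps)
    then have "t * (t * c) < t * (2 * (w \<bullet> w))"
      using pos by (intro mult_strict_left_mono) linarith+
    then show False using key[of t] by (simp add: c_def algebra_simps power2_eq_square)
  qed
  then have "A *v z = r *\<^sub>R z" by (simp add: w_def)
  then show ?thesis using that z by fastforce
qed

section \<open>Spectral subspaces and the spectral theorem\<close>

text \<open>One notion for the fibres of the eigenbundle, where \<open>M\<close> consists of the
  values of the chosen bands, and for counting eigenvalues, where \<open>M\<close> is a half-line or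
  its complement. Values outside the spectrum contribute only the zero vector, so \<open>M\<close>
  may be infinite.\<close>

definition spectral_space :: "complex^'d^'d \<Rightarrow> real set \<Rightarrow> (complex^'d::finite) set" where
  "spectral_space A M = vec.span (\<Union>y\<in>M. eigenspace A y)"

definition spectrum :: "complex^'d^'d \<Rightarrow> real set" where
  "spectrum A = {y. eigenspace (A :: complex^'d^'d::finite) y \<noteq> {0}}"

lemma eigenspace_iff: "z \<in> eigenspace A y \<longleftrightarrow> A *v z = y *\<^sub>R z"
  by (simp add: eigenspace_def of_real_smult)

lemma subspace_eigenspace: "vec.subspace (eigenspace A y)"
  unfolding eigenspace_def vec.subspace_def
  by (auto simp: vec.scale matrix_vector_right_distrib vec.scale_right_distrib vec.scale_left_commute)

lemma zero_in_eigenspace [simp]: "0 \<in> eigenspace A y"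
  using subspace_eigenspace vec.subspace_0 by blast

lemma subspace_spectral_space: "vec.subspace (spectral_space A M)"
  by (simp add: spectral_space_def)

lemma eigenspace_subset_spectral_space: "y \<in> M \<Longrightarrow> eigenspace A y \<subseteq> spectral_space A M"
  unfolding spectral_space_def by (meson UN_upper order_trans vec.span_superset)

lemma spectral_space_insert:
  "spectral_space A (insert y M) = {a + b | a b. a \<in> eigenspace A y \<and> b \<in> spectral_space A M}"
  unfolding spectral_space_def
  using vec.span_Un[of "eigenspace A y" "\<Union>y\<in>M. eigenspace A y"]
  by (auto simp: vec.span_eq_iff[THEN iffD2, OF subspace_eigenspace])

lemma spectral_space_restrict: "spectral_space A (M \<inter> spectrum A) = spectral_space A M"
proof -
  have "eigenspace A y \<subseteq> spectral_space A (M \<inter> spectrum A)" if "y \<in> M" for y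
    using that eigenspace_subset_spectral_space[of y "M \<inter> spectrum A" A]
      vec.subspace_0[OF subspace_spectral_space[of A "M \<inter> spectrum A"]]
    by (cases "y \<in> spectrum A") (auto simp: spectrum_def)
  then have "spectral_space A M \<subseteq> spectral_space A (M \<inter> spectrum A)"
    unfolding spectral_space_def[of A M]
    by (intro vec.span_minimal subspace_spectral_space) blast
  moreover have "spectral_space A (M \<inter> spectrum A) \<subseteq> spectral_space A M"
    unfolding spectral_space_def by (intro vec.span_mono) blast
  ultimately show ?thesis by blast
qed

context
  fixes A :: "complex^'d^'d::finite"
  assumes A: "hermitian A"
begin

lemma eigenspaces_orthogonal:
  assumes "z \<in> eigenspace A y" "w \<in> eigenspace A x" "x \<noteq> y"
  shows "z \<bullet> w = 0"
proof -
  have "y * (z \<bullet> w) = x * (z \<bullet> w)"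
    using hermitian_inner[OF A, of z w] assms by (simp add: eigenspace_iff)
  then show ?thesis using assms by simp
qed

text \<open>One nonzero eigenvector for each eigenvalue gives an orthogonal, hence independent,
  family.\<close>

lemma finite_spectrum: "finite (spectrum A)"
proof -
  have "\<forall>y\<in>spectrum A. \<exists>z. z \<in> eigenspace A y \<and> z \<noteq> 0"
    using zero_in_eigenspace by (auto simp: spectrum_def)
  then obtain f where f: "\<And>y. y \<in> spectrum A \<Longrightarrow> f y \<in> eigenspace A y \<and> f y \<noteq> 0"
    by metis
  have inj: "inj_on f (spectrum A)"
    using f eigenspaces_orthogonal by (metis inj_onI inner_eq_zero_iff)
  have "pairwise orthogonal (f ` spectrum A)"
    unfolding pairwise_def orthogonal_def using f eigenspaces_orthogonal by blast
  then have "finite (f ` spectrum A)"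
    using f by (intro independent_imp_finite pairwise_orthogonal_independent) auto
  then show ?thesis using inj finite_imageD by blast
qed

lemma spectral_spaceE:
  assumes "z \<in> spectral_space A M"
  obtains f where "\<And>y. f y \<in> eigenspace A y" "z = (\<Sum>y\<in>M \<inter> spectrum A. f y)"
proof -
  have "\<exists>f. (\<forall>y. f y \<in> eigenspace A y) \<and> z = (\<Sum>y\<in>M. f y)"
    if "finite M" "z \<in> spectral_space A M" for M z
    using that
  proof (induction M arbitrary: z)
    case empty
    then have "z = 0" by (simp add: spectral_space_def)
    then show ?case by (auto intro!: exI[of _ "\<lambda>_. 0"])
  next
    case (insert x M)
    then obtain a b where ab: "z = a + b" "a \<in> eigenspace A x" "b \<in> spectral_space A M"
      by (auto simp: spectral_space_insert)
    with insert obtain f where f: "\<forall>y. f y \<in> eigenspace A y" "b = (\<Sum>y\<in>M. f y)" by blast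
    have "(\<Sum>y\<in>M. f y) = (\<Sum>y\<in>M. (f(x := a)) y)" using insert by (intro sum.cong) auto
    then show ?case using ab f insert by (intro exI[of _ "f(x := a)"]) auto
  qed
  then show ?thesis
    using assms that spectral_space_restrict[of A M] finite_spectrum by (metis finite_Int)
qed

lemma spectral_spaces_orthogonal:
  assumes "z \<in> spectral_space A M" "w \<in> spectral_space A N" "M \<inter> N = {}"
  shows "z \<bullet> w = 0"
proof -
  obtain f g where f: "\<And>y. f y \<in> eigenspace A y" "z = (\<Sum>y\<in>M \<inter> spectrum A. f y)"
    and g: "\<And>y. g y \<in> eigenspace A y" "w = (\<Sum>y\<in>N \<inter> spectrum A. g y)"
    using assms(1,2) by (metis spectral_spaceE)
  have "f x \<bullet> g y = 0" if "x \<in> M" "y \<in> N" for x y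
    using eigenspaces_orthogonal[OF f(1) g(1), of y x] that assms(3) by blast
  then show ?thesis by (simp add: f(2) g(2) inner_sum_left inner_sum_right)
qed

text \<open>The orthogonal complement of the sum of all eigenspaces is invariant under
  \<open>A\<close>; were it nonzero, it would contain an eigenvector, which would be orthogonal to
  itself.\<close>

lemma spectral_space_UNIV: "spectral_space A UNIV = UNIV"
proof (rule ccontr)
  let ?W = "spectral_space A UNIV"
  assume "?W \<noteq> UNIV"
  have sub: "subspace ?W" by (simp add: subspace_spectral_space vec_subspace_imp_subspace)
  have "span ?W = ?W" using sub span_eq_iff by blast
  then obtain x where x: "x \<noteq> 0" "\<And>w. w \<in> ?W \<Longrightarrow> orthogonal x w"
    using \<open>?W \<noteq> UNIV\<close> orthogonal_to_subspace_exists_gen[of ?W UNIV] by (metis psubsetI span_UNIV subset_UNIV)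
  define S where "S = {z. \<forall>w\<in>?W. w \<bullet> z = 0}"
  have inv: "A *v w \<in> ?W" if w: "w \<in> ?W" for w
  proof -
    obtain f where f: "\<And>y. f y \<in> eigenspace A y" "w = (\<Sum>y\<in>UNIV \<inter> spectrum A. f y)"
      using spectral_spaceE[OF w] by metis
    have "A *v w = (\<Sum>y\<in>UNIV \<inter> spectrum A. y *\<^sub>R f y)"
      using f(1) by (simp add: f(2) vec.sum eigenspace_iff)
    also have "\<dots> \<in> ?W"
      using f(1) eigenspace_subset_spectral_space[of _ UNIV A] sub
      by (intro subspace_sum subspace_scale) auto
    finally show ?thesis .
  qed
  have "x \<in> S" using x by (auto simp: S_def orthogonal_def inner_commute)
  moreover have "subspace S"
    by (auto simp: S_def subspace_def inner_add_right)
  moreover have "A *v z \<in> S" if "z \<in> S" for z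
    using that inv hermitian_inner[OF A] by (auto simp: S_def) metis
  ultimately obtain r z where z: "z \<in> S" "z \<noteq> 0" "A *v z = r *\<^sub>R z"
    using hermitian_eigenvector_in_invariant_subspace[OF A, of S] x(1) by (metis singletonD)
  then have "z \<in> ?W" using eigenspace_subset_spectral_space[of r UNIV A] by (auto simp: eigenspace_iff)
  then show False using z by (auto simp: S_def)
qed

lemma dim_spectral_space:
  "vec.dim (spectral_space A M) = (\<Sum>y\<in>M \<inter> spectrum A. vec.dim (eigenspace A y))"
proof -
  have "vec.dim (spectral_space A M) = (\<Sum>y\<in>M. vec.dim (eigenspace A y))" if "finite M" for M
    using that
  proof (induction M)
    case empty
    show ?case by (simp add: spectral_space_def)
  next
    case (insert x M)
    have "z = 0" if "z \<in> eigenspace A x" "z \<in> spectral_space A M" for z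
      using that insert spectral_spaces_orthogonal[of z "{x}" z M]
        eigenspace_subset_spectral_space[of x "{x}" A] by auto
    then have "eigenspace A x \<inter> spectral_space A M = {0}"
      using vec.subspace_0[OF subspace_spectral_space[of A M]] by auto
    then show ?case
      using vec.dim_sums_Int[OF subspace_eigenspace[of A x] subspace_spectral_space[of A M]] insert
      by (simp add: spectral_space_insert)
  qed
  then show ?thesis using finite_spectrum spectral_space_restrict[of A M] by (metis finite_Int)
qed

section \<open>Counting eigenvalues by Rayleigh quotients\<close>

lemma eigenvalue_count_eq: "eigenvalue_count A x = vec.dim (spectral_space A {..x})"
proof -
  have "{..x} \<inter> spectrum A = {y. y \<le> x \<and> eigenspace A y \<noteq> {0}}" by (auto simp: spectrum_def)
  then show ?thesis by (simp add: dim_spectral_space eigenvalue_count_def)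
qed

lemma dim_spectral_space_split:
  "vec.dim (spectral_space A M) + vec.dim (spectral_space A (- M)) = CARD('d)"
proof -
  have "(\<Sum>y\<in>M \<inter> spectrum A. vec.dim (eigenspace A y)) + (\<Sum>y\<in>- M \<inter> spectrum A. vec.dim (eigenspace A y))
    = (\<Sum>y\<in>(M \<inter> spectrum A) \<union> (- M \<inter> spectrum A). vec.dim (eigenspace A y))"
    using finite_spectrum by (intro sum.union_disjoint[symmetric]) auto
  also have "(M \<inter> spectrum A) \<union> (- M \<inter> spectrum A) = UNIV \<inter> spectrum A" by blast
  finally have "(\<Sum>y\<in>M \<inter> spectrum A. vec.dim (eigenspace A y)) + (\<Sum>y\<in>- M \<inter> spectrum A. vec.dim (eigenspace A y))
    = (\<Sum>y\<in>UNIV \<inter> spectrum A. vec.dim (eigenspace A y))" .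
  then show ?thesis
    using dim_spectral_space[of UNIV] spectral_space_UNIV
    by (simp add: dim_spectral_space vec_dim_card del: vec.dim_UNIV)
qed

lemma rayleigh_quotient:
  assumes "\<And>y. f y \<in> eigenspace A y" "z = (\<Sum>y\<in>M. f y)" "finite M"
  shows "z \<bullet> z = (\<Sum>y\<in>M. f y \<bullet> f y)" "z \<bullet> (A *v z) = (\<Sum>y\<in>M. y * (f y \<bullet> f y))"
proof -
  have *: "z \<bullet> f y = f y \<bullet> f y" if "y \<in> M" for y
  proof -
    have "(\<Sum>x\<in>M - {y}. f x \<bullet> f y) = 0"
      using eigenspaces_orthogonal[OF assms(1) assms(1)] by (intro sum.neutral) auto
    then show ?thesis
      by (simp add: assms(2) sum.remove[OF assms(3) that] inner_add_left) (simp add: inner_sum_left)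
  qed
  have "z \<bullet> z = (\<Sum>y\<in>M. z \<bullet> f y)" by (subst (2) assms(2)) (rule inner_sum_right)
  then show "z \<bullet> z = (\<Sum>y\<in>M. f y \<bullet> f y)" using * by simp
  have "A *v z = (\<Sum>y\<in>M. y *\<^sub>R f y)"
    using assms(1) by (simp add: assms(2) vec.sum eigenspace_iff)
  then show "z \<bullet> (A *v z) = (\<Sum>y\<in>M. y * (f y \<bullet> f y))"
    using * by (simp add: inner_sum_right)
qed

lemma rayleigh_le:
  assumes "z \<in> spectral_space A {..x}"
  shows "z \<bullet> (A *v z) \<le> x * (z \<bullet> z)"
proof -
  obtain f where f: "\<And>y. f y \<in> eigenspace A y" "z = (\<Sum>y\<in>{..x} \<inter> spectrum A. f y)"
    using spectral_spaceE[OF assms] by metis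
  show ?thesis
    using finite_spectrum
    by (auto simp: rayleigh_quotient[OF f] sum_distrib_left intro!: sum_mono mult_right_mono)
qed

lemma rayleigh_gt:
  assumes "z \<in> spectral_space A (- {..x})" "z \<noteq> 0"
  shows "z \<bullet> (A *v z) > x * (z \<bullet> z)"
proof -
  let ?M = "- {..x} \<inter> spectrum A"
  obtain f where f: "\<And>y. f y \<in> eigenspace A y" "z = (\<Sum>y\<in>?M. f y)"
    using spectral_spaceE[OF assms(1)] by metis
  have fin: "finite ?M" using finite_spectrum by simp
  obtain y where y: "y \<in> ?M" "f y \<noteq> 0"
    using assms(2) f(2) by (metis (no_types, lifting) sum.neutral)
  have "(\<Sum>y\<in>?M. x * (f y \<bullet> f y)) < (\<Sum>y\<in>?M. y * (f y \<bullet> f y))"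
    using y fin by (intro sum_strict_mono_ex1 bexI[of _ y]) (auto intro!: mult_right_mono)
  then show ?thesis
    using fin by (simp add: rayleigh_quotient[OF f] sum_distrib_left)
qed

text \<open>The Courant-Fischer argument: on nonzero vectors of the spectral space above
  \<open>x\<close> the Rayleigh quotient exceeds \<open>x\<close>, so \<open>S\<close> meets that
  space only in zero and the two dimensions add up to at most \<open>CARD('d)\<close>.\<close>

lemma dim_le_eigenvalue_count:
  assumes "vec.subspace S" "\<And>z. z \<in> S \<Longrightarrow> z \<bullet> (A *v z) \<le> x * (z \<bullet> z)"
  shows "vec.dim S \<le> eigenvalue_count A x"
proof -
  let ?T = "spectral_space A (- {..x})"
  have "z = 0" if "z \<in> S" "z \<in> ?T" for z
    using assms(2)[OF that(1)] rayleigh_gt[OF that(2)] by (meson not_less)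
  moreover have "0 \<in> S \<inter> ?T"
    by (intro IntI vec.subspace_0 assms(1) subspace_spectral_space)
  ultimately have "S \<inter> ?T = {0}" by blast
  then have "vec.dim S + vec.dim ?T = vec.dim {a + b | a b. a \<in> S \<and> b \<in> ?T}"
    using vec.dim_sums_Int[OF assms(1) subspace_spectral_space[of A "- {..x}"]] by simp
  also have "\<dots> \<le> CARD('d)"     unfolding vec_dim_card[where 'n='d and 'a=complex, symmetric] by (rule vec.dim_subset[OF subset_UNIV])
  finally show ?thesis using dim_spectral_space_split[of "{..x}"] by (simp add: eigenvalue_count_eq)
qed

lemma eigenvalue_count_le_CARD: "eigenvalue_count A x \<le> CARD('d)"
  using dim_spectral_space_split[of "{..x}"] by (simp add: eigenvalue_count_eq)

text \<open>\<open>LEAST\<close> over the reals needs a minimum that is attained. The count jumps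
  only at eigenvalues, so the minimum may be taken over a finite set of eigenvalues.\<close>

lemma band_least_exists:
  assumes "i \<in> {1..CARD('d)}"
  obtains b where "b \<in> spectrum A" "i \<le> eigenvalue_count A b"
    "\<And>x. i \<le> eigenvalue_count A x \<Longrightarrow> b \<le> x" "band A i = b"
proof -
  let ?C = "{y \<in> spectrum A. i \<le> eigenvalue_count A y}"
  have fin: "finite ?C" using finite_spectrum by simp
  have *: "\<exists>y\<in>?C. y \<le> x" if x: "i \<le> eigenvalue_count A x" for x
  proof -
    let ?M = "{..x} \<inter> spectrum A"
    have "?M \<noteq> {}"
      using x assms dim_spectral_space[of "{..x}"] by (auto simp: eigenvalue_count_eq)
    \<comment> \<open>The largest eigenvalue up to \<open>x\<close> has the same count as
      \<open>x\<close> itself.\<close>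
    then have m: "Max ?M \<in> ?M" using finite_spectrum by (intro Max_in) auto
    moreover have "{..Max ?M} \<inter> spectrum A = ?M"
      using m finite_spectrum by (auto intro: Max_ge)
    ultimately have "Max ?M \<in> ?C" "Max ?M \<le> x"
      using x by (auto simp: eigenvalue_count_eq dim_spectral_space)
    then show ?thesis by blast
  qed
  have "spectrum A \<noteq> {}"
    using dim_spectral_space[of UNIV] spectral_space_UNIV vec_dim_card[where 'n='d and 'a=complex]
    by (metis Int_empty_right sum.empty zero_less_card_finite less_irrefl)
  have "{..Max (spectrum A)} \<inter> spectrum A = UNIV \<inter> spectrum A"
    using finite_spectrum by auto
  then have "eigenvalue_count A (Max (spectrum A)) = CARD('d)"
    using dim_spectral_space[of UNIV] spectral_space_UNIV
    by (simp add: eigenvalue_count_eq dim_spectral_space vec_dim_card del: vec.dim_UNIV)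
  then have "?C \<noteq> {}" using *[of "Max (spectrum A)"] assms by auto
  then have m: "Min ?C \<in> ?C" using fin by (rule Min_in[rotated])
  have least: "Min ?C \<le> x" if "i \<le> eigenvalue_count A x" for x
    using *[OF that] fin by (meson Min_le order_trans)
  have "band A i = Min ?C"
    unfolding band_def using m least by (intro Least_equality) auto
  with m least show ?thesis by (intro that[of "Min ?C"]) auto
qed

lemma band_in_spectrum: "i \<in> {1..CARD('d)} \<Longrightarrow> band A i \<in> spectrum A"
  by (metis band_least_exists)

lemma le_eigenvalue_count_band: "i \<in> {1..CARD('d)} \<Longrightarrow> i \<le> eigenvalue_count A (band A i)"
  by (metis band_least_exists)

lemma band_le: "i \<in> {1..CARD('d)} \<Longrightarrow> i \<le> eigenvalue_count A x \<Longrightarrow> band A i \<le> x"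
  by (metis band_least_exists)

lemma spectrum_eq_bands: "spectrum A = band A ` {1..CARD('d)}"
proof
  show "spectrum A \<subseteq> band A ` {1..CARD('d)}"
  proof
    fix y assume y: "y \<in> spectrum A"
    \<comment> \<open>The largest index of a band with value \<open>y\<close>; below
      \<open>y\<close> the count is smaller by at least the dimension of the eigenspace.\<close>
    define i where "i = eigenvalue_count A y"
    have count: "i = (\<Sum>x\<in>{..y} \<inter> spectrum A. vec.dim (eigenspace A x))"
      by (simp only: i_def eigenvalue_count_eq dim_spectral_space)
    have "vec.dim (eigenspace A y) \<noteq> 0"
      using y by (auto simp: spectrum_def vec.dim_eq_0)
    then have pos: "vec.dim (eigenspace A y) > 0" by (rule iffD1[OF neq0_conv])
    have "(\<Sum>x\<in>{y}. vec.dim (eigenspace A x)) \<le> i"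
      unfolding count using y finite_spectrum by (intro sum_mono2) auto
    with pos have i: "i \<in> {1..CARD('d)}" using eigenvalue_count_le_CARD i_def by simp
    have "\<not> band A i < y"
    proof
      assume less: "band A i < y"
      let ?M = "{..band A i} \<inter> spectrum A"
      have "(\<Sum>x\<in>insert y ?M. vec.dim (eigenspace A x)) \<le> (\<Sum>x\<in>{..y} \<inter> spectrum A. vec.dim (eigenspace A x))"
        using y less finite_spectrum by (intro sum_mono2) auto
      moreover have "(\<Sum>x\<in>insert y ?M. vec.dim (eigenspace A x))
          = vec.dim (eigenspace A y) + eigenvalue_count A (band A i)"
        unfolding eigenvalue_count_eq[of "band A _"] dim_spectral_space
        using less finite_spectrum by (subst sum.insert) auto
      ultimately show False using pos le_eigenvalue_count_band[OF i] count by linarith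
    qed
    then have "band A i = y" using band_le[OF i, of y] i_def by simp
    then show "y \<in> band A ` {1..CARD('d)}" using i by blast
  qed
qed (use band_in_spectrum in auto)

end

section \<open>Continuity of the bands\<close>

text \<open>On the span of the eigenvectors of \<open>A\<close> up to \<open>band A i\<close>, of
  dimension at least \<open>i\<close>, the Rayleigh quotient of \<open>A'\<close> is at most
  \<open>band A i + e\<close>. So \<open>A'\<close> has at least \<open>i\<close> eigenvalues up to
  this bound.\<close>

lemma weyl_inequality_band:
  assumes "hermitian A" "hermitian (A' :: complex^'d^'d::finite)" "i \<in> {1..CARD('d)}"
    and "\<And>z. \<bar>z \<bullet> ((A' - A) *v z)\<bar> \<le> e * (z \<bullet> z)"
  shows "band A' i \<le> band A i + e"
proof (rule band_le[OF assms(2,3)])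
  let ?S = "spectral_space A {..band A i}"
  have "i \<le> eigenvalue_count A (band A i)" by (rule le_eigenvalue_count_band[OF assms(1,3)])
  also have "\<dots> = vec.dim ?S" by (rule eigenvalue_count_eq[OF assms(1)])
  also have "\<dots> \<le> eigenvalue_count A' (band A i + e)"
  proof (rule dim_le_eigenvalue_count[OF assms(2) subspace_spectral_space])
    fix z assume "z \<in> ?S"
    then have "z \<bullet> (A *v z) \<le> band A i * (z \<bullet> z)" by (rule rayleigh_le[OF assms(1)])
    moreover have "A' *v z = A *v z + (A' - A) *v z"
      by (simp add: matrix_vector_mult_add_rdistrib[symmetric])
    ultimately show "z \<bullet> (A' *v z) \<le> (band A i + e) * (z \<bullet> z)"
      using assms(4)[of z] by (simp add: algebra_simps inner_add_right)
  qed
  finally show "i \<le> eigenvalue_count A' (band A i + e)" .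
qed

lemma bounded_bilinear_matrix_vector_mult:
  "bounded_bilinear (\<lambda>(A :: complex^'d^'d::finite) z. A *v z)"
  unfolding bilinear_conv_bounded_bilinear[symmetric] bilinear_def
  by (auto intro!: linearI simp: matrix_vector_mult_add_rdistrib matrix_vector_right_distrib
      of_real_smult[symmetric] vec.scale)
    (simp add: vec_eq_iff matrix_vector_mult_def scaleR_right.sum[symmetric] scaleR_conv_of_real[symmetric])

text \<open>Weyl's inequality in both directions makes each band Lipschitz on the Hermitian
  matrices. Numbering with multiplicity is what keeps the bands continuous through
  crossings.\<close>

lemma continuous_on_band:
  fixes A :: "'x::metric_space \<Rightarrow> complex^'d^'d::finite"
  assumes "continuous_on X A" "\<And>x. hermitian (A x)" "i \<in> {1..CARD('d)}"
  shows "continuous_on X (\<lambda>x. band (A x) i)"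
proof -
  obtain K where K: "K > 0" "\<And>(M :: complex^'d^'d) z. norm (M *v z) \<le> norm M * norm z * K"
    using bounded_bilinear.pos_bounded[OF bounded_bilinear_matrix_vector_mult] by blast
  have le: "band M' i \<le> band M i + K * norm (M' - M)" if "hermitian M" "hermitian M'" for M M' :: "complex^'d^'d"
  proof (rule weyl_inequality_band[OF that assms(3)])
    fix z
    have "\<bar>z \<bullet> ((M' - M) *v z)\<bar> \<le> norm z * norm ((M' - M) *v z)"
      by (rule Cauchy_Schwarz_ineq2)
    also have "\<dots> \<le> norm z * (norm (M' - M) * norm z * K)"
      using K(2) by (intro mult_left_mono) auto
    finally show "\<bar>z \<bullet> ((M' - M) *v z)\<bar> \<le> K * norm (M' - M) * (z \<bullet> z)"
      by (simp add: power2_norm_eq_inner[symmetric] power2_eq_square mult_ac)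
  qed
  have dist: "dist (band M i) (band M' i) \<le> K * dist M M'" if "hermitian M" "hermitian M'" for M M' :: "complex^'d^'d"
    using le[OF that] le[OF that(2,1)] by (simp add: dist_real_def dist_norm norm_minus_commute abs_le_iff)
  have "continuous_on {M :: complex^'d^'d. hermitian M} (\<lambda>M. band M i)"
  proof (rule continuous_onI)
    fix M :: "complex^'d^'d" and e :: real assume *: "M \<in> {M. hermitian M}" "e > 0"
    have "dist (band M' i) (band M i) \<le> e" if "M' \<in> {M. hermitian M}" "dist M' M < e / K" for M'
    proof -
      have "dist (band M' i) (band M i) \<le> K * dist M' M" using dist * that by simp
      also have "\<dots> \<le> e" using that K(1) by (simp add: field_simps)
      finally show ?thesis .
    qed
    then show "\<exists>d>0. \<forall>M'\<in>{M. hermitian M}. dist M' M < d \<longrightarrow> dist (band M' i) (band M i) \<le> e"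
      using * K(1) by (intro exI[of _ "e / K"]) auto
  qed
  then show ?thesis
    using assms by (auto intro: continuous_on_compose2)
qed

section \<open>Smoothness of the projection to isolated bands\<close>

declare C_k.simps(2) [simp del]

lemma has_derivative_vecI:
  fixes f :: "'x::real_normed_vector \<Rightarrow> 'a::real_normed_vector^'m::finite"
  assumes "\<And>i. ((\<lambda>x. f x $ i) has_derivative (\<lambda>u. D u $ i)) F"
  shows "(f has_derivative D) F"
proof -
  have bl: "bounded_linear (axis i :: 'a \<Rightarrow> 'a^'m)" for i
  proof (rule bounded_linear_intro[where K = 1])
    show "norm (axis i x :: 'a^'m) \<le> norm x * 1" for x :: 'a
      by (simp add: norm_vec_def L2_set_def axis_def if_distrib[of norm] if_distrib[of "\<lambda>r. r\<^sup>2"] cong: if_cong)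
  qed (auto simp: axis_def vec_eq_iff)
  have sum: "v = (\<Sum>i\<in>UNIV. axis i (v $ i))" for v :: "'a^'m"
    by (simp add: vec_eq_iff axis_def if_distrib[of "\<lambda>f. f $ _"] cong: if_cong)
  have "((\<lambda>x. \<Sum>i\<in>UNIV. axis i (f x $ i)) has_derivative (\<lambda>u. \<Sum>i\<in>UNIV. axis i (D u $ i))) F"
    by (intro has_derivative_sum bounded_linear.has_derivative[OF bl] assms)
  then show ?thesis by (simp add: sum[symmetric])
qed

lemma bounded_bilinear_matrix_mult:
  "bounded_bilinear ((**) :: complex^'d^'d \<Rightarrow> complex^'d^'d \<Rightarrow> complex^'d^'d::finite)"
  unfolding bilinear_conv_bounded_bilinear[symmetric] bilinear_def
  by (auto intro!: linearI simp: vec_eq_iff matrix_matrix_mult_def algebra_simps sum.distrib scaleR_right.sum)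

interpretation matrix_mult: bounded_bilinear "(**) :: complex^'d^'d \<Rightarrow> complex^'d^'d \<Rightarrow> complex^'d^'d::finite"
  by (rule bounded_bilinear_matrix_mult)

lemmas matrix_distribs = matrix_mult.add_left matrix_mult.add_right matrix_mult.diff_left
  matrix_mult.diff_right matrix_mult.minus_left matrix_mult.minus_right

text \<open>\<open>C_k\<close> speaks of complex-valued functions, so matrices are treated entry by
  entry.\<close>

definition C_k_matrix :: "nat \<Rightarrow> (real^'n::finite \<Rightarrow> complex^'d^'d::finite) \<Rightarrow> bool" where
  "C_k_matrix m A \<longleftrightarrow> (\<forall>a b. C_k m (\<lambda>x. A x $ a $ b))"

lemma C_k_matrix_const [simp]: "C_k_matrix m (\<lambda>x. A)"
  by (simp add: C_k_matrix_def)

lemma C_k_matrix_add: "C_k_matrix m A \<Longrightarrow> C_k_matrix m B \<Longrightarrow> C_k_matrix m (\<lambda>x. A x + B x)"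
  by (simp add: C_k_matrix_def C_k_add)

lemma C_k_matrix_diff: "C_k_matrix m A \<Longrightarrow> C_k_matrix m B \<Longrightarrow> C_k_matrix m (\<lambda>x. A x - B x)"
  by (simp add: C_k_matrix_def C_k_diff)

lemma C_k_matrix_mult: "C_k_matrix m A \<Longrightarrow> C_k_matrix m B \<Longrightarrow> C_k_matrix m (\<lambda>x. A x ** B x)"
  by (simp add: C_k_matrix_def matrix_matrix_mult_def C_k_sum C_k_mult)

lemmas C_k_matrix_intros = C_k_matrix_const C_k_matrix_add C_k_matrix_diff C_k_matrix_mult

lemma C_k_matrix_entry: "C_k_matrix m A \<Longrightarrow> C_k m (\<lambda>x. A x $ a $ b)"
  by (simp add: C_k_matrix_def)

lemma C_k_matrix_imp_continuous:
  assumes "C_k_matrix m A"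
  shows "continuous_on UNIV A"
proof -
  have "continuous_on UNIV (\<lambda>x. \<chi> a b. A x $ a $ b)"
    using assms C_k_imp_continuous unfolding C_k_matrix_def
    by (intro continuous_on_vec_lambda) blast
  then show ?thesis by (simp add: vec_lambda_eta)
qed

lemma has_derivative_matrix_iff:
  fixes A :: "real^'n::finite \<Rightarrow> complex^'d^'d::finite"
  shows "(A has_derivative D) F \<longleftrightarrow> (\<forall>a b. ((\<lambda>x. A x $ a $ b) has_derivative (\<lambda>u. D u $ a $ b)) F)"
proof
  assume *: "\<forall>a b. ((\<lambda>x. A x $ a $ b) has_derivative (\<lambda>u. D u $ a $ b)) F"
  have "((\<lambda>x. A x $ a) has_derivative (\<lambda>u. D u $ a)) F" for a
    using * by (intro has_derivative_vecI) blast
  then show "(A has_derivative D) F" by (rule has_derivative_vecI)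
qed (auto intro: bounded_linear.has_derivative[OF bounded_linear_vec_nth])

lemma C_k_matrix_SucD:
  assumes "C_k_matrix (Suc m) A"
  shows "(A has_derivative (\<lambda>u. dir_deriv A u x)) (at x)" "C_k_matrix m (dir_deriv A u)"
proof -
  have *: "(A has_derivative (\<lambda>u. \<chi> a b. dir_deriv (\<lambda>x. A x $ a $ b) u x)) (at x)" for x
    using assms unfolding C_k_matrix_def has_derivative_matrix_iff
    by (auto intro: C_k_SucD(1))
  then have eq: "dir_deriv A u x = (\<chi> a b. dir_deriv (\<lambda>x. A x $ a $ b) u x)" for u x
    by (rule dir_deriv_eq)
  show "(A has_derivative (\<lambda>u. dir_deriv A u x)) (at x)" unfolding eq by (rule *)
  show "C_k_matrix m (dir_deriv A u)"
    using assms unfolding C_k_matrix_def eq[abs_def] by (auto intro: C_k_SucD(2))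
qed

lemma C_k_matrix_SucI:
  assumes "\<And>x. (A has_derivative D x) (at x)" "\<And>u. C_k_matrix m (\<lambda>x. D x u)"
  shows "C_k_matrix (Suc m) A"
  unfolding C_k_matrix_def
proof (intro allI)
  fix a b
  show "C_k (Suc m) (\<lambda>x. A x $ a $ b)"
    by (rule C_k_SucI[where g' = "\<lambda>x u. D x u $ a $ b"])
      (use assms in \<open>auto simp: has_derivative_matrix_iff C_k_matrix_def\<close>)
qed

section \<open>Orthogonal and spectral projections\<close>

text \<open>Justifies the definite description. The projection is first obtained from the real inner
  product and then shown to be complex linear.\<close>

lemma orthogonal_projection:
  assumes E: "vec.subspace (E :: (complex^'d::finite) set)"
  shows "orthogonal_projection E ** orthogonal_projection E = orthogonal_projection E"
    "hermitian (orthogonal_projection E)"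
    "range ((*v) (orthogonal_projection E)) = E"
proof -
  let ?Q = "\<lambda>P :: complex^'d^'d. P ** P = P \<and> hermitian P \<and> range ((*v) P) = E"
  have sE: "subspace E" using E by (rule vec_subspace_imp_subspace)
  let ?R = "\<lambda>z a. a \<in> E \<and> (\<forall>w\<in>E. w \<bullet> (z - a) = 0)"
  have "\<exists>a. ?R z a" for z
    using orthogonal_subspace_decomp_exists[of E z] span_eq_iff[THEN iffD2, OF sE]
    by (metis add_diff_cancel_left' orthogonal_def inner_commute)
  then obtain f where f: "\<And>z. ?R z (f z)" by metis
  have uniq: "f z = a" if "?R z a" for z a
  proof -
    have "f z - a \<in> E" using that f sE by (simp add: subspace_diff)
    then have "(f z - a) \<bullet> (z - a) = 0" "(f z - a) \<bullet> (z - f z) = 0" using that f by auto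
    then have "(f z - a) \<bullet> (f z - a) = 0" by (simp add: inner_diff_right)
    then show ?thesis by simp
  qed
  have add: "f (z + w) = f z + f w" for z w
  proof (rule uniq)
    have eq: "z + w - (f z + f w) = (z - f z) + (w - f w)" by simp
    show "?R (z + w) (f z + f w)"
      unfolding eq inner_add_right using f[of z] f[of w] sE by (simp add: subspace_add)
  qed
  have scale: "f (c *s z) = c *s f z" for c z
  proof (rule uniq)
    \<comment> \<open>A complex subspace is closed under multiplication by \<open>\<i>\<close>, so a
      vector that is orthogonal to it in the real sense stays so after complex scaling.\<close>
    have orth: "w \<bullet> (c *s v) = 0" if "w \<in> E" "\<forall>w\<in>E. w \<bullet> v = 0" for w v
    proof -
      have "(- \<i>) *s w \<in> E" using E that(1) by (rule vec.subspace_scale)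
      then have "w \<bullet> (\<i> *s v) = 0" "w \<bullet> v = 0" using that by (auto simp only: inner_i_smult)
      then show ?thesis unfolding smult_conv[of c v] by (simp add: inner_add_right)
    qed
    have "w \<bullet> (c *s (z - f z)) = 0" if "w \<in> E" for w
      using f[of z] that by (intro orth) auto
    then show "?R (c *s z) (c *s f z)"
      using f[of z] E by (simp add: vec.subspace_scale vec.scale_right_diff_distrib)
  qed
  have "Vector_Spaces.linear (*s) (*s) f"
    by (intro Vector_Spaces.linear.intro module_hom.intro module_hom_axioms.intro)
      (auto simp: add scale intro: vec.vector_space_axioms vec.module_axioms)
  then have P: "matrix f *v z = f z" for z by (rule matrix_works)
  have fE: "f a = a" if "a \<in> E" for a using that by (intro uniq) auto
  have ex: "?Q (matrix f)"
  proof (intro conjI)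
    show "matrix f ** matrix f = matrix f"
      by (simp add: matrix_eq matrix_vector_mul_assoc[symmetric] P fE f)
    have "range f \<subseteq> E" using f by blast
    moreover have "E \<subseteq> range f" using fE by (auto intro: range_eqI[OF sym])
    ultimately have "range f = E" by blast
    moreover have "(*v) (matrix f) = f" using P by blast
    ultimately show "range ((*v) (matrix f)) = E" by simp
    show "hermitian (matrix f)"
    proof (rule hermitianI)
      fix z w
      have "f z \<bullet> (w - f w) = 0" "f w \<bullet> (z - f z) = 0" using f by auto
      then show "(matrix f *v z) \<bullet> w = z \<bullet> (matrix f *v w)"
        by (simp add: P inner_diff_right inner_commute)
    qed
  qed
  \<comment> \<open>Equal ranges give \<open>P' ** P = P\<close> and \<open>P ** P' = P'\<close>;
    moving the self-adjoint factors across the inner product identifies the two matrices.\<close>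
  have unique: "P = P'" if "?Q P" "?Q P'" for P P'
  proof -
    have "P' *v (P *v z) = P *v z" for z
    proof -
      have "P *v z \<in> range ((*v) P')" using that rangeI[of "(*v) P" z] by simp
      then obtain w where "P *v z = P' *v w" by blast
      then show ?thesis using that by (simp add: matrix_vector_mul_assoc)
    qed
    moreover have "P *v (P' *v z) = P' *v z" for z
    proof -
      have "P' *v z \<in> range ((*v) P)" using that rangeI[of "(*v) P'" z] by simp
      then obtain w where "P' *v z = P *v w" by blast
      then show ?thesis using that by (simp add: matrix_vector_mul_assoc)
    qed
    ultimately have "(P *v z) \<bullet> w = (P' *v z) \<bullet> w" for z w
      using that hermitian_inner[of P z "P' *v w"] hermitian_inner[of P' "P *v z" w]
        hermitian_inner[of P' z w] by simp
    then have "P *v z = P' *v z" for z by (meson vector_eq_rdot)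
    then show ?thesis by (simp add: matrix_eq)
  qed
  have "?Q (orthogonal_projection E)"
    unfolding orthogonal_projection_def by (rule theI[of ?Q, OF ex]) (rule unique[OF _ ex])
  then show "orthogonal_projection E ** orthogonal_projection E = orthogonal_projection E"
    "hermitian (orthogonal_projection E)"
    "range ((*v) (orthogonal_projection E)) = E" by blast+
qed

abbreviation spectral_projection :: "complex^'d^'d::finite \<Rightarrow> real set \<Rightarrow> complex^'d^'d" where
  "spectral_projection A M \<equiv> orthogonal_projection (spectral_space A M)"

text \<open>Eigenvectors span, so matrix identities can be checked one eigenvalue at a time.\<close>

lemma matrix_eq_on_eigenvectors:
  assumes "hermitian A" "\<And>y z. z \<in> eigenspace A y \<Longrightarrow> X *v z = Y *v z"
  shows "X = (Y :: complex^'d^'d::finite)"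
proof -
  have "X *v z = Y *v z" for z
  proof -
    have "z \<in> spectral_space A UNIV" using spectral_space_UNIV[OF assms(1)] by simp
    then obtain f where f: "\<And>y. f y \<in> eigenspace A y" "z = (\<Sum>y\<in>UNIV \<inter> spectrum A. f y)"
      using spectral_spaceE[OF assms(1)] by metis
    then show ?thesis using assms(2)[OF f(1)] by (simp add: f(2) vec.sum)
  qed
  then show ?thesis by (simp add: matrix_eq)
qed

context
  fixes A :: "complex^'d^'d::finite" and M :: "real set"
  assumes A: "hermitian A"
begin

lemma spectral_projection_eigenvector:
  assumes "z \<in> eigenspace A y"
  shows "spectral_projection A M *v z = (if y \<in> M then z else 0)"
proof -
  let ?P = "spectral_projection A M"
  note P = orthogonal_projection[OF subspace_spectral_space[of A M]]
  show ?thesis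
  proof (cases "y \<in> M")
    case True
    then have "z \<in> range ((*v) ?P)"
      using assms eigenspace_subset_spectral_space P(3) by blast
    then show ?thesis using True P(1) by (auto simp: matrix_vector_mul_assoc)
  next
    case False
    have "z \<in> spectral_space A {y}" using assms eigenspace_subset_spectral_space by blast
    moreover have "?P *v z \<in> spectral_space A M" using P(3) by blast
    ultimately have "z \<bullet> (?P *v z) = 0"
      using False by (intro spectral_spaces_orthogonal[OF A]) auto
    then have "(?P *v z) \<bullet> (?P *v z) = 0"
      using hermitian_inner[OF P(2)] P(1) by (simp add: matrix_vector_mul_assoc)
    then show ?thesis using False by simp
  qed
qed

lemma spectral_projection_commute: "A ** spectral_projection A M = spectral_projection A M ** A"
proof (rule matrix_eq_on_eigenvectors[OF A])
  fix y z assume z: "z \<in> eigenspace A y"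
  then have "A *v z = of_real y *s z" by (simp add: eigenspace_def)
  with z show "(A ** spectral_projection A M) *v z = (spectral_projection A M ** A) *v z"
    by (simp add: matrix_vector_mul_assoc[symmetric] spectral_projection_eigenvector vec.scale)
qed

end

text \<open>The commutator with \<open>H\<close> on the part of \<open>Y\<close> that is off-diagonal with respect to \<open>P\<close> and
  \<open>1 - P\<close>, and the identity on the diagonal part. Since the derivative of \<open>P\<close> is off-diagonal, it is
  determined by its commutator with \<open>H\<close>.\<close>

definition block_op :: "complex^'d^'d \<Rightarrow> complex^'d^'d \<Rightarrow> complex^'d^'d \<Rightarrow> complex^'d^'d::finite" where
  "block_op P H Y = (let Q = mat 1 - P in
     (H ** P) ** Y ** Q + (H ** Q) ** Y ** P - P ** Y ** (Q ** H) - Q ** Y ** (P ** H)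
     + P ** Y ** P + Q ** Y ** Q)"

text \<open>For \<open>X = - dH\<close> the inner commutator is \<open>[P, dH]\<close>, so this is
  the off-diagonal right-hand side of the equation for \<open>dP\<close>. It is kept linear in
  \<open>X\<close> so that it also applies to the finite increment \<open>H - H'\<close>.\<close>

definition block_source :: "complex^'d^'d \<Rightarrow> complex^'d^'d \<Rightarrow> complex^'d^'d::finite" where
  "block_source P X = (let Q = mat 1 - P in
     P ** (X ** P - P ** X) ** Q + Q ** (X ** P - P ** X) ** P)"

text \<open>With \<Delta> = P' - P, the two commutation relations give
  \<open>[H, \<Delta>] = [H - H', P] + [H - H', \<Delta>]\<close>, whose off-diagonal part accounts
  for the first two terms. Idempotence gives \<Delta> = P \<Delta> + \<Delta> P + \<Delta> \<Delta>,
  hence the diagonal blocks of \<Delta> are those of \<Delta> \<Delta>, with a minus sign in the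
  \<open>P\<close> block. The whole right-hand side is therefore of second order in the
  increments.\<close>

lemma block_op_difference:
  assumes "P ** P = P" "P' ** P' = P'" "H ** P = P ** H" "H' ** P' = P' ** H'"
  shows "block_op P H (P' - P) - block_source P (H - H') =
    (let Q = mat 1 - P; \<Delta> = P' - P in
      P ** ((H - H') ** \<Delta> - \<Delta> ** (H - H')) ** Q + Q ** ((H - H') ** \<Delta> - \<Delta> ** (H - H')) ** P
      + Q ** (\<Delta> ** \<Delta>) ** Q - P ** (\<Delta> ** \<Delta>) ** P)"
proof -
  have r: "P ** (P ** X) = P ** X" "P' ** (P' ** X) = P' ** X"
    "H ** (P ** X) = P ** (H ** X)" "H' ** (P' ** X) = P' ** (H' ** X)" for X
    using assms by (simp_all add: matrix_mul_assoc)
  show ?thesis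
    unfolding block_op_def block_source_def Let_def
    by (simp add: matrix_distribs matrix_mul_assoc[symmetric] assms r algebra_simps)
qed

text \<open>On an eigenvector \<open>z\<close> of value \<open>y\<close>, the diagonal part forces
  one component of \<open>Y *v z\<close> to vanish. The other component \<open>u\<close> satisfies
  \<open>A *v u = y u\<close>, but lies in the block to which eigenvectors of value \<open>y\<close>
  do not belong, so it is zero as well.\<close>

lemma block_op_injective:
  assumes A: "hermitian A" and 0: "block_op (spectral_projection A M) A Y = 0"
  shows "Y = 0"
proof (rule matrix_eq_on_eigenvectors[OF A])
  fix y z assume z: "z \<in> eigenspace A y"
  define P where "P = spectral_projection A M"
  define Q where "Q = mat 1 - P"
  have PP: "P ** P = P"
    unfolding P_def using orthogonal_projection(1)[OF subspace_spectral_space] .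
  have AP: "A ** P = P ** A" unfolding P_def by (rule spectral_projection_commute[OF A])
  have PPv: "P *v (P *v u) = P *v u" and APv: "A *v (P *v u) = P *v (A *v u)" for u
    by (simp_all add: matrix_vector_mul_assoc PP AP)
  have Qv: "Q *v u = u - P *v u" for u
    by (simp add: Q_def matrix_vector_mult_diff_rdistrib)
  have T: "block_op P A Y *v z = A *v (P *v (Y *v (Q *v z))) + A *v (Q *v (Y *v (P *v z)))
      - P *v (Y *v (Q *v (A *v z))) - Q *v (Y *v (P *v (A *v z)))
      + P *v (Y *v (P *v z)) + Q *v (Y *v (Q *v z))"
    by (simp add: block_op_def Let_def Q_def[symmetric] matrix_vector_mult_add_rdistrib
        matrix_vector_mult_diff_rdistrib matrix_vector_mul_assoc matrix_mul_assoc)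
  have Az: "A *v z = of_real y *s z" using z by (simp add: eigenspace_def)
  have proj: "P *v u = (if y \<in> M then u else 0)" if "u \<in> eigenspace A y" for u
    unfolding P_def by (rule spectral_projection_eigenvector[OF A that])
  show "Y *v z = 0 *v z"
  proof (cases "y \<in> M")
    case True
    define u where "u = Q *v (Y *v z)"
    have eq: "A *v u - of_real y *s u + P *v (Y *v z) = 0"
      using T 0 proj[OF z] True by (simp add: P_def[symmetric] Az Qv vec.scale u_def vec.scale_right_diff_distrib)
    have Pu: "P *v u = 0" by (simp add: u_def Qv vec.diff PPv)
    have "P *v (A *v u) = 0" using Pu APv[of u] by simp
    then have PY: "P *v (Y *v z) = 0"
      using arg_cong[OF eq, of "\<lambda>v. P *v v"] Pu by (simp add: vec.add vec.diff vec.scale PPv)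
    then have "u \<in> eigenspace A y" using eq by (simp add: eigenspace_def)
    then have "u = 0" using proj[of u] True Pu by simp
    then show ?thesis using PY by (simp add: u_def Qv)
  next
    case False
    define u where "u = P *v (Y *v z)"
    have eq: "A *v u - of_real y *s u + Q *v (Y *v z) = 0"
      using T 0 proj[OF z] False by (simp add: P_def[symmetric] Az Qv vec.scale u_def vec.scale_right_diff_distrib)
    have Pu: "P *v u = u" by (simp add: u_def PPv)
    have "P *v (A *v u) = A *v u" using Pu APv[of u] by simp
    then have *: "A *v u - of_real y *s u = 0"
      using arg_cong[OF eq, of "\<lambda>v. P *v v"] Pu by (simp add: vec.add vec.diff vec.scale PPv Qv)
    then have "u \<in> eigenspace A y" by (simp add: eigenspace_def)
    then have "u = 0" using proj[of u] False Pu by simp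
    then show ?thesis using eq * by (simp add: u_def Qv)
  qed
qed

lemma linear_block_op: "linear (block_op P H)"
  unfolding block_op_def Let_def
  by (intro linear_compose_add linear_compose_sub bounded_linear.linear
      bounded_linear_compose[OF matrix_mult.bounded_linear_left]
      bounded_linear_compose[OF matrix_mult.bounded_linear_right] bounded_linear_ident)

lemma linear_block_source: "linear (block_source P)"
  unfolding block_source_def Let_def
  by (intro linear_compose_add linear_compose_sub bounded_linear.linear bounded_linear_add bounded_linear_sub
      bounded_linear_compose[OF matrix_mult.bounded_linear_left]
      bounded_linear_compose[OF matrix_mult.bounded_linear_right] bounded_linear_ident)

text \<open>The matrix of \<open>block_op P H\<close> when a square matrix is read as a vector
  indexed by pairs: a sum of Kronecker products. In this form Cramer's rule applies to the equation
  for the derivative.\<close>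

definition block_matrix :: "complex^'d^'d \<Rightarrow> complex^'d^'d \<Rightarrow> complex^('d \<times> 'd)^('d \<times> 'd::finite)" where
  "block_matrix P H = (let Q = mat 1 - P in (\<chi> p q.
     (H ** P) $ fst p $ fst q * Q $ snd q $ snd p + (H ** Q) $ fst p $ fst q * P $ snd q $ snd p
     - P $ fst p $ fst q * (Q ** H) $ snd q $ snd p - Q $ fst p $ fst q * (P ** H) $ snd q $ snd p
     + P $ fst p $ fst q * P $ snd q $ snd p + Q $ fst p $ fst q * Q $ snd q $ snd p))"

lemma sandwich_entry:
  "((X :: complex^'d^'d) ** Y ** Z) $ a $ b = (\<Sum>q\<in>UNIV. (X $ a $ fst q * Z $ snd q $ b) * Y $ fst q $ snd q)"
proof -
  have "((X ** Y) ** Z) $ a $ b = (\<Sum>e\<in>UNIV. \<Sum>c\<in>UNIV. (X $ a $ c * Z $ e $ b) * Y $ c $ e)"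
    by (simp add: matrix_matrix_mult_def sum_distrib_left sum_distrib_right mult_ac)
  also have "\<dots> = (\<Sum>c\<in>UNIV. \<Sum>e\<in>UNIV. (X $ a $ c * Z $ e $ b) * Y $ c $ e)" by (rule sum.swap)
  also have "\<dots> = (\<Sum>q\<in>UNIV \<times> UNIV. (X $ a $ fst q * Z $ snd q $ b) * Y $ fst q $ snd q)"
    by (simp add: sum.cartesian_product case_prod_beta)
  finally show ?thesis by simp
qed

lemma block_matrix_mult:
  "(block_matrix P H *v (\<chi> p. Y $ fst p $ snd p)) $ p = block_op P H Y $ fst p $ snd p"
  unfolding block_op_def block_matrix_def Let_def
  by (simp add: sandwich_entry matrix_vector_mult_def sum.distrib sum_subtractf distrib_right left_diff_distrib)

lemma det_block_matrix:
  assumes "hermitian A"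
  shows "det (block_matrix (spectral_projection A M) A) \<noteq> 0"
proof -
  let ?B = "block_matrix (spectral_projection A M) A"
  have "v = 0" if "?B *v v = 0" for v
  proof -
    define Y where "Y = (\<chi> a b. v $ (a, b))"
    have v: "v = (\<chi> p. Y $ fst p $ snd p)" by (simp add: Y_def vec_eq_iff)
    have "block_op (spectral_projection A M) A Y $ a $ b = 0" for a b
      using block_matrix_mult[of "spectral_projection A M" A Y "(a, b)"] that v by simp
    then have "block_op (spectral_projection A M) A Y = 0" by (simp add: vec_eq_iff)
    then show ?thesis using block_op_injective[OF assms] v by (simp add: vec_eq_iff)
  qed
  then show ?thesis
    by (simp add: invertible_det_nz[symmetric] invertible_left_inverse matrix_left_invertible_ker)
qed

section \<open>Differentiating the projection\<close>

text \<open>A step from continuity to differentiability. Since \<open>d\<close> is continuous, the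
  factor in front of \<open>norm (d y)\<close> in the remainder tends to zero; absorbing it into the
  lower bound of \<open>T\<close> shows that \<open>d\<close> is of order
  \<open>norm (y - x)\<close>. Then the remainder is of smaller order, and inverting
  \<open>T\<close> yields the derivative.\<close>

lemma implicit_has_derivative:
  fixes T :: "'v::euclidean_space \<Rightarrow> 'v" and L :: "'w::euclidean_space \<Rightarrow> 'v"
    and h :: "'x::real_normed_vector \<Rightarrow> 'w"
  assumes T: "linear T" "inj T" and L: "linear L"
    and h: "h x = 0" "(h has_derivative h') (at x)" and d: "d x = 0" "isCont d x"
    and rem: "\<And>y. norm (T (d y) - L (h y)) \<le> K * (norm (h y) + norm (d y)) * norm (d y)"
  shows "\<exists>D. (d has_derivative D) (at x) \<and> (\<forall>u. T (D u) = L (h' u))"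
proof -
  obtain G where G: "linear G" "\<And>v. G (T v) = v" "\<And>v. T (G v) = v"
    using linear_injective_isomorphism[OF T] by auto
  obtain c where c: "c > 0" "\<And>v. c * norm v \<le> norm (T v)"
    using linear_inj_bounded_below_pos[OF T] by metis
  obtain B where B: "B > 0" "\<And>w. norm (L w) \<le> B * norm w"
    using linear_bounded_pos[OF L] by blast
  define s where "s y = K * (norm (h y) + norm (d y))" for y
  have "isCont h x" using h(2) has_derivative_continuous by blast
  then have "(s \<longlongrightarrow> s x) (at x)"
    using d(2) unfolding s_def isCont_def by (intro tendsto_intros)
  then have s: "(s \<longlongrightarrow> 0) (at x)" by (simp add: s_def h(1) d(1))
  have small: "\<forall>\<^sub>F y in at x. s y < e" if "e > 0" for e
    using order_tendstoD(2)[OF s that] .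
  obtain C where C: "C > 0" "\<And>u. norm (h' u) \<le> norm u * C"
    using bounded_linear.pos_bounded[OF has_derivative_bounded_linear[OF h(2)]] by blast
  have "\<forall>\<^sub>F y in at x. norm (h y - h x - h' (y - x)) \<le> 1 * norm (y - x)"
    using h(2) unfolding has_derivative_within_alt2 by (metis zero_less_one)
  then have hC: "\<forall>\<^sub>F y in at x. norm (h y) \<le> (C + 1) * norm (y - x)"
  proof eventually_elim
    case (elim y)
    have "norm (h y) \<le> norm (h y - h' (y - x)) + norm (h' (y - x))"
      by (metis add.commute diff_add_cancel norm_triangle_ineq)
    then show ?case using elim C(2)[of "y - x"] h(1) by (simp add: algebra_simps)
  qed
  \<comment> \<open>Once \<open>s y < c / 2\<close>, half of \<open>c * norm (d y)\<close> absorbs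
    the remainder, which leaves
    \<open>c / 2 * norm (d y) \<le> B * (C + 1) * norm (y - x)\<close>.\<close>
  define C2 where "C2 = 2 * B * (C + 1) / c"
  have "C2 > 0" using B C c by (simp add: C2_def)
  have dC: "\<forall>\<^sub>F y in at x. norm (d y) \<le> C2 * norm (y - x)"
    using hC small[OF half_gt_zero[OF c(1)]]
  proof eventually_elim
    case (elim y)
    have "c * norm (d y) \<le> norm (T (d y))" by (rule c)
    also have "\<dots> \<le> norm (T (d y) - L (h y)) + norm (L (h y))"
      by (metis add.commute diff_add_cancel norm_triangle_ineq)
    also have "\<dots> \<le> s y * norm (d y) + B * norm (h y)"
      using rem[of y] B(2)[of "h y"] by (simp add: s_def)
    also have "\<dots> \<le> c / 2 * norm (d y) + B * ((C + 1) * norm (y - x))"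
      using elim c B by (intro add_mono mult_right_mono mult_left_mono) auto
    finally have "c / 2 * norm (d y) \<le> B * (C + 1) * norm (y - x)" by simp
    then show ?case using c by (simp add: C2_def field_simps)
  qed
  define r where "r y = T (d y) - L (h y)" for y
  have "(r has_derivative (\<lambda>_. 0)) (at x)"
    unfolding has_derivative_within_alt2
  proof (intro conjI allI impI)
    fix e :: real assume "e > 0"
    have "e / C2 > 0" using \<open>e > 0\<close> \<open>C2 > 0\<close> by simp
    have rx: "r x = 0" using linear_0[OF T(1)] linear_0[OF L] by (simp add: r_def h(1) d(1))
    show "\<forall>\<^sub>F y in at x. norm (r y - r x - 0) \<le> e * norm (y - x)"
      using dC small[OF \<open>e / C2 > 0\<close>]
    proof eventually_elim
      case (elim y)
      have "norm (r y) \<le> s y * norm (d y)" using rem[of y] by (simp add: r_def s_def)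
      also have "\<dots> \<le> (e / C2) * norm (d y)" using elim by (intro mult_right_mono) auto
      also have "\<dots> \<le> (e / C2) * (C2 * norm (y - x))"
        using elim \<open>e > 0\<close> \<open>C2 > 0\<close> by (intro mult_left_mono) auto
      finally show ?case using \<open>C2 > 0\<close> rx by simp
    qed
  qed simp
  moreover have "((\<lambda>y. L (h y)) has_derivative (\<lambda>u. L (h' u))) (at x)"
    using L h(2) by (simp add: bounded_linear.has_derivative linear_conv_bounded_linear)
  ultimately have "((\<lambda>y. L (h y) + r y) has_derivative (\<lambda>u. L (h' u) + 0)) (at x)"
    using has_derivative_add by blast
  then have "((\<lambda>y. T (d y)) has_derivative (\<lambda>u. L (h' u))) (at x)"
    by (simp add: r_def)
  then have "((\<lambda>y. G (T (d y))) has_derivative (\<lambda>u. G (L (h' u)))) (at x)"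
    using G(1)[unfolded linear_conv_bounded_linear] by (rule bounded_linear.has_derivative[rotated])
  then show ?thesis
    unfolding G(2) by (intro exI[of _ "\<lambda>u. G (L (h' u))"] conjI allI G(3))
qed

context
  fixes H P :: "real^'n::finite \<Rightarrow> complex^'d^'d::finite" and M :: "real^'n \<Rightarrow> real set"
  assumes hermitian_H: "\<And>x. hermitian (H x)" and smooth_H: "\<And>m. C_k_matrix m H"
    and P: "\<And>x. P x = spectral_projection (H x) (M x)" and continuous_P: "C_k_matrix 0 P"
begin

text \<open>Applies the preceding lemma to the increments \<open>H x - H y\<close> and
  \<open>P y - P x\<close>: every term of the remainder in \<open>block_op_difference\<close>
  contains the increment of \<open>P\<close> and one more increment.\<close>

lemma spectral_projection_has_derivative:
  "\<exists>D. (P has_derivative D) (at x) \<and>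
     (\<forall>u. block_op (P x) (H x) (D u) = block_source (P x) (- dir_deriv H u x))"
proof -
  have PP: "P x ** P x = P x" and HP: "H x ** P x = P x ** H x" for x
    unfolding P by (rule orthogonal_projection[OF subspace_spectral_space] spectral_projection_commute hermitian_H)+
  let ?Q = "mat 1 - P x"
  obtain K where K: "K > 0" "\<And>(X :: complex^'d^'d) (Y :: complex^'d^'d). norm (X ** Y) \<le> norm X * norm Y * K"
    using matrix_mult.pos_bounded by blast
  let ?N = "max (norm (P x)) (norm ?Q)"
  have sw: "norm (X ** Y ** Z) \<le> ?N * ?N * K * K * norm Y" if "norm X \<le> ?N" "norm Z \<le> ?N" for X Y Z :: "complex^'d^'d"
  proof -
    have "norm (X ** Y ** Z) \<le> (norm X * norm Y * K) * norm Z * K"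
      using K by (meson K(2) mult_right_mono norm_ge_zero order_trans less_imp_le)
    also have "\<dots> \<le> (?N * norm Y * K) * ?N * K"
      using that K(1) by (intro mult_mono) (auto simp: le_max_iff_disj)
    finally show ?thesis by (simp add: mult_ac)
  qed
  define K2 where "K2 = ?N * ?N * K * K"
  have sw: "norm (X ** Y ** Z) \<le> K2 * norm Y" if "X \<in> {P x, ?Q}" "Z \<in> {P x, ?Q}" for X Y Z
    unfolding K2_def using that by (intro sw) auto
  have "K2 \<ge> 0" unfolding K2_def using K(1) by (intro mult_nonneg_nonneg) (auto simp: le_max_iff_disj)
  \<comment> \<open>\<open>K2\<close> bounds multiplication by \<open>P x\<close> or
    \<open>mat 1 - P x\<close> on both sides. Two sandwiched commutators, each bounded with
    \<open>2 * K\<close>, give \<open>4 * K2 * K\<close>; the two squares of the increment of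
    \<open>P\<close> give half as much and fit under the same constant.\<close>
  have rem: "norm (block_op (P x) (H x) (P y - P x) - block_source (P x) (H x - H y))
      \<le> (4 * K2 * K) * (norm (H x - H y) + norm (P y - P x)) * norm (P y - P x)" for y
  proof -
    let ?D = "P y - P x" and ?X = "H x - H y"
    let ?C = "?X ** ?D - ?D ** ?X"
    have C: "norm ?C \<le> 2 * K * norm ?X * norm ?D"
      using norm_triangle_ineq4[of "?X ** ?D" "?D ** ?X"] K(2)[of ?X ?D] K(2)[of ?D ?X]
      by (simp add: mult_ac)
    have D: "norm (?D ** ?D) \<le> K * norm ?D * norm ?D" using K(2)[of ?D ?D] by (simp add: mult_ac)
    have "norm (P x ** ?C ** ?Q + ?Q ** ?C ** P x + ?Q ** (?D ** ?D) ** ?Q - P x ** (?D ** ?D) ** P x)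
      \<le> norm (P x ** ?C ** ?Q) + norm (?Q ** ?C ** P x) + norm (?Q ** (?D ** ?D) ** ?Q) + norm (P x ** (?D ** ?D) ** P x)"
      by (intro order_trans[OF norm_triangle_ineq4] add_mono order_trans[OF norm_triangle_ineq] order_refl)
    also have "\<dots> \<le> K2 * norm ?C + K2 * norm ?C + K2 * norm (?D ** ?D) + K2 * norm (?D ** ?D)"
      by (intro add_mono sw) auto
    also have "\<dots> \<le> K2 * (2 * K * norm ?X * norm ?D) + K2 * (2 * K * norm ?X * norm ?D)
        + K2 * (K * norm ?D * norm ?D) + K2 * (K * norm ?D * norm ?D)"
      using C D \<open>K2 \<ge> 0\<close> by (intro add_mono mult_left_mono) auto
    also have "\<dots> \<le> (4 * K2 * K) * (norm ?X + norm ?D) * norm ?D"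
      using \<open>K2 \<ge> 0\<close> K(1) by (simp add: algebra_simps)
    finally show ?thesis
      using block_op_difference[OF PP PP HP HP, of x y] by (simp add: Let_def)
  qed
  have inj: "inj (block_op (P x) (H x))"
    using block_op_injective[OF hermitian_H, of x "M x"] linear_block_op linear_injective_0 P by metis
  have deriv: "((\<lambda>y. H x - H y) has_derivative (\<lambda>u. - dir_deriv H u x)) (at x)"
    using has_derivative_diff[OF has_derivative_const C_k_matrix_SucD(1)[OF smooth_H]] by simp
  have cont: "isCont (\<lambda>y. P y - P x) x"
    using C_k_matrix_imp_continuous[OF continuous_P]
    by (intro continuous_intros) (simp add: continuous_on_eq_continuous_at)
  obtain D where D: "((\<lambda>y. P y - P x) has_derivative D) (at x)"
      "\<And>u. block_op (P x) (H x) (D u) = block_source (P x) (- dir_deriv H u x)"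
    using implicit_has_derivative[where h = "\<lambda>y. H x - H y" and d = "\<lambda>y. P y - P x",
        OF linear_block_op inj linear_block_source _ deriv _ cont rem] by auto
  then have "(P has_derivative D) (at x)"
    using has_derivative_add[OF D(1) has_derivative_const[of "P x"]] by simp
  then show ?thesis using D(2) by blast
qed

lemma C_k_spectral_projection: "C_k_matrix m P"
proof (induction m)
  case (Suc m)
  obtain D where D: "\<And>x. (P has_derivative D x) (at x)"
    "\<And>x u. block_op (P x) (H x) (D x u) = block_source (P x) (- dir_deriv H u x)"
    using spectral_projection_has_derivative by metis
  have Q: "C_k_matrix m (\<lambda>x. mat 1 - P x)" using Suc by (intro C_k_matrix_intros)
  show ?case
  proof (rule C_k_matrix_SucI[OF D(1)])
    fix u
    let ?b = "\<lambda>x. block_source (P x) (- dir_deriv H u x)"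
    have "C_k_matrix m (\<lambda>x. 0 - dir_deriv H u x)"
      by (intro C_k_matrix_intros C_k_matrix_SucD(2) smooth_H)
    then have b: "C_k_matrix m ?b"
      unfolding block_source_def Let_def using Q Suc by (intro C_k_matrix_intros) auto
    have "C_k m (\<lambda>x. (\<chi> p. D x u $ fst p $ snd p) $ p)" for p
    proof (rule C_k_linear_system[where A = "\<lambda>x. block_matrix (P x) (H x)"
          and b = "\<lambda>x. \<chi> p. ?b x $ fst p $ snd p"])
      show "C_k m (\<lambda>x. block_matrix (P x) (H x) $ i $ j)" for i j
        unfolding block_matrix_def Let_def using Q Suc smooth_H
        by (simp, intro C_k_add C_k_diff C_k_mult C_k_matrix_entry C_k_matrix_intros)
      show "C_k m (\<lambda>x. (\<chi> p. ?b x $ fst p $ snd p) $ i)" for i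
        using b by (simp add: C_k_matrix_entry)
      show "block_matrix (P x) (H x) *v (\<chi> p. D x u $ fst p $ snd p) = (\<chi> p. ?b x $ fst p $ snd p)" for x
        by (simp add: vec_eq_iff[where 'b = "'d \<times> 'd"] block_matrix_mult D(2))
      show "det (block_matrix (P x) (H x)) \<noteq> 0" for x
        unfolding P by (rule det_block_matrix[OF hermitian_H])
    qed
    from this[of "(_, _)"] show "C_k_matrix m (\<lambda>x. D x u)" by (simp add: C_k_matrix_def)
  qed
qed (rule continuous_P)

end

section \<open>Continuity of the projection\<close>

text \<open>A polynomial in \<open>A\<close> with prescribed roots. The roots form a list because
  the matrix product is not commutative in general. Its coefficients depend continuously on the
  bands, even where eigenvectors cannot be chosen continuously.\<close>

primrec char_prod :: "complex^'d^'d \<Rightarrow> real list \<Rightarrow> complex^'d^'d::finite" where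
  "char_prod A [] = mat 1"
| "char_prod A (c # cs) = (A - mat (of_real c)) ** char_prod A cs"

lemma char_prod_eigenvector:
  assumes "z \<in> eigenspace A y"
  shows "char_prod A cs *v z = of_real (\<Prod>c\<leftarrow>cs. y - c) *s z"
proof (induction cs)
  case (Cons c cs)
  have "mat (of_real c) *v z = of_real c *s z"
    by (simp add: vec_eq_iff matrix_vector_mult_def mat_def if_distrib[of "\<lambda>x. x * _"] cong: if_cong)
  moreover have "A *v z = of_real y *s z" using assms by (simp add: eigenspace_def)
  ultimately have "(A - mat (of_real c)) *v z = of_real (y - c) *s z"
    by (simp add: matrix_vector_mult_diff_rdistrib vec.scale_left_diff_distrib)
  then show ?case
    by (simp add: matrix_vector_mul_assoc[symmetric] Cons.IH vec.scale mult.commute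
        del: of_real_diff)
qed simp

lemma continuous_char_prod:
  fixes H :: "real^'n::finite \<Rightarrow> complex^'d^'d::finite"
  assumes "C_k_matrix 0 H" "\<And>i. i \<in> set ks \<Longrightarrow> continuous_on UNIV (\<lambda>x. c x i)"
  shows "C_k_matrix 0 (\<lambda>x. char_prod (H x) (map (c x) ks))"
  using assms(2)
proof (induction ks)
  case (Cons i ks)
  have "C_k_matrix 0 (\<lambda>x. mat (of_real (c x i)) :: complex^'d^'d)"
    unfolding C_k_matrix_def
  proof (intro allI)
    fix a b
    show "C_k 0 (\<lambda>x. mat (of_real (c x i)) $ a $ b)"
      using Cons.prems[of i] by (cases "a = b") (auto simp: mat_def intro!: continuous_intros)
  qed
  then show ?case
    using Cons assms(1) by (auto intro!: C_k_matrix_mult C_k_matrix_diff)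
qed simp

text \<open>With \<open>p\<close> and \<open>q\<close> the products of \<open>H - \<lambda>\<close> over the bands inside and outside of \<open>B\<close>, the
  projection solves \<open>(p + q) P = q\<close>, and \<open>p + q\<close> is invertible since the bands are isolated.\<close>

lemma continuous_spectral_projection:
  fixes H :: "real^'n::finite \<Rightarrow> complex^'d^'d::finite"
  assumes H: "\<And>x. hermitian (H x)" and cont: "C_k_matrix 0 H" and B: "B \<subseteq> {1..CARD('d)}"
    and isolated: "\<And>x i j. i \<in> B \<Longrightarrow> j \<in> {1..CARD('d)} - B \<Longrightarrow> band (H x) i \<noteq> band (H x) j"
  shows "C_k_matrix 0 (\<lambda>x. spectral_projection (H x) (band (H x) ` B))"
proof -
  define p where "p x = char_prod (H x) (map (band (H x)) (sorted_list_of_set B))" for x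
  define q where "q x = char_prod (H x) (map (band (H x)) (sorted_list_of_set ({1..CARD('d)} - B)))" for x
  let ?P = "\<lambda>x. spectral_projection (H x) (band (H x) ` B)"
  have fin: "finite B" using B finite_subset by blast
  have band: "continuous_on UNIV (\<lambda>x. band (H x) i)" if "i \<in> {1..CARD('d)}" for i
    by (intro continuous_on_band C_k_matrix_imp_continuous[OF cont] H that)
  have p: "C_k_matrix 0 p" and q: "C_k_matrix 0 q"
    unfolding p_def q_def using band B fin by (auto intro!: continuous_char_prod cont)
  \<comment> \<open>Exactly one of \<open>p\<close> and \<open>q\<close> kills a given nonzero
    eigenvector. This is where isolation enters: an eigenvalue cannot be the value of bands on both
    sides.\<close>
  have eig: "\<exists>a b. p x *v z = of_real a *s z \<and> q x *v z = of_real b *s z \<and>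
      (if y \<in> band (H x) ` B then a = 0 \<and> b \<noteq> 0 else a \<noteq> 0 \<and> b = 0)"
    if z: "z \<in> eigenspace (H x) y" "z \<noteq> 0" for x y z
  proof -
    have "y \<in> band (H x) ` {1..CARD('d)}"
      unfolding spectrum_eq_bands[OF H, symmetric] using z by (auto simp: spectrum_def)
    then obtain k where k: "k \<in> {1..CARD('d)}" "y = band (H x) k" by (rule imageE)
    have out: "y \<notin> band (H x) ` ({1..CARD('d)} - B)" if "k \<in> B"
    proof
      assume "y \<in> band (H x) ` ({1..CARD('d)} - B)"
      then obtain j where "j \<in> {1..CARD('d)} - B" "y = band (H x) j" by (rule imageE)
      then show False using isolated[OF that, of j x] k by simp
    qed
    have inside: "y \<notin> band (H x) ` B" if "k \<notin> B"
    proof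
      assume "y \<in> band (H x) ` B"
      then obtain i where "i \<in> B" "y = band (H x) i" by (rule imageE)
      then show False using isolated[of i k x] k that by simp
    qed
    have iff: "y \<in> band (H x) ` B \<longleftrightarrow> y \<notin> band (H x) ` ({1..CARD('d)} - B)"
    proof (cases "k \<in> B")
      case True
      then show ?thesis using out k(2) by (metis imageI)
    next
      case False
      then have "y \<in> band (H x) ` ({1..CARD('d)} - B)" using k by (simp del: atLeastAtMost_iff)
      then show ?thesis using inside[OF False] by simp
    qed
    have zero: "(\<Prod>c\<leftarrow>map (band (H x)) (sorted_list_of_set X). y - c) = 0 \<longleftrightarrow> y \<in> band (H x) ` X"
      if "finite X" for X
      using that by (auto simp: prod_list_zero_iff)
    let ?f = "\<lambda>X. \<Prod>c\<leftarrow>map (band (H x)) (sorted_list_of_set X). y - c"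
    show ?thesis
      unfolding p_def q_def char_prod_eigenvector[OF z(1)]
      by (rule exI[of _ "?f B"], rule exI[of _ "?f ({1..CARD('d)} - B)"])
        (simp only: zero[OF fin] zero[OF finite_Diff[OF finite_atLeastAtMost]] iff, simp)
  qed
  \<comment> \<open>On each eigenvector \<open>p + q\<close> is multiplication by a nonzero number,
    so its range contains all eigenspaces and hence everything.\<close>
  have det: "det (p x + q x) \<noteq> 0" for x
  proof -
    have "eigenspace (H x) y \<subseteq> range ((*v) (p x + q x))" for y
    proof
      fix z assume z: "z \<in> eigenspace (H x) y"
      show "z \<in> range ((*v) (p x + q x))"
      proof (cases "z = 0")
        case False
        obtain a b where ab: "p x *v z = of_real a *s z" "q x *v z = of_real b *s z" "a + b \<noteq> 0"
        proof -
          obtain a b where ab: "p x *v z = of_real a *s z" "q x *v z = of_real b *s z"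
            "if y \<in> band (H x) ` B then a = 0 \<and> b \<noteq> 0 else a \<noteq> 0 \<and> b = 0"
            using eig[OF z False] by blast
          then have "a + b \<noteq> 0" by (simp split: if_splits)
          then show ?thesis using that ab by blast
        qed
        have "(p x + q x) *v ((1 / of_real (a + b)) *s z) = (1 / of_real (a + b)) *s (of_real (a + b) *s z)"
          by (simp only: vec.scale matrix_vector_mult_add_rdistrib ab vec.scale_left_distrib of_real_add)
        also have "\<dots> = z" using ab(3) by (simp del: of_real_add)
        finally show ?thesis by (metis rangeI)
      qed (metis rangeI vec.zero)
    qed
    moreover have "vec.subspace (range ((*v) (p x + q x)))"
      by (rule vec.subspace_image[OF vec.subspace_UNIV])
    ultimately have "spectral_space (H x) UNIV \<subseteq> range ((*v) (p x + q x))"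
      unfolding spectral_space_def by (intro vec.span_minimal) auto
    then have "surj ((*v) (p x + q x))" using spectral_space_UNIV[OF H] by auto
    then have "invertible (p x + q x)"
      using matrix_right_invertible_surjective invertible_right_inverse by blast
    then show ?thesis by (simp add: invertible_det_nz)
  qed
  have sys: "(p x + q x) ** ?P x = q x" for x
  proof (rule matrix_eq_on_eigenvectors[OF H])
    fix y z assume z: "z \<in> eigenspace (H x) y"
    show "((p x + q x) ** ?P x) *v z = q x *v z"
    proof (cases "z = 0")
      case False
      show ?thesis
        using eig[OF z False]
        by (auto simp: matrix_vector_mul_assoc[symmetric] spectral_projection_eigenvector[OF H z]
            matrix_vector_mult_add_rdistrib split: if_splits)
    qed simp
  qed
  \<comment> \<open>Each column of the projection solves its own linear system with matrix
    \<open>p x + q x\<close>.\<close>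
  have "C_k 0 (\<lambda>x. (\<chi> a. ?P x $ a $ b) $ a)" for a b
  proof (rule C_k_linear_system[where A = "\<lambda>x. p x + q x" and b = "\<lambda>x. \<chi> a. q x $ a $ b"])
    show "C_k 0 (\<lambda>x. (p x + q x) $ i $ j)" for i j
      by (intro C_k_matrix_entry C_k_matrix_add p q)
    show "C_k 0 (\<lambda>x. (\<chi> a. q x $ a $ b) $ i)" for i
      using C_k_matrix_entry[OF q] by simp
    show "(p x + q x) *v (\<chi> a. ?P x $ a $ b) = (\<chi> a. q x $ a $ b)" for x
    proof -
      have "((p x + q x) *v (\<chi> a. ?P x $ a $ b)) $ i = ((p x + q x) ** ?P x) $ i $ b" for i
        by (simp add: matrix_vector_mult_def matrix_matrix_mult_def)
      then show ?thesis by (simp add: vec_eq_iff sys)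
    qed
    show "det (p x + q x) \<noteq> 0" for x by (rule det)
  qed
  then show ?thesis by (simp add: C_k_matrix_def)
qed

lemma smooth_spectral_projection:
  fixes H :: "real^'n::finite \<Rightarrow> complex^'d^'d::finite"
  assumes "\<And>x. hermitian (H x)" "\<And>m. C_k_matrix m H" "B \<subseteq> {1..CARD('d)}"
    and "\<And>x i j. i \<in> B \<Longrightarrow> j \<in> {1..CARD('d)} - B \<Longrightarrow> band (H x) i \<noteq> band (H x) j"
  shows "C_k_matrix m (\<lambda>x. spectral_projection (H x) (band (H x) ` B))"
  by (rule C_k_spectral_projection[OF assms(1,2) refl continuous_spectral_projection]) (use assms in auto)

section \<open>The scaling map of the torus\<close>

lemma abs_torus_eq_iff: "abs_torus x = abs_torus y \<longleftrightarrow> torus_rel x y"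
  by (simp add: torus.abs_eq_iff)

lemma abs_rep_torus [simp]: "abs_torus (rep_torus p) = p"
  by (rule Quotient_abs_rep[OF Quotient_torus])

lemma torus_rel_rep_abs: "torus_rel (rep_torus (abs_torus x)) x"
  by (simp add: abs_torus_eq_iff[symmetric])

lemma torus_rel_add: "torus_rel x y \<Longrightarrow> abs_torus (z + (x - y)) = abs_torus z"
  by (simp add: abs_torus_eq_iff torus_rel_def)

lemma has_derivative_shift:
  "(f has_derivative D) (at (x + p)) \<longleftrightarrow> ((\<lambda>y. f (y + p)) has_derivative D) (at x)"
proof
  have *: "((\<lambda>y. f (y + p)) has_derivative D) (at x)"
    if "(f has_derivative D) (at (x + p))" for f :: "'a::real_normed_vector \<Rightarrow> 'b::real_normed_vector" and p x
    using has_derivative_compose[where f = "\<lambda>y. y + p" and f' = "\<lambda>h. h" and g = f and g' = D and s = UNIV] that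
    by (simp add: has_derivative_add_const[OF has_derivative_ident])
  show "((\<lambda>y. f (y + p)) has_derivative D) (at x)" if "(f has_derivative D) (at (x + p))"
    using *[OF that] .
  show "(f has_derivative D) (at (x + p))" if "((\<lambda>y. f (y + p)) has_derivative D) (at x)"
    using *[of "\<lambda>y. f (y + p)" "x + p" "- p"] that by simp
qed

text \<open>The lifted function is periodic, so the representative chosen by
  \<open>rep_torus\<close> may be replaced by any other lift of the point.\<close>

lemma torus_deriv_abs: "torus_deriv g (abs_torus x) u = dir_deriv (\<lambda>y. g (abs_torus y)) u x"
proof -
  let ?p = "rep_torus (abs_torus x) - x"
  have "(\<lambda>y. g (abs_torus (y + ?p))) = (\<lambda>y. g (abs_torus y))"
    by (simp only: torus_rel_add[OF torus_rel_rep_abs])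
  then have "((\<lambda>y. g (abs_torus y)) has_derivative D) (at (x + ?p)) \<longleftrightarrow>
      ((\<lambda>y. g (abs_torus y)) has_derivative D) (at x)" for D
    using has_derivative_shift[of "\<lambda>y. g (abs_torus y)" D x ?p] by simp
  then show ?thesis by (simp add: torus_deriv_def frechet_derivative_def)
qed

lemma torus_scale_abs: "torus_scale l (abs_torus x) = abs_torus (of_nat l *\<^sub>R x)"
  by (rule torus_scale.abs_eq)

lemma torus_scale_surj:
  assumes "l > 0"
  shows "surj (torus_scale l)"
proof (rule surjI)
  show "torus_scale l (abs_torus ((1 / of_nat l) *\<^sub>R rep_torus \<theta>)) = \<theta>" for \<theta>
    using assms by (simp add: torus_scale_abs)
qed

text \<open>\<open>torus_lift\<close> is known only as some continuous lift. Each coordinate of its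
  difference from multiplication by \<open>l\<close> is continuous with values in the integer
  multiples of \<open>2 * pi\<close>, hence constant.\<close>

lemma torus_lift_scale:
  obtains c where "torus_lift (torus_scale l) = (\<lambda>x :: real^'n::finite. of_nat l *\<^sub>R x + c)"
proof -
  define F where "F = (torus_lift (torus_scale l) :: real^'n \<Rightarrow> real^'n)"
  have "continuous_on UNIV F \<and> (\<forall>x. torus_scale l (abs_torus x) = abs_torus (F x))"
    unfolding F_def torus_lift_def
    by (rule someI[where x = "\<lambda>x. of_nat l *\<^sub>R x"]) (auto simp: torus_scale_abs intro!: continuous_intros)
  then have cont: "continuous_on UNIV F" and rel: "torus_rel (F x) (of_nat l *\<^sub>R x)" for x
    by (auto simp: torus_scale_abs abs_torus_eq_iff[symmetric])
  have "(F x - of_nat l *\<^sub>R x) $ i = (F 0) $ i" for x i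
  proof -
    define G where "G x = (F x - of_nat l *\<^sub>R x) $ i" for x
    have G: "\<exists>m::int. G x = 2 * pi * m" for x
      using rel[of x] by (simp add: G_def torus_rel_def)
    have "G constant_on UNIV"
    proof (rule continuous_discrete_range_constant)
      show "continuous_on UNIV G"
        unfolding G_def using cont by (intro continuous_intros)
      show "\<exists>e>0. \<forall>y. y \<in> UNIV \<and> G y \<noteq> G x \<longrightarrow> e \<le> norm (G y - G x)" for x
      proof (intro exI[of _ "2 * pi"] conjI allI impI)
        fix y assume "y \<in> UNIV \<and> G y \<noteq> G x"
        moreover obtain m n :: int where mn: "G x = 2 * pi * m" "G y = 2 * pi * n" using G by metis
        ultimately have "n \<noteq> m" by auto
        then have "1 \<le> \<bar>n - m\<bar>" by simp
        then have "1 \<le> \<bar>real_of_int n - real_of_int m\<bar>"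
          by (metis of_int_1_le_iff of_int_abs of_int_diff)
        moreover have "norm (G y - G x) = 2 * pi * \<bar>real_of_int n - real_of_int m\<bar>"
          by (simp add: mn abs_mult right_diff_distrib[symmetric])
        ultimately show "2 * pi \<le> norm (G y - G x)" using pi_gt_zero by simp
      qed simp
    qed (simp add: convex_connected)
    then obtain d where "\<And>x. G x = d" by (auto simp: constant_on_def)
    from this[of x] this[of 0] show ?thesis by (simp add: G_def)
  qed
  then have "F x - of_nat l *\<^sub>R x = F 0" for x
    unfolding vec_eq_iff by blast
  then have "F x = of_nat l *\<^sub>R x + F 0" for x
    by (metis diff_add_cancel add.commute)
  then have "F = (\<lambda>x. of_nat l *\<^sub>R x + F 0)" by blast
  then show ?thesis unfolding F_def by (rule that)
qed

lemma torus_lift_scale_has_derivative: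
  "(torus_lift (torus_scale l :: 'n::finite torus \<Rightarrow> 'n torus) has_derivative (\<lambda>u. of_nat l *\<^sub>R u)) (at x)"
proof -
  obtain c where c: "torus_lift (torus_scale l) = (\<lambda>x :: real^'n. of_nat l *\<^sub>R x + c)"
    by (rule torus_lift_scale)
  show ?thesis unfolding c by (auto intro!: derivative_eq_intros)
qed

lemma torus_map_deriv_scale:
  "torus_map_deriv (torus_scale l :: 'n::finite torus \<Rightarrow> 'n torus) p = (\<lambda>u. of_nat l *\<^sub>R u)"
  unfolding torus_map_deriv_def
  by (rule ext) (rule dir_deriv_eq[OF torus_lift_scale_has_derivative])

section \<open>The degree of the scaling map\<close>

text \<open>The preimages of the class of \<open>y\<close> are the classes of
  \<open>(y + 2 * pi * k) / l\<close>, where \<open>k\<close> runs through the vectors with entries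
  in \<open>{..<l}\<close>.\<close>

lemma card_torus_scale_vimage:
  assumes l: "l > 0"
  shows "card (torus_scale l -` {q :: 'n::finite torus}) = l ^ CARD('n)"
proof -
  define y where "y = rep_torus q"
  define g where "g k = abs_torus ((1 / real l) *\<^sub>R (y + (\<chi> i. 2 * pi * real (k i))))" for k :: "'n \<Rightarrow> nat"
  let ?K = "(UNIV :: 'n set) \<rightarrow>\<^sub>E {..<l}"
  have "inj_on g ?K"
  proof (rule inj_onI)
    fix k k' assume k: "k \<in> ?K" "k' \<in> ?K" and eq: "g k = g k'"
    show "k = k'"
    proof
      fix i
      obtain m :: int where "(y $ i + 2 * pi * k i) / l - (y $ i + 2 * pi * k' i) / l = 2 * pi * m"
        using eq by (force simp: g_def abs_torus_eq_iff torus_rel_def)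
      then have "((y $ i + 2 * pi * k i) - (y $ i + 2 * pi * k' i)) / l = 2 * pi * m"
        by (simp only: diff_divide_distrib)
      then have "(y $ i + 2 * pi * k i) - (y $ i + 2 * pi * k' i) = 2 * pi * m * l"
        using l by (simp only: nonzero_divide_eq_eq of_nat_0_less_iff less_imp_neq[symmetric] of_nat_eq_0_iff not_False_eq_True neq0_conv)
      then have "2 * pi * (real (k i) - real (k' i)) = 2 * pi * (m * real l)"
        by (simp add: algebra_simps)
      then have "real (k i) - real (k' i) = m * real l" using pi_neq_zero by simp
      then have "real_of_int (int (k i) - int (k' i)) = real_of_int (m * int l)" by simp
      then have *: "int (k i) - int (k' i) = m * int l" by (simp only: of_int_eq_iff)
      have "int (k i) mod int l = int (k' i) mod int l"
        using * by (metis diff_add_cancel mod_mult_self4 add.commute mult.commute mod_mult_self2)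
      moreover have "k i < l" "k' i < l" using k by (auto simp: PiE_iff)
      ultimately show "k i = k' i" by simp
    qed
  qed
  moreover have "g ` ?K = torus_scale l -` {q}"
  proof
    show "g ` ?K \<subseteq> torus_scale l -` {q}"
    proof clarify
      fix k
      have "torus_rel (y + (\<chi> i. 2 * pi * real (k i))) y"
        by (auto simp: torus_rel_def intro!: exI[of _ "int (k _)"])
      then show "g k \<in> torus_scale l -` {q}"
        using l by (simp add: g_def torus_scale_abs y_def abs_torus_eq_iff[symmetric])
    qed
    show "torus_scale l -` {q} \<subseteq> g ` ?K"
    proof
      fix p assume "p \<in> torus_scale l -` {q}"
      then have "abs_torus (of_nat l *\<^sub>R rep_torus p) = abs_torus y"
        by (simp add: y_def torus_scale_abs[symmetric])
      then have "\<forall>i. \<exists>m::int. l * rep_torus p $ i - y $ i = 2 * pi * m"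
        by (simp add: abs_torus_eq_iff torus_rel_def)
      then obtain m :: "'n \<Rightarrow> int" where m: "\<And>i. l * rep_torus p $ i - y $ i = 2 * pi * m i" by metis
      \<comment> \<open>Only the residue modulo \<open>l\<close> counts on the torus: the quotient
        \<open>m i div int l\<close> shifts the point by full periods.\<close>
      define k where "k i = nat (m i mod int l)" for i
      have "k \<in> ?K" using l by (auto simp: k_def nat_less_iff)
      moreover have "g k = p"
      proof -
        have "torus_rel ((1 / real l) *\<^sub>R (y + (\<chi> i. 2 * pi * real (k i)))) (rep_torus p)"
          unfolding torus_rel_def
        proof (intro allI exI)
          fix i
          have "real (k i) = real_of_int (m i mod int l)" using l by (simp add: k_def)
          also have "\<dots> = m i - l * real_of_int (m i div int l)"
            by (simp add: minus_div_mult_eq_mod[symmetric])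
          finally have ki: "real (k i) = m i - l * real_of_int (m i div int l)" .
          show "((1 / real l) *\<^sub>R (y + (\<chi> i. 2 * pi * real (k i)))) $ i - rep_torus p $ i
              = 2 * pi * real_of_int (- (m i div int l))"
            using m[of i] l by (simp add: ki field_simps)
        qed
        then show ?thesis unfolding g_def by (simp add: abs_torus_eq_iff[symmetric])
      qed
      ultimately show "p \<in> g ` ?K" by blast
    qed
  qed
  ultimately have "card (torus_scale l -` {q}) = card ?K" using card_image[of g ?K] by simp
  then show ?thesis by (simp add: card_PiE)
qed

text \<open>Every value is regular, so the count over any single fibre already determines the number
  in the definite description.\<close>

lemma torus_degree_scale:
  assumes "l > 0"
  shows "torus_degree (torus_scale l :: 'n::finite torus \<Rightarrow> 'n torus) = int l ^ CARD('n)"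
proof -
  let ?f = "torus_scale l :: 'n torus \<Rightarrow> 'n torus"
  have "matrix (\<lambda>u :: real^'n. of_nat l *\<^sub>R u) = (of_nat l :: real) *\<^sub>R mat 1"
    by (auto simp: vec_eq_iff matrix_def mat_def axis_def)
  then have "det (matrix (\<lambda>u :: real^'n. of_nat l *\<^sub>R u)) = real l ^ CARD('n)"
    by (subst det_diagonal) (simp_all add: mat_def)
  then have det: "det (matrix (torus_map_deriv ?f p)) = real l ^ CARD('n)" for p
    by (simp add: torus_map_deriv_scale)
  have regular: "torus_regular_value ?f q" for q
    unfolding torus_regular_value_def det
    using torus_lift_scale_has_derivative assms by (auto simp: differentiable_def)
  have "(\<Sum>p\<in>?f -` {q}. sgn (det (matrix (torus_map_deriv ?f p)))) = real_of_int (int l ^ CARD('n))" for q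
    using assms by (simp add: det card_torus_scale_vimage)
  then show ?thesis
    unfolding torus_degree_def using regular by (intro the_equality) (auto simp: of_int_eq_iff simp del: of_int_power)
qed

section \<open>Lattices and their Hamiltonians\<close>

text \<open>An infinite set of reals that is finite below every bound is enumerated in increasing
  order; the next element is the minimum of those above the current one.\<close>

lemma kth_smallest_exists:
  fixes N :: "real set"
  assumes inf: "infinite N" and fin: "\<And>r. finite {s \<in> N. s < r}"
  shows "\<exists>r\<in>N. card {s \<in> N. s < r} = k"
proof (induction k)
  case 0
  obtain a where a: "a \<in> N" using inf by (metis ex_in_conv finite.emptyI)
  have f: "finite {s \<in> N. s < a + 1}" by (rule fin)
  then have m: "Min {s \<in> N. s < a + 1} \<in> {s \<in> N. s < a + 1}" using a by (intro Min_in) auto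
  have "{s \<in> N. s < Min {s \<in> N. s < a + 1}} = {}"
    using f m Min_le[OF f] by fastforce
  then have "card {s \<in> N. s < Min {s \<in> N. s < a + 1}} = 0" by (simp only: card.empty)
  then show ?case using m by blast
next
  case (Suc k)
  then obtain r where r: "r \<in> N" "card {s \<in> N. s < r} = k" by blast
  have "infinite (N - insert r {s \<in> N. s < r})" using inf fin[of r] by (simp add: Diff_infinite_finite)
  then have "N - insert r {s \<in> N. s < r} \<noteq> {}" by (rule infinite_imp_nonempty)
  then obtain a where "a \<in> N - insert r {s \<in> N. s < r}" by blast
  then have a: "a \<in> N" "a > r" by auto
  \<comment> \<open>The bound \<open>a + 1\<close> makes the set finite while keeping
    \<open>a\<close> in it, so that its minimum exists.\<close>
  let ?S = "{s \<in> N. r < s \<and> s < a + 1}"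
  have f: "finite ?S" by (rule finite_subset[OF _ fin[of "a + 1"]]) auto
  then have m: "Min ?S \<in> ?S" using a by (intro Min_in) auto
  have "s \<le> r \<or> Min ?S \<le> s" if "s \<in> N" for s
  proof (cases "s < a + 1")
    case True
    then show ?thesis using Min_le[OF f, of s] that by force
  next
    case False
    then show ?thesis using m by auto
  qed
  then have "{s \<in> N. s < Min ?S} = insert r {s \<in> N. s < r}" using m r(1) by force
  then have "card {s \<in> N. s < Min ?S} = Suc k" using fin[of r] r(2) by simp
  then show ?case using m by blast
qed

lemma kth_smallest_unique:
  fixes N :: "real set"
  assumes "r \<in> N" "r' \<in> N" "finite {s \<in> N. s < r}" "finite {s \<in> N. s < r'}"
    "card {s \<in> N. s < r} = card {s \<in> N. s < r'}"
  shows "r = r'"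
proof (rule ccontr)
  have *: "card {s \<in> N. s < a} < card {s \<in> N. s < b}" if "a < b" "a \<in> N" "finite {s \<in> N. s < b}" for a b
    using that by (intro psubset_card_mono) force+
  assume "r \<noteq> r'"
  then show False using *[of r r'] *[of r' r] assms by force
qed

section \<open>Coordinates and distances in a lattice\<close>

context
  fixes \<Gamma> :: "(real^'n::finite) set" and v :: "'n \<Rightarrow> real^'n"
  assumes basis: "lattice_basis v \<Gamma>"
begin

lemma lattice_basis_coeffs_zero:
  assumes "(\<Sum>j\<in>UNIV. a j *\<^sub>R v j) = 0"
  shows "a j = 0"
proof -
  have v: "inj v" "independent (range v)" using basis by (auto simp: lattice_basis_def)
  have "(\<Sum>w\<in>range v. a (inv v w) *\<^sub>R w) = 0"
    using assms v(1) by (simp add: sum.reindex)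
  then have "a (inv v (v j)) = 0"
    using independentD[OF v(2), of "range v" "\<lambda>w. a (inv v w)" "v j"] by simp
  then show ?thesis using v(1) by simp
qed

lemma lattice_basis_coeffs_unique:
  assumes "(\<Sum>j\<in>UNIV. a j *\<^sub>R v j) = (\<Sum>j\<in>UNIV. b j *\<^sub>R v j)"
  shows "a = b"
proof
  fix j
  have "(\<Sum>j\<in>UNIV. (a j - b j) *\<^sub>R v j) = 0"
    using assms by (simp add: scaleR_left_diff_distrib sum_subtractf)
  then show "a j = b j" using lattice_basis_coeffs_zero[of "\<lambda>j. a j - b j" j] by simp
qed

lemma lattice_coords_sum: "lattice_coords v (\<Sum>j\<in>UNIV. of_int (c j) *\<^sub>R v j) = c"
proof -
  have "c' = c" if "(\<Sum>j\<in>UNIV. of_int (c j) *\<^sub>R v j) = (\<Sum>j\<in>UNIV. of_int (c' j) *\<^sub>R v j)" for c'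
    using lattice_basis_coeffs_unique[OF that] by (metis of_int_eq_iff ext)
  then show ?thesis unfolding lattice_coords_def by (intro the_equality) auto
qed

lemma lattice_iff: "g \<in> \<Gamma> \<longleftrightarrow> (\<exists>c. g = (\<Sum>j\<in>UNIV. of_int (c j) *\<^sub>R v j))"
  using basis by (auto simp: lattice_basis_def)

lemma lattice_zero: "0 \<in> \<Gamma>"
  unfolding lattice_iff by (rule exI[of _ "\<lambda>_. 0"]) simp

lemma lattice_add: "g \<in> \<Gamma> \<Longrightarrow> h \<in> \<Gamma> \<Longrightarrow> g + h \<in> \<Gamma>"
proof -
  assume "g \<in> \<Gamma>" "h \<in> \<Gamma>"
  then obtain c d where "g = (\<Sum>j\<in>UNIV. of_int (c j) *\<^sub>R v j)" "h = (\<Sum>j\<in>UNIV. of_int (d j) *\<^sub>R v j)"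
    unfolding lattice_iff by blast
  then have "g + h = (\<Sum>j\<in>UNIV. of_int (c j + d j) *\<^sub>R v j)"
    by (simp add: scaleR_left_distrib sum.distrib)
  then show ?thesis unfolding lattice_iff by (rule exI[of _ "\<lambda>j. c j + d j"])
qed

lemma lattice_scale: "g \<in> \<Gamma> \<Longrightarrow> of_int m *\<^sub>R g \<in> \<Gamma>"
proof -
  assume "g \<in> \<Gamma>"
  then obtain c where "g = (\<Sum>j\<in>UNIV. of_int (c j) *\<^sub>R v j)" unfolding lattice_iff by blast
  then have "of_int m *\<^sub>R g = (\<Sum>j\<in>UNIV. of_int (m * c j) *\<^sub>R v j)"
    by (simp add: scaleR_right.sum)
  then show ?thesis unfolding lattice_iff by (rule exI[of _ "\<lambda>j. m * c j"])
qed

lemma lattice_generated_subset: "S \<subseteq> \<Gamma> \<Longrightarrow> lattice_generated S \<subseteq> \<Gamma>"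
proof clarify
  fix g assume S: "S \<subseteq> \<Gamma>" and "g \<in> lattice_generated S"
  then obtain F c where F: "finite F" "F \<subseteq> S" "g = (\<Sum>s\<in>F. of_int (c s) *\<^sub>R s)"
    unfolding lattice_generated_def by blast
  have "(\<Sum>s\<in>F. of_int (c s) *\<^sub>R s) \<in> \<Gamma>"
    using F(1,2)
  proof (induction F)
    case (insert s F)
    then show ?case using lattice_add[OF lattice_scale[of s "c s"]] S by auto
  qed (simp add: lattice_zero)
  then show "g \<in> \<Gamma>" using F(3) by simp
qed

text \<open>The map from real coordinates to vectors is linear and injective, hence bounded below;
  short lattice vectors thus have bounded integer coordinates.\<close>

lemma finite_lattice_ball: "finite {g \<in> \<Gamma>. norm g < r}"
proof -
  let ?L = "\<lambda>x :: real^'n. \<Sum>j\<in>UNIV. x $ j *\<^sub>R v j"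
  have lin: "linear ?L"
    by (rule linearI) (auto simp: scaleR_left_distrib sum.distrib scaleR_right.sum)
  have "x = 0" if "?L x = 0" for x
    using lattice_basis_coeffs_zero[OF that] by (simp add: vec_eq_iff)
  then have "inj ?L" by (simp add: linear_injective_0[OF lin])
  then obtain b where b: "b > 0" "\<And>x. b * norm x \<le> norm (?L x)"
    using linear_inj_bounded_below_pos[OF lin] by metis
  define N where "N = \<lceil>r / b\<rceil>"
  have "{g \<in> \<Gamma>. norm g < r} \<subseteq> (\<lambda>c. \<Sum>j\<in>UNIV. of_int (c j) *\<^sub>R v j) ` (UNIV \<rightarrow>\<^sub>E {-N..N})"
  proof clarify
    fix g assume g: "g \<in> \<Gamma>" "norm g < r"
    then obtain c where c: "g = (\<Sum>j\<in>UNIV. of_int (c j) *\<^sub>R v j)" using lattice_iff by blast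
    have "c j \<in> {-N..N}" for j
    proof -
      have "b * \<bar>real_of_int (c j)\<bar> \<le> b * norm (\<chi> j. real_of_int (c j))"
        using b(1) component_le_norm_cart[of "\<chi> j. real_of_int (c j)" j] by simp
      also have "\<dots> \<le> norm g" using b(2)[of "\<chi> j. real_of_int (c j)"] by (simp add: c)
      finally have "b * \<bar>real_of_int (c j)\<bar> \<le> r" using g(2) by simp
      then have "\<bar>real_of_int (c j)\<bar> \<le> r / b" using b(1) by (simp add: field_simps)
      then have "\<bar>real_of_int (c j)\<bar> \<le> of_int N" unfolding N_def by linarith
      then have "\<bar>c j\<bar> \<le> N" by (metis of_int_abs of_int_le_iff)
      then show ?thesis by auto
    qed
    then show "g \<in> (\<lambda>c. \<Sum>j\<in>UNIV. of_int (c j) *\<^sub>R v j) ` (UNIV \<rightarrow>\<^sub>E {-N..N})"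
      using c by (intro image_eqI[of _ _ c]) auto
  qed
  then show ?thesis by (rule finite_subset) (intro finite_imageI finite_PiE, auto)
qed

lemma lattice_basis_nonzero: "v i \<noteq> 0"
  using basis dependent_zero[of "range v"] unfolding lattice_basis_def by (metis rangeI)

lemma lattice_basis_in_lattice: "v i \<in> \<Gamma>"
proof -
  have "v i = (\<Sum>j\<in>UNIV. of_int (if j = i then 1 else 0) *\<^sub>R v j)"
    by (simp add: if_distrib[of of_int] if_distrib[of "\<lambda>x. x *\<^sub>R _"] cong: if_cong)
  then show ?thesis unfolding lattice_iff by (rule exI[of _ "\<lambda>j. if j = i then 1 else 0"])
qed

text \<open>Makes the definite description in \<open>neighbour_distance\<close> meaningful: the
  norms are infinite in number, because of the multiples of a basis vector, and finite below every
  bound.\<close>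

lemma neighbour_distance_in_norms:
  assumes "k \<ge> 1"
  shows "neighbour_distance \<Gamma> k \<in> norm ` (\<Gamma> - {0})"
proof -
  let ?N = "norm ` (\<Gamma> - {0})"
  have fin: "finite {s \<in> ?N. s < r}" for r
    by (rule finite_subset[OF _ finite_imageI[OF finite_lattice_ball[of r], of norm]]) auto
  obtain i :: 'n where True by blast
  let ?f = "\<lambda>m::nat. norm (of_int (int (Suc m)) *\<^sub>R v i)"
  have "inj ?f" using lattice_basis_nonzero by (auto simp: inj_on_def)
  then have "infinite (range ?f)" by (rule range_inj_infinite)
  moreover have "range ?f \<subseteq> ?N"
  proof (intro image_subsetI imageI)
    show "of_int (int (Suc m)) *\<^sub>R v i \<in> \<Gamma> - {0}" for m
      using lattice_scale[OF lattice_basis_in_lattice[of i], of "int (Suc m)"] lattice_basis_nonzero[of i]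
      by auto
  qed
  ultimately have "infinite ?N" using finite_subset by blast
  \<comment> \<open>Distances are counted from \<open>k = 1\<close>, so \<open>k - 1\<close> of them
    lie below the k-th.\<close>
  then obtain r where r: "r \<in> ?N" "card {s \<in> ?N. s < r} = k - 1"
    using kth_smallest_exists[OF _ fin] by blast
  have "neighbour_distance \<Gamma> k = r"
    unfolding neighbour_distance_def
    using r fin assms by (intro the_equality) (auto intro: kth_smallest_unique[of _ ?N, OF _ _ fin fin])
  then show ?thesis using r by simp
qed

lemma neighbour_scale_pos:
  assumes "k \<ge> 1"
  shows "neighbour_scale \<Gamma> k > 0"
  using neighbour_distance_in_norms[OF assms] neighbour_distance_in_norms[of 1]
  by (auto simp: neighbour_scale_def intro!: divide_pos_pos)

lemma neighbour_scale_nat: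
  assumes "k \<ge> 1" "commensurate \<Gamma> k"
  obtains l :: nat where "l > 0" "real l = neighbour_scale \<Gamma> k"
proof -
  obtain i :: 'n where True by blast
  let ?s = "neighbour_scale \<Gamma> k"
  have "?s *\<^sub>R v i \<in> neighbour_sublattice \<Gamma> k"
    using assms(2) lattice_basis_in_lattice by (auto simp: commensurate_def)
  then have "?s *\<^sub>R v i \<in> \<Gamma>"
    using lattice_generated_subset[of "neighbours \<Gamma> k"]
    by (auto simp: neighbour_sublattice_def neighbours_def)
  then obtain c where c: "?s *\<^sub>R v i = (\<Sum>j\<in>UNIV. of_int (c j) *\<^sub>R v j)" using lattice_iff by blast
  have "?s *\<^sub>R v i = (\<Sum>j\<in>UNIV. (if j = i then ?s else 0) *\<^sub>R v j)"
    by (simp add: if_distrib[of "\<lambda>x. x *\<^sub>R _"] cong: if_cong)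
  then have "(\<lambda>j. of_int (c j)) = (\<lambda>j. if j = i then ?s else 0)"
    using c by (intro lattice_basis_coeffs_unique) simp
  then have "of_int (c i) = ?s" by (auto dest: fun_cong[of _ _ i])
  then have "real (nat (c i)) = ?s" "nat (c i) > 0" using neighbour_scale_pos[OF assms(1)] by auto
  then show ?thesis using that by blast
qed

lemma translation_scale:
  assumes "e \<in> \<Gamma>" "\<And>i. w i = real l *\<^sub>R v i"
  shows "translation v (\<Sum>i\<in>UNIV. of_int (lattice_coords v e i) *\<^sub>R w i) \<theta>
    = translation v e (torus_scale l \<theta>)"
proof -
  obtain c where c: "e = (\<Sum>j\<in>UNIV. of_int (c j) *\<^sub>R v j)" using assms(1) lattice_iff by blast
  have "(\<Sum>i\<in>UNIV. of_int (lattice_coords v e i) *\<^sub>R w i) = (\<Sum>j\<in>UNIV. of_int (int l * c j) *\<^sub>R v j)"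
    by (simp add: c lattice_coords_sum assms(2) mult.commute)
  then have "lattice_coords v (\<Sum>i\<in>UNIV. of_int (lattice_coords v e i) *\<^sub>R w i) = (\<lambda>j. int l * c j)"
    using lattice_coords_sum by metis
  moreover have "torus_character (torus_scale l \<theta>) j = torus_character \<theta> j ^ l" for j
    by transfer (simp add: Complex.DeMoivre)
  ultimately show ?thesis
    by (simp add: translation_def c lattice_coords_sum power_int_mult)
qed

lemma neighbour_hamiltonian_eq:
  assumes "\<And>i. w i = real l *\<^sub>R v i"
  shows "neighbour_hamiltonian \<Gamma> v w t \<theta> = lattice_hamiltonian \<Gamma> v t (torus_scale l \<theta>)"
proof -
  have "e \<in> \<Gamma>" if "e \<in> hoppings \<Gamma>" for e
    using that lattice_zero by (auto simp: hoppings_def neighbours_def)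
  then show ?thesis
    unfolding neighbour_hamiltonian_def lattice_hamiltonian_def
    by (simp add: translation_scale[OF _ assms] cong: sum.cong)
qed

end

lemma prod_cis: "(\<Prod>j\<in>A. cis (f j)) = cis (\<Sum>j\<in>A. f j)"
  by (induction A rule: infinite_finite_induct) (auto simp: cis_mult)

lemma C_k_matrix_lattice_hamiltonian:
  fixes v :: "'n::finite \<Rightarrow> real^'n"
  shows "C_k_matrix m (\<lambda>x. lattice_hamiltonian \<Gamma> v t (abs_torus x) :: complex^'d^'d::finite)"
proof -
  have "translation v g (abs_torus x) = cis (\<Sum>j\<in>UNIV. of_int (lattice_coords v g j) * x $ j)"
    for g and x :: "real^'n"
    by (simp add: translation_def torus_character.abs_eq cis_power_int prod_cis)
  moreover have "linear (\<lambda>x :: real^'n. \<Sum>j\<in>UNIV. of_int (lattice_coords v g j) * x $ j)" for g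
    by (rule linearI) (auto simp: algebra_simps sum.distrib sum_distrib_left)
  ultimately show ?thesis
    unfolding C_k_matrix_def lattice_hamiltonian_def
    by (simp add: C_k_sum C_k_mult C_k_cis_linear)
qed

section \<open>Differential forms on the torus\<close>

lemma linear_cmult: "linear f \<Longrightarrow> linear (\<lambda>u. c * f u)" for f :: "'a::real_vector \<Rightarrow> complex"
  by (intro linearI) (auto simp: linear_add linear_scale distrib_left)

lemma torus_cases: obtains x where "\<theta> = abs_torus x"
  by (metis abs_rep_torus)

lemma
  assumes "smooth_form p \<omega>"
  shows smooth_form_C_k: "C_k m (\<lambda>x. \<omega> (abs_torus x) V)"
    and smooth_form_cong: "(\<And>i. i < p \<Longrightarrow> V i = W i) \<Longrightarrow> \<omega> \<theta> V = \<omega> \<theta> W"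
    and smooth_form_linear: "i < p \<Longrightarrow> linear (\<lambda>u. \<omega> \<theta> (V(i := u)))"
    and smooth_form_alternating: "i < j \<Longrightarrow> j < p \<Longrightarrow> V i = V j \<Longrightarrow> \<omega> \<theta> V = 0"
  using assms unfolding smooth_form_def by blast+

lemma smooth_formI:
  assumes "\<And>V m. C_k m (\<lambda>x. \<omega> (abs_torus x) V)"
    and "\<And>\<theta> V W. (\<And>i. i < p \<Longrightarrow> V i = W i) \<Longrightarrow> \<omega> \<theta> V = \<omega> \<theta> W"
    and "\<And>\<theta> V i. i < p \<Longrightarrow> linear (\<lambda>u. \<omega> \<theta> (V(i := u)))"
    and "\<And>\<theta> V i j. i < j \<Longrightarrow> j < p \<Longrightarrow> V i = V j \<Longrightarrow> \<omega> \<theta> V = 0"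
  shows "smooth_form p \<omega>"
  unfolding smooth_form_def using assms by blast

lemma smooth_form_has_derivative:
  assumes "smooth_form p \<omega>"
  shows "((\<lambda>x. \<omega> (abs_torus x) V) has_derivative torus_deriv (\<lambda>\<theta>. \<omega> \<theta> V) (abs_torus x)) (at x)"
proof -
  have "torus_deriv (\<lambda>\<theta>. \<omega> \<theta> V) (abs_torus x) = (\<lambda>u. dir_deriv (\<lambda>x. \<omega> (abs_torus x) V) u x)"
    by (auto simp: torus_deriv_abs)
  then show ?thesis using C_k_SucD(1)[OF smooth_form_C_k[OF assms]] by simp
qed

lemma torus_deriv_eq:
  assumes "((\<lambda>x. g (abs_torus x)) has_derivative D) (at x)"
  shows "torus_deriv g (abs_torus x) u = D u"
  using dir_deriv_eq[OF assms] by (simp add: torus_deriv_abs)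

lemma linear_torus_deriv:
  assumes "smooth_form p \<omega>"
  shows "linear (torus_deriv (\<lambda>\<theta>. \<omega> \<theta> V) \<theta>)"
  using smooth_form_has_derivative[OF assms] has_derivative_linear by (cases \<theta> rule: torus_cases) blast

lemma torus_deriv_combination:
  assumes "smooth_form p \<omega>" "smooth_form q \<eta>"
  shows "torus_deriv (\<lambda>\<theta>. a * \<omega> \<theta> V + b * \<eta> \<theta> W) \<theta> u
    = a * torus_deriv (\<lambda>\<theta>. \<omega> \<theta> V) \<theta> u + b * torus_deriv (\<lambda>\<theta>. \<eta> \<theta> W) \<theta> u"
proof (cases \<theta> rule: torus_cases)
  case (1 x)
  show ?thesis unfolding 1
    by (rule torus_deriv_eq)
      (intro has_derivative_add has_derivative_mult_right smooth_form_has_derivative[OF assms(1)]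
        smooth_form_has_derivative[OF assms(2)])
qed

lemma smooth_form_combination:
  assumes "smooth_form p \<omega>" "smooth_form p \<eta>"
  shows "smooth_form p (\<lambda>\<theta> V. a * \<omega> \<theta> V + b * \<eta> \<theta> V)"
proof (rule smooth_formI)
  show "C_k m (\<lambda>x. a * \<omega> (abs_torus x) V + b * \<eta> (abs_torus x) V)" for m V
    by (intro C_k_add C_k_mult C_k_const smooth_form_C_k[OF assms(1)] smooth_form_C_k[OF assms(2)])
  show "a * \<omega> \<theta> V + b * \<eta> \<theta> V = a * \<omega> \<theta> W + b * \<eta> \<theta> W" if "\<And>i. i < p \<Longrightarrow> V i = W i" for \<theta> V W
    using smooth_form_cong[OF assms(1) that] smooth_form_cong[OF assms(2) that] by simp
  show "linear (\<lambda>u. a * \<omega> \<theta> (V(i := u)) + b * \<eta> \<theta> (V(i := u)))" if "i < p" for \<theta> V i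
    using smooth_form_linear[OF assms(1) that, of \<theta> V] smooth_form_linear[OF assms(2) that, of \<theta> V]
    by (intro linear_compose_add linear_cmult)
  show "a * \<omega> \<theta> V + b * \<eta> \<theta> V = 0" if "i < j" "j < p" "V i = V j" for \<theta> V i j
    using smooth_form_alternating[OF assms(1) that] smooth_form_alternating[OF assms(2) that] by simp
qed

lemma smooth_form_zero: "smooth_form p (\<lambda>\<theta> V. 0)"
  by (rule smooth_formI) (auto intro: linearI)

lemma exterior_derivative_combination:
  assumes "smooth_form p \<omega>" "smooth_form p \<eta>"
  shows "exterior_derivative p (\<lambda>\<theta> V. a * \<omega> \<theta> V + b * \<eta> \<theta> V)
    = (\<lambda>\<theta> V. a * exterior_derivative p \<omega> \<theta> V + b * exterior_derivative p \<eta> \<theta> V)"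
  unfolding exterior_derivative_def torus_deriv_combination[OF assms]
  by (simp add: sum_distrib_left sum.distrib algebra_simps)

lemma exact_form_combination:
  assumes "exact_form p \<omega>" "exact_form p \<eta>"
  shows "exact_form p (\<lambda>\<theta> V. a * \<omega> \<theta> V + b * \<eta> \<theta> V)"
proof (cases p)
  case (Suc q)
  then obtain \<alpha> \<beta> where "smooth_form q \<alpha>" "\<omega> = exterior_derivative q \<alpha>"
      "smooth_form q \<beta>" "\<eta> = exterior_derivative q \<beta>"
    using assms by (auto simp: exact_form_def)
  then show ?thesis
    unfolding exact_form_def Suc nat.case
    by (intro exI[of _ "\<lambda>\<theta> V. a * \<alpha> \<theta> V + b * \<beta> \<theta> V"])
      (simp add: smooth_form_combination exterior_derivative_combination)
qed (use assms in \<open>simp add: exact_form_def\<close>)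

lemma exact_form_zero: "exact_form p ((\<lambda>\<theta> V. 0) :: 'n::finite form)"
proof (cases p)
  case (Suc q)
  have "exterior_derivative q ((\<lambda>\<theta> V. 0) :: 'n form) = (\<lambda>\<theta> V. 0)"
    using exterior_derivative_combination[OF smooth_form_zero smooth_form_zero, where a = 0 and b = 0] by simp
  then show ?thesis
    unfolding exact_form_def Suc nat.case by (intro exI[of _ "\<lambda>\<theta> V. 0"]) (simp add: smooth_form_zero)
qed (simp add: exact_form_def)

lemma exact_form_scale: "exact_form p \<omega> \<Longrightarrow> exact_form p (\<lambda>\<theta> V. a * \<omega> \<theta> V)"
  using exact_form_combination[of p \<omega> \<omega> a 0] by simp

lemma exact_form_add: "exact_form p \<omega> \<Longrightarrow> exact_form p \<eta> \<Longrightarrow> exact_form p (\<lambda>\<theta> V. \<omega> \<theta> V + \<eta> \<theta> V)"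
  using exact_form_combination[of p \<omega> \<eta> 1 1] by simp

lemma deRham_class_eqI:
  assumes "exact_form p (\<lambda>\<theta> V. \<omega>' \<theta> V - \<omega> \<theta> V)"
  shows "deRham_class p \<omega>' = deRham_class p \<omega>"
proof (rule set_eqI)
  fix \<eta>
  have "exact_form p (\<lambda>\<theta> V. \<eta> \<theta> V - \<omega> \<theta> V)" if "exact_form p (\<lambda>\<theta> V. \<eta> \<theta> V - \<omega>' \<theta> V)"
    using exact_form_add[OF that assms] by simp
  moreover have "exact_form p (\<lambda>\<theta> V. \<eta> \<theta> V - \<omega>' \<theta> V)" if "exact_form p (\<lambda>\<theta> V. \<eta> \<theta> V - \<omega> \<theta> V)"
    using exact_form_combination[OF that assms, of 1 "-1"] by simp
  ultimately show "\<eta> \<in> deRham_class p \<omega>' \<longleftrightarrow> \<eta> \<in> deRham_class p \<omega>"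
    unfolding deRham_class_def by blast
qed

text \<open>\<open>class_map\<close> is a union over all representatives. It is a single class
  because their images differ by exact forms.\<close>

lemma class_map_deRham_class:
  assumes "\<And>\<omega>'. exact_form p (\<lambda>\<theta> V. \<omega>' \<theta> V - \<omega> \<theta> V) \<Longrightarrow> exact_form p (\<lambda>\<theta> V. \<Phi> \<omega>' \<theta> V - \<Phi> \<omega> \<theta> V)"
  shows "class_map p \<Phi> (deRham_class p \<omega>) = deRham_class p (\<Phi> \<omega>)"
proof -
  have "deRham_class p (\<Phi> \<omega>') = deRham_class p (\<Phi> \<omega>)" if "\<omega>' \<in> deRham_class p \<omega>" for \<omega>'
    using that assms by (intro deRham_class_eqI) (auto simp: deRham_class_def)
  moreover have "\<omega> \<in> deRham_class p \<omega>" by (simp add: deRham_class_def exact_form_zero)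
  ultimately show ?thesis unfolding class_map_def by blast
qed

lemma scale_class_deRham_class: "scale_class c p (deRham_class p \<omega>) = deRham_class p (scale_form c \<omega>)"
proof (rule class_map_deRham_class)
  fix \<omega>' assume "exact_form p (\<lambda>\<theta> V. \<omega>' \<theta> V - \<omega> \<theta> V)"
  from exact_form_scale[OF this, of c]
  show "exact_form p (\<lambda>\<theta> V. scale_form c \<omega>' \<theta> V - scale_form c \<omega> \<theta> V)"
    by (simp add: scale_form_def right_diff_distrib)
qed

section \<open>Pull-back under the scaling map\<close>

lemma pullback_form_scale:
  "pullback_form (torus_scale l) \<omega> = (\<lambda>\<theta> V. \<omega> (torus_scale l \<theta>) (\<lambda>i. of_nat l *\<^sub>R V i))"
  by (simp add: pullback_form_def torus_map_deriv_scale)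

lemma smooth_form_pullback:
  assumes "smooth_form p \<omega>"
  shows "smooth_form p (pullback_form (torus_scale l) \<omega>)"
  unfolding pullback_form_scale
proof (rule smooth_formI)
  have lin: "linear (\<lambda>x :: real^'a. of_nat l *\<^sub>R x)" by (intro linearI) (auto simp: scaleR_right_distrib)
  show "C_k m (\<lambda>x. \<omega> (torus_scale l (abs_torus x)) (\<lambda>i. of_nat l *\<^sub>R V i))" for m V
    unfolding torus_scale_abs by (rule C_k_compose_linear[OF lin smooth_form_C_k[OF assms]])
  show "\<omega> (torus_scale l \<theta>) (\<lambda>i. of_nat l *\<^sub>R V i) = \<omega> (torus_scale l \<theta>) (\<lambda>i. of_nat l *\<^sub>R W i)"
    if "\<And>i. i < p \<Longrightarrow> V i = W i" for \<theta> V W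
    using that by (intro smooth_form_cong[OF assms]) simp
  show "linear (\<lambda>u. \<omega> (torus_scale l \<theta>) (\<lambda>j. of_nat l *\<^sub>R (V(i := u)) j))" if "i < p" for \<theta> V i
  proof -
    have "(\<lambda>j. of_nat l *\<^sub>R (V(i := u)) j) = (\<lambda>j. of_nat l *\<^sub>R V j)(i := of_nat l *\<^sub>R u)" for u by auto
    then show ?thesis
      using linear_compose[OF lin smooth_form_linear[OF assms that]] by (simp add: o_def)
  qed
  show "\<omega> (torus_scale l \<theta>) (\<lambda>i. of_nat l *\<^sub>R V i) = 0" if "i < j" "j < p" "V i = V j" for \<theta> V i j
    using that by (intro smooth_form_alternating[OF assms that(1,2)]) simp
qed

lemma exterior_derivative_pullback:
  fixes \<omega> :: "'n::finite form"
  assumes "smooth_form p \<omega>"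
  shows "exterior_derivative p (pullback_form (torus_scale l) \<omega>)
    = pullback_form (torus_scale l) (exterior_derivative p \<omega>)"
proof (intro ext)
  fix \<theta> :: "'n torus" and V :: "nat \<Rightarrow> real^'n"
  obtain x where \<theta>: "\<theta> = abs_torus x" by (rule torus_cases)
  have "torus_deriv (\<lambda>\<theta>. \<omega> (torus_scale l \<theta>) W) \<theta> u = torus_deriv (\<lambda>\<theta>. \<omega> \<theta> W) (torus_scale l \<theta>) (of_nat l *\<^sub>R u)" for W u
    unfolding \<theta> torus_scale_abs
  proof (rule torus_deriv_eq)
    have "((\<lambda>x. of_nat l *\<^sub>R x) has_derivative (\<lambda>u. of_nat l *\<^sub>R u)) (at x)"
      by (auto intro!: derivative_eq_intros)
    from has_derivative_compose[OF this smooth_form_has_derivative[OF assms]]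
    show "((\<lambda>x. \<omega> (torus_scale l (abs_torus x)) W) has_derivative
        (\<lambda>u. torus_deriv (\<lambda>\<theta>. \<omega> \<theta> W) (abs_torus (of_nat l *\<^sub>R x)) (of_nat l *\<^sub>R u))) (at x)"
      by (simp add: torus_scale_abs)
  qed
  moreover have "(\<lambda>j. of_nat l *\<^sub>R omit i V j) = omit i (\<lambda>j. of_nat l *\<^sub>R V j)" for i
    by (auto simp: omit_def)
  ultimately show "exterior_derivative p (pullback_form (torus_scale l) \<omega>) \<theta> V
      = pullback_form (torus_scale l) (exterior_derivative p \<omega>) \<theta> V"
    unfolding exterior_derivative_def pullback_form_scale by simp
qed

lemma exact_form_pullback:
  assumes "exact_form p \<omega>"
  shows "exact_form p (pullback_form (torus_scale l) \<omega>)"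
proof (cases p)
  case (Suc q)
  then obtain \<eta> where "smooth_form q \<eta>" "\<omega> = exterior_derivative q \<eta>"
    using assms by (auto simp: exact_form_def)
  then show ?thesis
    unfolding exact_form_def Suc nat.case
    by (intro exI[of _ "pullback_form (torus_scale l) \<eta>"])
      (simp add: smooth_form_pullback exterior_derivative_pullback)
qed (use assms in \<open>simp add: exact_form_def pullback_form_def\<close>)

lemma pullback_class_deRham_class:
  "pullback_class (torus_scale l) p (deRham_class p \<omega>) = deRham_class p (pullback_form (torus_scale l) \<omega>)"
proof (rule class_map_deRham_class)
  fix \<omega>' assume "exact_form p (\<lambda>\<theta> V. \<omega>' \<theta> V - \<omega> \<theta> V)"
  from exact_form_pullback[OF this, of l]
  show "exact_form p (\<lambda>\<theta> V. pullback_form (torus_scale l) \<omega>' \<theta> V - pullback_form (torus_scale l) \<omega> \<theta> V)"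
    by (simp add: pullback_form_def)
qed

section \<open>Forms of degree at least the dimension\<close>

text \<open>Evaluation at \<open>a + b\<close> in two adjacent slots shows that swapping neighbours
  changes the sign; such swaps bring equal arguments next to each other. For exterior derivatives
  the adjacent case is the one that can be checked directly.\<close>

lemma multilinear_adjacent_alternating:
  fixes \<Phi> :: "(nat \<Rightarrow> 'a::real_vector) \<Rightarrow> complex"
  assumes lin: "\<And>V i. i < p \<Longrightarrow> linear (\<lambda>u. \<Phi> (V(i := u)))"
    and adj: "\<And>V i. Suc i < p \<Longrightarrow> V i = V (Suc i) \<Longrightarrow> \<Phi> V = 0"
  shows "i < j \<Longrightarrow> j < p \<Longrightarrow> V i = V j \<Longrightarrow> \<Phi> V = 0"
proof -
  have add: "\<Phi> (V(k := a + b)) = \<Phi> (V(k := a)) + \<Phi> (V(k := b))" if "k < p" for V k a b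
    using linear_add[OF lin[OF that]] .
  have swap: "\<Phi> (V(k := a, Suc k := b)) = - \<Phi> (V(k := b, Suc k := a))" if "Suc k < p" for V k a b
  proof -
    have k: "k < p" using that by simp
    have comm: "V(k := a, Suc k := b) = V(Suc k := b, k := a)" for a b by (simp add: fun_upd_twist)
    have z: "\<Phi> (V(k := c, Suc k := c)) = 0" for c using that by (intro adj) auto
    have "\<Phi> (V(k := a + b, Suc k := a + b)) = \<Phi> (V(k := a + b, Suc k := a)) + \<Phi> (V(k := a + b, Suc k := b))"
      by (rule add[OF that])
    also have "\<Phi> (V(k := a + b, Suc k := a)) = \<Phi> (V(k := a, Suc k := a)) + \<Phi> (V(k := b, Suc k := a))"
      unfolding comm by (rule add[OF k])
    also have "\<Phi> (V(k := a + b, Suc k := b)) = \<Phi> (V(k := a, Suc k := b)) + \<Phi> (V(k := b, Suc k := b))"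
      unfolding comm by (rule add[OF k])
    finally show ?thesis unfolding z by (metis add.left_neutral add.right_neutral add_eq_0_iff)
  qed
  have *: "\<Phi> V = 0" if "i + Suc d < p" "V i = V (i + Suc d)" for d V i
    using that
  proof (induction d arbitrary: V)
    case 0
    then show ?case by (intro adj) auto
  next
    case (Suc d)
    let ?k = "i + Suc d"
    have "\<Phi> V = \<Phi> (V(?k := V ?k, Suc ?k := V (Suc ?k)))" by simp
    also have "\<dots> = - \<Phi> (V(?k := V (Suc ?k), Suc ?k := V ?k))"
      using Suc.prems by (intro swap) simp
    also have "\<Phi> (V(?k := V (Suc ?k), Suc ?k := V ?k)) = 0"
      using Suc.prems by (intro Suc.IH) auto
    finally show ?case by simp
  qed
  assume "i < j" "j < p" "V i = V j"
  then show "\<Phi> V = 0" using *[of i "j - Suc i" V] by simp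
qed

text \<open>Among more than \<open>CARD('n)\<close> distinct vectors one lies in the span of the
  others, and linearity in its slot reduces to repeated arguments. Repetitions are treated apart
  since dependence speaks of the set of vectors.\<close>

lemma alternating_eq_0:
  fixes \<Phi> :: "(nat \<Rightarrow> real^'n::finite) \<Rightarrow> complex"
  assumes lin: "\<And>V i. i < p \<Longrightarrow> linear (\<lambda>u. \<Phi> (V(i := u)))"
    and alt: "\<And>V i j. i < j \<Longrightarrow> j < p \<Longrightarrow> V i = V j \<Longrightarrow> \<Phi> V = 0"
    and p: "p > CARD('n)"
  shows "\<Phi> V = 0"
proof -
  have alt': "\<Phi> V = 0" if "i \<noteq> j" "i < p" "j < p" "V i = V j" for V i j
    using alt[of i j V] alt[of j i V] that by (cases "i < j") auto
  show ?thesis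
  proof (cases "inj_on V {..<p}")
    case True
    then have "card (V ` {..<p}) = p" by (simp add: card_image)
    then have "dependent (V ` {..<p})"
      using p independent_bound[of "V ` {..<p}"] by auto
    then obtain m where m: "m < p" "V m \<in> span (V ` {..<p} - {V m})"
      by (auto simp: dependent_def)
    have "\<Phi> (V(m := u)) = 0" if "u \<in> span (V ` {..<p} - {V m})" for u
    proof (rule linear_eq_0_on_span[OF lin[OF m(1)] _ that])
      fix w assume "w \<in> V ` {..<p} - {V m}"
      then obtain i where "i < p" "i \<noteq> m" "w = V i" by auto
      then show "\<Phi> (V(m := w)) = 0" using m(1) by (intro alt'[of i m]) auto
    qed
    from this[OF m(2)] show ?thesis by simp
  next
    case False
    then obtain i j where "i \<noteq> j" "i < p" "j < p" "V i = V j" by (auto simp: inj_on_def)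
    then show ?thesis by (rule alt')
  qed
qed

text \<open>The exterior derivative is alternating in \<open>Suc p\<close> arguments, more than the
  dimension. If two neighbouring arguments agree, the two terms that omit one of them cancel by
  their signs.\<close>

lemma exterior_derivative_top_degree:
  fixes \<omega> :: "'n::finite form"
  assumes "smooth_form p \<omega>" "p \<ge> CARD('n)"
  shows "exterior_derivative p \<omega> \<theta> V = 0"
proof (rule alternating_eq_0[where p = "Suc p"])
  let ?\<Phi> = "exterior_derivative p \<omega> \<theta>"
  show lin: "linear (\<lambda>u. ?\<Phi> (V(m := u)))" if "m < Suc p" for V m
    unfolding exterior_derivative_def
  proof (intro linear_compose_sum ballI)
    fix k assume "k \<in> {..p}"

    show "linear (\<lambda>u. (-1) ^ k * torus_deriv (\<lambda>\<eta>. \<omega> \<eta> (omit k (V(m := u)))) \<theta> ((V(m := u)) k))"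
    proof (cases "k = m")
      case True
      then have "omit k (V(m := u)) = omit k V" for u by (auto simp: omit_def)
      then show ?thesis using True linear_torus_deriv[OF assms(1)] by (simp add: linear_cmult)
    next
      case False
      \<comment> \<open>The position of the \<open>m\<close>-th argument after the
        \<open>k\<close>-th has been omitted.\<close>
      define m' where "m' = (if m < k then m else m - 1)"
      have m': "m' < p" using that False \<open>k \<in> {..p}\<close> by (auto simp: m'_def)
      have om: "omit k (V(m := u)) = (omit k V)(m' := u)" for u
        using False by (auto simp: omit_def m'_def fun_eq_iff)
      have "linear (\<lambda>u. torus_deriv (\<lambda>\<eta>. \<omega> \<eta> ((omit k V)(m' := u))) \<theta> (V k))"
      proof (rule linearI)
        note l = smooth_form_linear[OF assms(1) m', of _ "omit k V"]
        show "torus_deriv (\<lambda>\<eta>. \<omega> \<eta> ((omit k V)(m' := u + w))) \<theta> (V k) =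
            torus_deriv (\<lambda>\<eta>. \<omega> \<eta> ((omit k V)(m' := u))) \<theta> (V k) +
            torus_deriv (\<lambda>\<eta>. \<omega> \<eta> ((omit k V)(m' := w))) \<theta> (V k)" for u w
          using torus_deriv_combination[OF assms(1,1), of 1 _ 1] by (simp add: linear_add[OF l])
        show "torus_deriv (\<lambda>\<eta>. \<omega> \<eta> ((omit k V)(m' := r *\<^sub>R u))) \<theta> (V k) =
            r *\<^sub>R torus_deriv (\<lambda>\<eta>. \<omega> \<eta> ((omit k V)(m' := u))) \<theta> (V k)" for r u
          using torus_deriv_combination[OF assms(1,1), of "of_real r" _ 0]
          by (simp add: linear_scale[OF l] scaleR_conv_of_real[where 'a=complex])
      qed
      then show ?thesis using False unfolding om by (simp add: linear_cmult)
    qed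
  qed
  have adj: "?\<Phi> V = 0" if i: "Suc i < Suc p" "V i = V (Suc i)" for V i
  proof -
    let ?t = "\<lambda>k. (-1) ^ k * torus_deriv (\<lambda>\<eta>. \<omega> \<eta> (omit k V)) \<theta> (V k)"
    \<comment> \<open>A term that omits neither of the equal neighbours still contains both, and
      they remain adjacent.\<close>
    have "?t k = 0" if k: "k \<in> {..p} - {i, Suc i}" for k
    proof -
      define i' where "i' = (if i < k then i else i - 1)"
      have "\<omega> \<eta> (omit k V) = 0" for \<eta>
        using i k by (intro smooth_form_alternating[OF assms(1), of i' "Suc i'"])
          (auto simp: omit_def i'_def)
      moreover have "torus_deriv (\<lambda>\<eta> :: 'n torus. 0 :: complex) \<theta> u = 0" for u
        by (cases \<theta> rule: torus_cases) (simp add: torus_deriv_abs)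
      ultimately show ?thesis by simp
    qed
    then have "?\<Phi> V = (\<Sum>k\<in>{i, Suc i}. ?t k)"
      unfolding exterior_derivative_def using i(1) by (intro sum.mono_neutral_right) auto
    also have "\<dots> = ?t i + ?t (Suc i)" by simp
    also have "omit (Suc i) V = omit i V" using i(2) by (auto simp: omit_def fun_eq_iff not_less_eq less_Suc_eq)
    finally show ?thesis using i(2) by simp
  qed
  show "?\<Phi> V = 0" if "i < j" "j < Suc p" "V i = V j" for V i j
    using multilinear_adjacent_alternating[OF lin adj that] .
qed (use assms in simp)

text \<open>Cartan's formula: in top degree the Lie derivative along a constant field \<open>e\<close> is the exterior
  derivative of the contraction with \<open>e\<close>.\<close>

lemma exact_form_torus_deriv:
  fixes \<omega> :: "'n::finite form"
  assumes "smooth_form (Suc q) \<omega>" "Suc q \<ge> CARD('n)"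
  shows "exact_form (Suc q) (\<lambda>\<theta> V. torus_deriv (\<lambda>\<eta>. \<omega> \<eta> V) \<theta> e)"
proof -
  define \<iota> where "\<iota> = (\<lambda>\<theta> V. \<omega> \<theta> (case_nat e V))"
  have upd: "case_nat e (V(i := u)) = (case_nat e V)(Suc i := u)" for V :: "nat \<Rightarrow> real^'n" and i u
    by (auto simp: fun_eq_iff split: nat.splits)
  have "smooth_form q \<iota>"
    unfolding \<iota>_def
  proof (rule smooth_formI)
    show "C_k m (\<lambda>x. \<omega> (abs_torus x) (case_nat e V))" for m V
      by (rule smooth_form_C_k[OF assms(1)])
    show "\<omega> \<theta> (case_nat e V) = \<omega> \<theta> (case_nat e W)" if "\<And>i. i < q \<Longrightarrow> V i = W i" for \<theta> V W
      using that by (intro smooth_form_cong[OF assms(1)]) (auto split: nat.splits)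
    show "linear (\<lambda>u. \<omega> \<theta> (case_nat e (V(i := u))))" if "i < q" for \<theta> V i
      unfolding upd using that by (intro smooth_form_linear[OF assms(1)]) simp
    show "\<omega> \<theta> (case_nat e V) = 0" if "i < j" "j < q" "V i = V j" for \<theta> V i j
      using that by (intro smooth_form_alternating[OF assms(1), of "Suc i" "Suc j"]) auto
  qed
  moreover have "exterior_derivative q \<iota> = (\<lambda>\<theta> V. torus_deriv (\<lambda>\<eta>. \<omega> \<eta> V) \<theta> e)"
  proof (intro ext)
    fix \<theta> V
    have om: "omit 0 (case_nat e V) = V" "omit (Suc k) (case_nat e V) = case_nat e (omit k V)" for k
      by (auto simp: omit_def fun_eq_iff split: nat.splits)
    \<comment> \<open>With \<open>e\<close> as argument number zero, the first term is the
      derivative along \<open>e\<close>; the others, shifted by one and so of opposite sign, form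
      the exterior derivative of the contraction.\<close>
    have "0 = exterior_derivative (Suc q) \<omega> \<theta> (case_nat e V)"
      using exterior_derivative_top_degree[OF assms] by simp
    also have "\<dots> = torus_deriv (\<lambda>\<eta>. \<omega> \<eta> V) \<theta> e
        - (\<Sum>k\<le>q. (-1) ^ k * torus_deriv (\<lambda>\<eta>. \<omega> \<eta> (case_nat e (omit k V))) \<theta> (V k))"
      unfolding exterior_derivative_def sum.atMost_Suc_shift by (simp add: om sum_negf)
    finally show "exterior_derivative q \<iota> \<theta> V = torus_deriv (\<lambda>\<eta>. \<omega> \<eta> V) \<theta> e"
      by (simp add: exterior_derivative_def \<iota>_def)
  qed
  ultimately show ?thesis
    unfolding exact_form_def nat.case by (intro exI[of _ \<iota>]) simp
qed

text \<open>Multilinearity, one argument after the other. This is the source of the factor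
  \<open>l ^ p\<close>.\<close>

lemma pullback_form_scale_eq:
  fixes \<omega> :: "'n::finite form"
  assumes "smooth_form p \<omega>"
  shows "pullback_form (torus_scale l) \<omega> \<theta> V = of_nat l ^ p * \<omega> (torus_scale l \<theta>) V"
proof -
  have *: "\<omega> \<theta> (\<lambda>i. if i < k then of_nat l *\<^sub>R V i else V i) = of_nat l ^ k * \<omega> \<theta> V" if "k \<le> p" for k \<theta>
    using that
  proof (induction k)
    case (Suc k)
    let ?V = "\<lambda>i. if i < k then of_nat l *\<^sub>R V i else V i"
    have "(\<lambda>i. if i < Suc k then of_nat l *\<^sub>R V i else V i) = ?V(k := of_nat l *\<^sub>R V k)"
      by (auto simp: fun_eq_iff)
    then have "\<omega> \<theta> (\<lambda>i. if i < Suc k then of_nat l *\<^sub>R V i else V i) = of_nat l *\<^sub>R \<omega> \<theta> (?V(k := V k))"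
      using linear_scale[OF smooth_form_linear[OF assms], of k \<theta> ?V "of_nat l" "V k"] Suc.prems by simp
    also have "?V(k := V k) = ?V" by (auto simp: fun_eq_iff)
    finally show ?case using Suc by (simp add: scaleR_conv_of_real)
  qed simp
  have "pullback_form (torus_scale l) \<omega> \<theta> V = \<omega> (torus_scale l \<theta>) (\<lambda>i. if i < p then of_nat l *\<^sub>R V i else V i)"
    unfolding pullback_form_scale by (intro smooth_form_cong[OF assms]) simp
  then show ?thesis using *[of p] by simp
qed

section \<open>Scaling a form of top degree\<close>

text \<open>For \<open>t\<close> in the unit interval this runs from the projection to the
  hyperplane \<open>x $ i = 0\<close> to \<open>x\<close> itself, the path of the primitive below;
  for \<open>t = l\<close> it is the scaling of a single coordinate.\<close>

definition stretch :: "'n \<Rightarrow> real \<Rightarrow> real^'n::finite \<Rightarrow> real^'n" where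
  "stretch i t x = x + ((t - 1) * x $ i) *\<^sub>R axis i 1"

lemma linear_stretch: "linear (stretch i t)"
  by (rule linearI) (auto simp: stretch_def algebra_simps)

lemma stretch_1 [simp]: "stretch i 1 x = x"
  by (simp add: stretch_def)

lemma continuous_on_stretch: "continuous_on S (\<lambda>p. stretch i (snd p) (fst p))"
  unfolding stretch_def by (intro continuous_intros)

text \<open>The weight \<phi> makes the family closed under differentiation: the path depends on
  \<open>x $ i\<close>, and differentiating it multiplies the weight by \<open>t - 1\<close>. Hence
  the induction for \<open>C_k\<close> has to run over all weights.\<close>

definition stretch_integral :: "'n \<Rightarrow> (real \<Rightarrow> complex) \<Rightarrow> (real^'n::finite \<Rightarrow> complex) \<Rightarrow> real^'n \<Rightarrow> complex" where
  "stretch_integral i \<phi> g x = integral {0..1} (\<lambda>t. \<phi> t * g (stretch i t x))"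

lemma continuous_on_stretch_integrand:
  fixes \<phi> :: "real \<Rightarrow> complex" and g :: "real^'n::finite \<Rightarrow> complex"
  assumes "continuous_on UNIV \<phi>" "continuous_on UNIV g"
  shows "continuous_on S (\<lambda>(x, t). \<phi> t * g (stretch i t x))"
proof -
  have "continuous_on S (\<lambda>p. \<phi> (snd p))" "continuous_on S (\<lambda>p. g (stretch i (snd p) (fst p)))"
    by (rule continuous_on_compose2[OF assms(1)] continuous_on_compose2[OF assms(2)] continuous_on_stretch
        | intro continuous_intros subset_UNIV)+
  then show ?thesis unfolding case_prod_beta by (rule bounded_bilinear.continuous_on[OF bounded_bilinear_mult])
qed

lemma integrable_stretch_integrand:
  fixes \<phi> :: "real \<Rightarrow> complex" and g :: "real^'n::finite \<Rightarrow> complex"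
  assumes "continuous_on UNIV \<phi>" "continuous_on UNIV g"
  shows "(\<lambda>t. \<phi> t * g (stretch i t x)) integrable_on {0..1}"
proof -
  have "continuous_on UNIV (\<lambda>t. g (stretch i t x))"
    unfolding stretch_def by (rule continuous_on_compose2[OF assms(2)]) (auto intro!: continuous_intros)
  then have "continuous_on {0..1} (\<lambda>t. \<phi> t * g (stretch i t x))"
    by (intro bounded_bilinear.continuous_on[OF bounded_bilinear_mult]) (auto intro: continuous_on_subset assms(1))
  then show ?thesis by (rule integrable_continuous_real)
qed

lemma stretch_integral_has_derivative:
  assumes g: "C_k (Suc m) g" and \<phi>: "continuous_on UNIV \<phi>"
  shows "(stretch_integral i \<phi> g has_derivative (\<lambda>u. stretch_integral i \<phi> (dir_deriv g u) x
    + of_real (u $ i) * stretch_integral i (\<lambda>t. \<phi> t * of_real (t - 1)) (dir_deriv g (axis i 1)) x)) (at x)"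
proof -
  let ?e = "axis i 1 :: real^'a"
  have cont: "continuous_on UNIV g" "continuous_on UNIV (dir_deriv g u)" for u
    using C_k_imp_continuous[OF g] C_k_imp_continuous[OF C_k_SucD(2)[OF g]] by auto
  have \<phi>1: "continuous_on UNIV (\<lambda>t. \<phi> t * of_real (t - 1))" using \<phi> by (intro continuous_intros)
  have lin: "linear (\<lambda>u. dir_deriv g u y)" for y
    using has_derivative_linear[OF C_k_SucD(1)[OF g]] .
  define D where "D x t u = \<phi> t * dir_deriv g (stretch i t u) (stretch i t x)" for x t u
  have D: "((\<lambda>x. \<phi> t * g (stretch i t x)) has_derivative D x t) (at x)" for x t
  proof -
    have "(stretch i t has_derivative stretch i t) (at x)"
      by (rule linear_imp_has_derivative[OF linear_stretch])
    from has_derivative_mult_right[OF has_derivative_compose[OF this C_k_SucD(1)[OF g]]]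
    show ?thesis by (simp add: D_def[abs_def])
  qed
  have D_eq: "D x t u = \<phi> t * dir_deriv g u (stretch i t x)
      + of_real (u $ i) * (\<phi> t * of_real (t - 1) * dir_deriv g ?e (stretch i t x))" for x t u
  proof -
    have "dir_deriv g (stretch i t u) (stretch i t x) = dir_deriv g u (stretch i t x)
        + of_real ((t - 1) * u $ i) * dir_deriv g ?e (stretch i t x)"
      unfolding stretch_def[of i t u] linear_add[OF lin] linear_scale[OF lin] scaleR_conv_of_real[where 'a=complex] ..
    then show ?thesis unfolding D_def by (simp only:) (simp add: algebra_simps)
  qed
  \<comment> \<open>\<open>leibniz_rule\<close> asks for the derivative of the integrand as a
    bounded linear map depending continuously on both variables.\<close>
  define B where "B x t = Blinfun (D x t)" for x t
  have B: "blinfun_apply (B x t) = D x t" for x t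
    unfolding B_def by (rule bounded_linear_Blinfun_apply[OF has_derivative_bounded_linear[OF D]])
  have contB: "continuous_on (UNIV \<times> cbox 0 1) (\<lambda>(x, t). B x t)"
  proof (rule continuous_on_blinfun_componentwise)
    fix u :: "real^'a"
    have "continuous_on (UNIV \<times> cbox 0 1) (\<lambda>p. (\<lambda>(x, t). \<phi> t * dir_deriv g u (stretch i t x)) p
      + of_real (u $ i) * (\<lambda>(x, t). (\<phi> t * of_real (t - 1)) * dir_deriv g ?e (stretch i t x)) p)"
      by (intro continuous_on_add bounded_bilinear.continuous_on[OF bounded_bilinear_mult] continuous_on_const
          continuous_on_stretch_integrand[OF \<phi> cont(2)] continuous_on_stretch_integrand[OF \<phi>1 cont(2)])
    then show "continuous_on (UNIV \<times> cbox 0 1) (\<lambda>p. blinfun_apply ((\<lambda>(x, t). B x t) p) u)"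
      by (simp add: case_prod_beta B D_eq)
  qed
  have "((\<lambda>x. integral (cbox 0 1) (\<lambda>t. \<phi> t * g (stretch i t x))) has_derivative
      blinfun_apply (integral (cbox 0 1) (B x))) (at x within UNIV)"
    by (rule leibniz_rule[OF _ _ contB])
      (auto simp: B intro!: D integrable_stretch_integrand[OF \<phi> cont(1)])
  moreover have "blinfun_apply (integral (cbox 0 1) (B x)) = (\<lambda>u. stretch_integral i \<phi> (dir_deriv g u) x
    + of_real (u $ i) * stretch_integral i (\<lambda>t. \<phi> t * of_real (t - 1)) (dir_deriv g ?e) x)"
  proof
    fix u
    have "continuous_on (cbox 0 1) (B x)"
    proof -
      have "continuous_on (cbox 0 1) (\<lambda>t :: real. (x, t))" by (intro continuous_intros)
      from continuous_on_compose2[OF contB this] show ?thesis by auto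
    qed
    then have "B x integrable_on cbox 0 1" by (rule integrable_continuous)
    then have "blinfun_apply (integral (cbox 0 1) (B x)) u = integral {0..1} (\<lambda>t. D x t u)"
      by (simp add: blinfun_apply_integral B)
    also have "\<dots> = stretch_integral i \<phi> (dir_deriv g u) x
        + of_real (u $ i) * stretch_integral i (\<lambda>t. \<phi> t * of_real (t - 1)) (dir_deriv g ?e) x"
      unfolding D_eq stretch_integral_def
      by (subst integral_add)
        (auto intro!: integrable_on_mult_right integrable_stretch_integrand \<phi> \<phi>1 cont simp del: of_real_diff)
    finally show "blinfun_apply (integral (cbox 0 1) (B x)) u = stretch_integral i \<phi> (dir_deriv g u) x
        + of_real (u $ i) * stretch_integral i (\<lambda>t. \<phi> t * of_real (t - 1)) (dir_deriv g ?e) x" .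
  qed
  ultimately show ?thesis by (simp add: stretch_integral_def[abs_def])
qed

lemma C_k_stretch_integral:
  assumes "C_k m g" "continuous_on UNIV \<phi>"
  shows "C_k m (stretch_integral i \<phi> g)"
  using assms
proof (induction m arbitrary: g \<phi>)
  case 0
  have "continuous_on (UNIV \<times> cbox 0 1) (\<lambda>(x, t). \<phi> t * g (stretch i t x))"
    using 0 by (intro continuous_on_stretch_integrand) auto
  from integral_continuous_on_param[OF this] show ?case
    by (simp add: stretch_integral_def[abs_def])
next
  case (Suc m)
  have "continuous_on UNIV (\<lambda>t. \<phi> t * of_real (t - 1))" using Suc.prems(2) by (intro continuous_intros)
  then show ?case
    by (intro C_k_SucI[OF stretch_integral_has_derivative[OF Suc.prems]] C_k_add C_k_mult C_k_const
        Suc.IH C_k_SucD(2)[OF Suc.prems(1)] Suc.prems(2))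
qed

text \<open>The integral of \<open>g\<close> along the \<open>i\<close>-th coordinate from the hyperplane \<open>x $ i = 0\<close>, written with a
  fixed domain of integration.\<close>

definition coordinate_primitive :: "'n \<Rightarrow> (real^'n::finite \<Rightarrow> complex) \<Rightarrow> real^'n \<Rightarrow> complex" where
  "coordinate_primitive i g x = of_real (x $ i) * stretch_integral i (\<lambda>_. 1) g x"

lemma linear_complex_coordinate: "linear (\<lambda>x :: real^'n::finite. complex_of_real (x $ i))"
  by (rule linearI) (auto simp: scaleR_conv_of_real[where 'a=complex])

lemma C_k_coordinate_primitive: "C_k m g \<Longrightarrow> C_k m (coordinate_primitive i g)"
  unfolding coordinate_primitive_def[abs_def]
  by (rule C_k_mult[OF C_k_linear[OF linear_complex_coordinate] C_k_stretch_integral]) auto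

text \<open>After differentiation the integrand is the derivative in \<open>t\<close> of
  \<open>t * g (stretch i t x)\<close>, whose values at the ends are \<open>0\<close> and
  \<open>g x\<close>.\<close>

lemma dir_deriv_coordinate_primitive:
  assumes g: "C_k (Suc m) g"
  shows "dir_deriv (coordinate_primitive i g) (axis i 1) x = g x"
proof -
  let ?e = "axis i 1 :: real^'a"
  have cont: "continuous_on UNIV g" "continuous_on UNIV (dir_deriv g ?e)"
    using C_k_imp_continuous[OF g] C_k_imp_continuous[OF C_k_SucD(2)[OF g]] by auto
  have lin: "linear (\<lambda>u. dir_deriv g u y)" for y
    using has_derivative_linear[OF C_k_SucD(1)[OF g]] .
  have "((\<lambda>x. complex_of_real (x $ i)) has_derivative (\<lambda>u. of_real (u $ i))) (at x)"
    by (rule linear_imp_has_derivative[OF linear_complex_coordinate])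
  then have "(coordinate_primitive i g has_derivative (\<lambda>u. of_real (x $ i) *
      (stretch_integral i (\<lambda>_. 1) (dir_deriv g u) x
        + of_real (u $ i) * stretch_integral i (\<lambda>t. 1 * of_real (t - 1)) (dir_deriv g ?e) x)
      + of_real (u $ i) * stretch_integral i (\<lambda>_. 1) g x)) (at x)"
    unfolding coordinate_primitive_def[abs_def]
    by (intro has_derivative_mult stretch_integral_has_derivative[OF g]) auto
  from dir_deriv_eq[OF this, of ?e]
  have "dir_deriv (coordinate_primitive i g) ?e x = of_real (x $ i) *
      (stretch_integral i (\<lambda>_. 1) (dir_deriv g ?e) x + stretch_integral i (\<lambda>t. of_real (t - 1)) (dir_deriv g ?e) x)
      + stretch_integral i (\<lambda>_. 1) g x"
    by simp
  \<comment> \<open>The weights \<open>1\<close> and \<open>t - 1\<close> add up to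
    \<open>t\<close>.\<close>
  also have "stretch_integral i (\<lambda>_. 1) (dir_deriv g ?e) x + stretch_integral i (\<lambda>t. of_real (t - 1)) (dir_deriv g ?e) x
      = integral {0..1} (\<lambda>t. of_real t * dir_deriv g ?e (stretch i t x))"
  proof -
    have "(\<lambda>t. 1 * dir_deriv g ?e (stretch i t x)) integrable_on {0..1}"
      "(\<lambda>t. of_real (t - 1) * dir_deriv g ?e (stretch i t x)) integrable_on {0..1}"
      by (intro integrable_stretch_integrand cont continuous_intros)+
    from integral_add[OF this] show ?thesis
      by (simp add: stretch_integral_def algebra_simps)
  qed
  also have "of_real (x $ i) * \<dots> + stretch_integral i (\<lambda>_. 1) g x
      = integral {0..1} (\<lambda>t. of_real (x $ i) * (of_real t * dir_deriv g ?e (stretch i t x)) + 1 * g (stretch i t x))"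
  proof -
    have "(\<lambda>t. of_real (x $ i) * (of_real t * dir_deriv g ?e (stretch i t x))) integrable_on {0..1}"
      "(\<lambda>t. 1 * g (stretch i t x)) integrable_on {0..1}"
      by (intro integrable_on_mult_right integrable_stretch_integrand cont continuous_intros)+
    from integral_add[OF this] show ?thesis
      by (simp add: stretch_integral_def)
  qed
  finally have eq: "dir_deriv (coordinate_primitive i g) ?e x = integral {0..1}
      (\<lambda>t. of_real (x $ i) * (of_real t * dir_deriv g ?e (stretch i t x)) + 1 * g (stretch i t x))" .
  have "((\<lambda>t. of_real (x $ i) * (of_real t * dir_deriv g ?e (stretch i t x)) + 1 * g (stretch i t x))
      has_integral (of_real 1 * g (stretch i 1 x) - of_real 0 * g (stretch i 0 x))) {0..1}"
  proof (rule fundamental_theorem_of_calculus)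
    fix t
    have "((\<lambda>t. stretch i t x) has_derivative (\<lambda>h. (h * x $ i) *\<^sub>R ?e)) (at t)"
      unfolding stretch_def by (auto intro!: derivative_eq_intros)
    from has_derivative_compose[OF this C_k_SucD(1)[OF g]]
    have "((\<lambda>t. g (stretch i t x)) has_derivative (\<lambda>h. (h * x $ i) *\<^sub>R dir_deriv g ?e (stretch i t x))) (at t)"
      by (simp add: linear_scale[OF lin])
    moreover have "(complex_of_real has_derivative complex_of_real) (at t)"
      by (intro has_derivative_of_real has_derivative_ident)
    ultimately have "((\<lambda>t. of_real t * g (stretch i t x)) has_derivative (\<lambda>h. of_real t *
        ((h * x $ i) *\<^sub>R dir_deriv g ?e (stretch i t x)) + of_real h * g (stretch i t x))) (at t)"
      by (rule has_derivative_mult[rotated])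
    then show "((\<lambda>t. of_real t * g (stretch i t x)) has_vector_derivative
        of_real (x $ i) * (of_real t * dir_deriv g ?e (stretch i t x)) + 1 * g (stretch i t x)) (at t within {0..1})"
      unfolding has_vector_derivative_def
      by (rule has_derivative_at_withinI[THEN has_derivative_eq_rhs])
        (auto simp: scaleR_conv_of_real algebra_simps)
  qed simp
  from integral_unique[OF this] show ?thesis unfolding eq by simp
qed

lemma coordinate_primitive_combination:
  assumes "continuous_on UNIV f" "continuous_on UNIV g"
  shows "coordinate_primitive i (\<lambda>x. a * f x + b * g x) x
    = a * coordinate_primitive i f x + b * coordinate_primitive i g x"
proof -
  have "(\<lambda>t. f (stretch i t x)) integrable_on {0..1}" "(\<lambda>t. g (stretch i t x)) integrable_on {0..1}"
    using integrable_stretch_integrand[OF continuous_on_const assms(1), of 1 i x]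
      integrable_stretch_integrand[OF continuous_on_const assms(2), of 1 i x] by auto
  then have "integral {0..1} (\<lambda>t. a * f (stretch i t x) + b * g (stretch i t x))
      = a * integral {0..1} (\<lambda>t. f (stretch i t x)) + b * integral {0..1} (\<lambda>t. g (stretch i t x))"
    by (simp add: integral_add integrable_on_mult_right)
  then show ?thesis
    by (simp add: coordinate_primitive_def stretch_integral_def algebra_simps)
qed

text \<open>The primitive is not periodic, but the following combination of it is.\<close>

definition scaling_primitive :: "(real^'n::finite \<Rightarrow> complex) \<Rightarrow> 'n \<Rightarrow> nat \<Rightarrow> real^'n \<Rightarrow> complex" where
  "scaling_primitive g i l x = coordinate_primitive i g (stretch i l x) / of_nat l - coordinate_primitive i g x"

context
  fixes g :: "real^'n::finite \<Rightarrow> complex" and i :: 'n and l :: nat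
  assumes smooth: "\<And>m. C_k m g" and periodic: "\<And>x y. torus_rel x y \<Longrightarrow> g x = g y"
    and l: "l > 0"
begin

text \<open>The path of integration moves only the i-th coordinate, so periods in the other
  coordinates pass through the integral.\<close>

lemma coordinate_primitive_periodic_other:
  assumes "torus_rel y x" "y $ i = x $ i"
  shows "coordinate_primitive i g y = coordinate_primitive i g x"
proof -
  have "g (stretch i t y) = g (stretch i t x)" for t
    using assms by (intro periodic) (auto simp: torus_rel_def stretch_def)
  then show ?thesis using assms(2) by (simp add: coordinate_primitive_def stretch_integral_def)
qed

text \<open>The derivative in \<open>r\<close> of the left-hand side is a difference of values of
  \<open>g\<close> a period apart, which is zero.\<close>

lemma coordinate_primitive_period_constant:
  assumes "\<And>x. torus_rel (x + p) x"
  shows "coordinate_primitive i g (x + r *\<^sub>R axis i 1 + p) - coordinate_primitive i g (x + r *\<^sub>R axis i 1)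
    = coordinate_primitive i g (x + p) - coordinate_primitive i g x"
proof -
  let ?e = "axis i 1 :: real^'n" and ?G = "coordinate_primitive i g"
  have G: "(?G has_derivative (\<lambda>u. dir_deriv ?G u y)) (at y)" for y
    by (rule C_k_SucD(1)[OF C_k_coordinate_primitive[OF smooth]])
  have lin: "linear (\<lambda>u. dir_deriv ?G u y)" for y using has_derivative_linear[OF G] .
  have d: "((\<lambda>r. ?G (x + r *\<^sub>R ?e + q)) has_derivative (\<lambda>h. h *\<^sub>R g (x + r *\<^sub>R ?e + q))) (at r)" for r q
  proof -
    have "((\<lambda>r. x + r *\<^sub>R ?e + q) has_derivative (\<lambda>h. h *\<^sub>R ?e)) (at r)"
      by (auto intro!: derivative_eq_intros)
    from has_derivative_compose[OF this G] show ?thesis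
      by (simp add: linear_scale[OF lin] dir_deriv_coordinate_primitive[OF smooth])
  qed
  have "((\<lambda>r. ?G (x + r *\<^sub>R ?e + p) - ?G (x + r *\<^sub>R ?e + 0)) has_derivative (\<lambda>h. 0)) (at r)" for r
    using has_derivative_diff[OF d[of p r] d[of 0 r]] periodic[OF assms] by simp
  then obtain c where "\<And>r. ?G (x + r *\<^sub>R ?e + p) - ?G (x + r *\<^sub>R ?e + 0) = c"
    using has_derivative_zero_constant[of UNIV "\<lambda>r. ?G (x + r *\<^sub>R ?e + p) - ?G (x + r *\<^sub>R ?e + 0)"] by auto
  from this[of r] this[of 0] show ?thesis by simp
qed

text \<open>A period in direction \<open>i\<close> becomes \<open>l\<close> periods after
  stretching. The primitive grows by the same amount over each of them, so division by
  \<open>l\<close> makes the growth of both terms equal.\<close>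

lemma scaling_primitive_periodic:
  assumes "torus_rel y x"
  shows "scaling_primitive g i l y = scaling_primitive g i l x"
proof -
  let ?G = "coordinate_primitive i g"
  define p where "p = (y $ i - x $ i) *\<^sub>R (axis i 1 :: real^'n)"
  have p: "torus_rel (z + p) z" for z
    unfolding torus_rel_def
  proof
    fix j
    obtain m :: int where "y $ i - x $ i = 2 * pi * m" using assms by (auto simp: torus_rel_def)
    then show "\<exists>m::int. (z + p) $ j - z $ j = 2 * pi * m"
      by (cases "j = i") (auto simp: p_def axis_def intro: exI[of _ 0])
  qed
  have yp: "?G y = ?G (x + p)"
    using assms by (intro coordinate_primitive_periodic_other)
      (auto simp: torus_rel_def p_def axis_def intro: exI[of _ 0])
  \<comment> \<open>The two points differ only by periods in coordinates other than
    \<open>i\<close>.\<close>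
  have "(stretch i l y) $ j - (stretch i l x + real l *\<^sub>R p) $ j = (if j = i then 0 else y $ j - x $ j)" for j
    by (auto simp: stretch_def p_def axis_def algebra_simps)
  then have "?G (stretch i l y) = ?G (stretch i l x + real l *\<^sub>R p)"
    using assms by (intro coordinate_primitive_periodic_other)
      (auto simp: torus_rel_def stretch_def p_def axis_def algebra_simps intro: exI[of _ 0])
  moreover have "?G (stretch i l x + real l *\<^sub>R p) - ?G (stretch i l x) = of_nat l * (?G (x + p) - ?G x)"
  proof -
    have "?G (stretch i l x + real (Suc k) *\<^sub>R p) - ?G (stretch i l x + real k *\<^sub>R p) = ?G (x + p) - ?G x" for k
    proof -
      have "stretch i l x + real k *\<^sub>R p = x + ((real l - 1) * x $ i + real k * (y $ i - x $ i)) *\<^sub>R axis i 1"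
        by (simp add: stretch_def p_def scaleR_left_distrib)
      moreover have "stretch i l x + real (Suc k) *\<^sub>R p = (stretch i l x + real k *\<^sub>R p) + p"
        by (simp add: scaleR_left_distrib)
      ultimately show ?thesis using coordinate_primitive_period_constant[OF p] by metis
    qed
    then have "(\<Sum>k<l. ?G (stretch i l x + real (Suc k) *\<^sub>R p) - ?G (stretch i l x + real k *\<^sub>R p))
        = of_nat l * (?G (x + p) - ?G x)" by simp
    then show ?thesis
      using sum_lessThan_telescope[of "\<lambda>k. ?G (stretch i l x + real k *\<^sub>R p)" l] by simp
  qed
  ultimately have *: "?G (stretch i l y) = ?G (stretch i l x) + of_nat l * (?G y - ?G x)"
    using yp by (simp add: algebra_simps)
  show ?thesis unfolding scaling_primitive_def * using l by (simp add: field_simps)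
qed

lemma C_k_scaling_primitive: "C_k m (scaling_primitive g i l)"
  unfolding scaling_primitive_def[abs_def]
  by (intro C_k_diff C_k_divide C_k_const C_k_coordinate_primitive smooth
      C_k_compose_linear[OF linear_stretch]) (use l in simp)

text \<open>The factor \<open>l\<close> from the chain rule cancels the denominator, so that
  division by \<open>l\<close> serves the derivative as well as periodicity.\<close>

lemma dir_deriv_scaling_primitive:
  "dir_deriv (scaling_primitive g i l) (axis i 1) x = g (stretch i l x) - g x"
proof -
  let ?e = "axis i 1 :: real^'n" and ?G = "coordinate_primitive i g"
  have G: "(?G has_derivative (\<lambda>u. dir_deriv ?G u y)) (at y)" for y
    by (rule C_k_SucD(1)[OF C_k_coordinate_primitive[OF smooth]])
  have lin: "linear (\<lambda>u. dir_deriv ?G u y)" for y using has_derivative_linear[OF G] .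
  have "(stretch i l has_derivative stretch i l) (at x)"
    by (rule linear_imp_has_derivative[OF linear_stretch])
  from has_derivative_diff[OF has_derivative_mult_right[OF has_derivative_compose[OF this G], of "1 / of_nat l"] G]
  have "(scaling_primitive g i l has_derivative (\<lambda>u. 1 / of_nat l * dir_deriv ?G (stretch i l u) (stretch i l x)
      - dir_deriv ?G u x)) (at x)"
    by (simp add: scaling_primitive_def[abs_def])
  from dir_deriv_eq[OF this, of ?e] have "dir_deriv (scaling_primitive g i l) ?e x
      = 1 / of_nat l * dir_deriv ?G (stretch i l ?e) (stretch i l x) - dir_deriv ?G ?e x" .
  moreover have "stretch i l ?e = real l *\<^sub>R ?e"
    by (simp add: stretch_def scaleR_left_diff_distrib)
  ultimately show ?thesis
    using l by (simp add: linear_scale[OF lin] dir_deriv_coordinate_primitive[OF smooth]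
        scaleR_conv_of_real[where 'a=complex])
qed

end

lemma scaling_primitive_combination:
  assumes "continuous_on UNIV f" "continuous_on UNIV g"
  shows "scaling_primitive (\<lambda>x. a * f x + b * g x) i l x
    = a * scaling_primitive f i l x + b * scaling_primitive g i l x"
  unfolding scaling_primitive_def coordinate_primitive_combination[OF assms]
  by (simp add: algebra_simps add_divide_distrib)

section \<open>Scaling the coordinates one after the other\<close>

definition coordinate_scale :: "nat \<Rightarrow> 'n set \<Rightarrow> real^'n::finite \<Rightarrow> real^'n" where
  "coordinate_scale l S x = (\<chi> j. if j \<in> S then real l * x $ j else x $ j)"

definition torus_coordinate_scale :: "nat \<Rightarrow> 'n set \<Rightarrow> 'n::finite torus \<Rightarrow> 'n torus" where
  "torus_coordinate_scale l S \<theta> = abs_torus (coordinate_scale l S (rep_torus \<theta>))"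

lemma torus_coordinate_scale_abs:
  "torus_coordinate_scale l S (abs_torus x) = abs_torus (coordinate_scale l S x)"
proof -
  let ?y = "rep_torus (abs_torus x)"
  have "\<exists>m::int. coordinate_scale l S ?y $ i - coordinate_scale l S x $ i = 2 * pi * m" for i
  proof -
    obtain m :: int where m: "?y $ i - x $ i = 2 * pi * m"
      using torus_rel_rep_abs[of x] by (auto simp: torus_rel_def)
    then have "real l * ?y $ i - real l * x $ i = 2 * pi * (int l * m)"
      by (simp add: right_diff_distrib[symmetric])
    with m show ?thesis by (cases "i \<in> S") (auto simp: coordinate_scale_def simp del: of_int_mult)
  qed
  then show ?thesis by (simp add: torus_coordinate_scale_def abs_torus_eq_iff torus_rel_def)
qed

lemma linear_coordinate_scale: "linear (coordinate_scale l S)"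
  by (rule linearI) (auto simp: coordinate_scale_def vec_eq_iff algebra_simps)

lemma coordinate_scale_insert:
  "i \<notin> S \<Longrightarrow> coordinate_scale l (insert i S) x = coordinate_scale l S (stretch i l x)"
  by (auto simp: coordinate_scale_def stretch_def vec_eq_iff axis_def algebra_simps)

lemma coordinate_scale_insert':
  "i \<notin> S \<Longrightarrow> coordinate_scale l (insert i S) x = stretch i l (coordinate_scale l S x)"
  by (auto simp: coordinate_scale_def stretch_def vec_eq_iff axis_def algebra_simps)

text \<open>For fixed arguments, \<kappa> is the periodic primitive of the difference along
  coordinate \<open>i\<close>. It is linear in the coefficient function, so it is again a form of
  the same degree, and Cartan's formula makes its derivative along \<open>axis i 1\<close>
  exact.\<close>

lemma exact_form_coordinate_scale_single:
  fixes \<omega> :: "'n::finite form"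
  assumes \<omega>: "smooth_form (Suc q) \<omega>" and q: "Suc q \<ge> CARD('n)" and l: "l > 0"
  shows "exact_form (Suc q) (\<lambda>\<theta> V. \<omega> (torus_coordinate_scale l {i} \<theta>) V - \<omega> \<theta> V)"
proof -
  define g where "g V x = \<omega> (abs_torus x) V" for V x
  have smooth: "C_k m (g V)" for m V
    unfolding g_def[abs_def] by (rule smooth_form_C_k[OF \<omega>])
  have cont: "continuous_on UNIV (g V)" for V by (rule C_k_imp_continuous[OF smooth])
  have periodic: "g V x = g V y" if "torus_rel x y" for V x y
    using that by (simp add: g_def abs_torus_eq_iff[symmetric])
  define \<kappa> where "\<kappa> = (\<lambda>\<theta> V. scaling_primitive (g V) i l (rep_torus \<theta>))"
  have \<kappa>: "\<kappa> (abs_torus x) V = scaling_primitive (g V) i l x" for x V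
    unfolding \<kappa>_def by (rule scaling_primitive_periodic[OF smooth periodic l torus_rel_rep_abs])
  have "smooth_form (Suc q) \<kappa>"
  proof (rule smooth_formI)
    show "C_k m (\<lambda>x. \<kappa> (abs_torus x) V)" for m V
      unfolding \<kappa> by (rule C_k_scaling_primitive[OF smooth periodic l])
    show "\<kappa> \<theta> V = \<kappa> \<theta> W" if "\<And>i. i < Suc q \<Longrightarrow> V i = W i" for \<theta> V W
    proof -
      have "g V = g W" using smooth_form_cong[OF \<omega> that] by (auto simp: g_def)
      then show ?thesis by (simp add: \<kappa>_def)
    qed
    show "linear (\<lambda>u. \<kappa> \<theta> (V(k := u)))" if "k < Suc q" for \<theta> V k
    proof (rule linearI)
      note lin = smooth_form_linear[OF \<omega> that, of _ V]
      fix u w and r :: real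
      have "g (V(k := u + w)) = (\<lambda>x. 1 * g (V(k := u)) x + 1 * g (V(k := w)) x)"
        by (simp add: g_def fun_eq_iff linear_add[OF lin])
      then show "\<kappa> \<theta> (V(k := u + w)) = \<kappa> \<theta> (V(k := u)) + \<kappa> \<theta> (V(k := w))"
        unfolding \<kappa>_def using scaling_primitive_combination[OF cont cont, of 1 _ 1] by simp
      have "g (V(k := r *\<^sub>R u)) = (\<lambda>x. of_real r * g (V(k := u)) x + 0 * g (V(k := u)) x)"
        by (simp add: g_def fun_eq_iff linear_scale[OF lin] scaleR_conv_of_real[where 'a=complex])
      then show "\<kappa> \<theta> (V(k := r *\<^sub>R u)) = r *\<^sub>R \<kappa> \<theta> (V(k := u))"
        unfolding \<kappa>_def using scaling_primitive_combination[OF cont cont, of "of_real r" _ 0]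
        by (simp add: scaleR_conv_of_real[where 'a=complex])
    qed
    show "\<kappa> \<theta> V = 0" if "a < b" "b < Suc q" "V a = V b" for \<theta> V a b
    proof -
      \<comment> \<open>Writing zero as a trivial combination gives the vanishing of the primitive
        from its linearity.\<close>
      have "g V = (\<lambda>x. 0 * g V x + 0 * g V x)"
        using smooth_form_alternating[OF \<omega> that] by (simp add: g_def fun_eq_iff)
      then have "scaling_primitive (g V) i l x = 0 * scaling_primitive (g V) i l x + 0 * scaling_primitive (g V) i l x" for x
        using scaling_primitive_combination[OF cont cont] by metis
      then show ?thesis by (simp add: \<kappa>_def)
    qed
  qed
  then have "exact_form (Suc q) (\<lambda>\<theta> V. torus_deriv (\<lambda>\<eta>. \<kappa> \<eta> V) \<theta> (axis i 1))"
    using q by (rule exact_form_torus_deriv)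
  moreover have "torus_deriv (\<lambda>\<eta>. \<kappa> \<eta> V) \<theta> (axis i 1) = \<omega> (torus_coordinate_scale l {i} \<theta>) V - \<omega> \<theta> V" for \<theta> V
  proof (cases \<theta> rule: torus_cases)
    case (1 x)
    have "(\<lambda>y. \<kappa> (abs_torus y) V) = scaling_primitive (g V) i l" by (simp add: \<kappa> fun_eq_iff)
    moreover have "coordinate_scale l {} z = z" for z :: "real^'n" by (simp add: coordinate_scale_def vec_eq_iff)
    ultimately show ?thesis
      unfolding 1 torus_deriv_abs torus_coordinate_scale_abs
      using dir_deriv_scaling_primitive[OF smooth periodic l, of V i] coordinate_scale_insert[of i "{}" l x]
      by (simp add: g_def[abs_def])
  qed
  ultimately show ?thesis by simp
qed

lemma smooth_form_coordinate_scale: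
  assumes "smooth_form p \<omega>"
  shows "smooth_form p (\<lambda>\<theta> V. \<omega> (torus_coordinate_scale l S \<theta>) V)"
proof (rule smooth_formI)
  show "C_k m (\<lambda>x. \<omega> (torus_coordinate_scale l S (abs_torus x)) V)" for m V
    unfolding torus_coordinate_scale_abs
    by (rule C_k_compose_linear[OF linear_coordinate_scale smooth_form_C_k[OF assms]])
qed (use smooth_form_cong[OF assms] smooth_form_linear[OF assms] smooth_form_alternating[OF assms] in blast)+

lemma exact_form_scale_difference:
  fixes \<omega> :: "'n::finite form"
  assumes \<omega>: "smooth_form (Suc q) \<omega>" and q: "Suc q \<ge> CARD('n)" and l: "l > 0"
  shows "exact_form (Suc q) (\<lambda>\<theta> V. \<omega> (torus_scale l \<theta>) V - \<omega> \<theta> V)"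
proof -
  have "exact_form (Suc q) (\<lambda>\<theta> V. \<omega> (torus_coordinate_scale l S \<theta>) V - \<omega> \<theta> V)" for S
    using finite[of S]
  proof (induction S)
    case empty
    have "coordinate_scale l {} x = x" for x :: "real^'n" by (simp add: coordinate_scale_def vec_eq_iff)
    then have "torus_coordinate_scale l {} \<theta> = \<theta>" for \<theta> :: "'n torus"
      by (simp add: torus_coordinate_scale_def)
    then show ?case by (simp add: exact_form_zero)
  next
    case (insert i S)
    have "torus_coordinate_scale l (insert i S) \<theta> = torus_coordinate_scale l S (torus_coordinate_scale l {i} \<theta>)" for \<theta> :: "'n torus"
    proof (cases \<theta> rule: torus_cases)
      case (1 x)
      have "coordinate_scale l {i} x = stretch i l x"
        using coordinate_scale_insert'[of i "{}" l x] by (simp add: coordinate_scale_def vec_eq_iff)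
      then show ?thesis using insert(2) by (simp add: 1 torus_coordinate_scale_abs coordinate_scale_insert)
    qed
    \<comment> \<open>The single step is applied to the form already scaled in the coordinates of
      \<open>S\<close>, so the differences telescope.\<close>
    then show ?case
      using exact_form_add[OF exact_form_coordinate_scale_single[OF smooth_form_coordinate_scale[OF \<omega>] q l, of l S i] insert.IH]
      by simp
  qed
  from this[of UNIV] have *: "exact_form (Suc q) (\<lambda>\<theta> V. \<omega> (torus_coordinate_scale l UNIV \<theta>) V - \<omega> \<theta> V)" .
  have "torus_coordinate_scale l UNIV \<theta> = torus_scale l \<theta>" for \<theta> :: "'n torus"
  proof (cases \<theta> rule: torus_cases)
    case (1 x)
    have "coordinate_scale l UNIV x = of_nat l *\<^sub>R x" by (simp add: coordinate_scale_def vec_eq_iff)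
    then show ?thesis by (simp add: 1 torus_coordinate_scale_abs torus_scale_abs)
  qed
  with * show ?thesis by simp
qed

section \<open>Chern forms\<close>

lemma wedge_2forms_cong:
  assumes "\<And>i. i < 2 * j \<Longrightarrow> V i = W i"
  shows "wedge_2forms j \<alpha> V = wedge_2forms j \<alpha> W"
  unfolding wedge_2forms_def
proof (intro arg_cong2[where f = "(/)"] sum.cong refl arg_cong2[where f = "(*)"] prod.cong)
  fix \<tau> m assume "\<tau> \<in> {\<tau>. \<tau> permutes {..<2 * j}}" "m \<in> {..<j}"
  then have "\<tau> (2 * m) < 2 * j" "\<tau> (2 * m + 1) < 2 * j"
    using permutes_in_image[of \<tau> "{..<2 * j}"] by auto
  then show "\<alpha> m (V (\<tau> (2 * m))) (V (\<tau> (2 * m + 1))) = \<alpha> m (W (\<tau> (2 * m))) (W (\<tau> (2 * m + 1)))"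
    using assms by simp
qed

text \<open>In each term of the sum the i-th argument occurs exactly once, at position
  \<open>k = inv \<tau> i\<close>. It belongs to factor \<open>k div 2\<close>, and the parity of
  \<open>k\<close> tells in which of the two slots.\<close>

lemma wedge_2forms_linear:
  fixes V :: "nat \<Rightarrow> 'a::real_vector"
  assumes lin1: "\<And>m v. linear (\<lambda>u. \<alpha> m u v)" and lin2: "\<And>m u. linear (\<alpha> m u)" and i: "i < 2 * j"
  shows "linear (\<lambda>u. wedge_2forms j \<alpha> (V(i := u)))"
proof -
  have "linear (\<lambda>u. \<Prod>m<j. \<alpha> m ((V(i := u)) (\<tau> (2 * m))) ((V(i := u)) (\<tau> (2 * m + 1))))"
    if \<tau>: "\<tau> permutes {..<2 * j}" for \<tau>
  proof -
    define k where "k = inv \<tau> i"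
    have \<tau>k: "\<tau> x = i \<longleftrightarrow> x = k" for x
      unfolding k_def using permutes_inverses[OF \<tau>] by metis
    have k: "k < 2 * j" using permutes_in_image[OF permutes_inv[OF \<tau>], of i] i by (simp add: k_def)
    define m where "m = k div 2"
    have m: "m < j" using k by (simp add: m_def)
    define C where "C = (\<Prod>m\<in>{..<j} - {m}. \<alpha> m (V (\<tau> (2 * m))) (V (\<tau> (2 * m + 1))))"
    have "(\<Prod>m<j. \<alpha> m ((V(i := u)) (\<tau> (2 * m))) ((V(i := u)) (\<tau> (2 * m + 1))))
        = \<alpha> m ((V(i := u)) (\<tau> (2 * m))) ((V(i := u)) (\<tau> (2 * m + 1))) * C" for u
    proof -
      have "(\<Prod>m\<in>{..<j} - {m}. \<alpha> m ((V(i := u)) (\<tau> (2 * m))) ((V(i := u)) (\<tau> (2 * m + 1)))) = C"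
        unfolding C_def
      proof (rule prod.cong)
        fix m' assume "m' \<in> {..<j} - {m}"
        then have "2 * m' \<noteq> k" "2 * m' + 1 \<noteq> k" by (auto simp: m_def)
        then show "\<alpha> m' ((V(i := u)) (\<tau> (2 * m'))) ((V(i := u)) (\<tau> (2 * m' + 1)))
            = \<alpha> m' (V (\<tau> (2 * m'))) (V (\<tau> (2 * m' + 1)))"
          using \<tau>k by simp
      qed simp
      then show ?thesis using m by (simp add: prod.remove[of "{..<j}" m])
    qed
    moreover have "linear (\<lambda>u. \<alpha> m ((V(i := u)) (\<tau> (2 * m))) ((V(i := u)) (\<tau> (2 * m + 1))))"
    proof (cases "even k")
      case True
      then have "2 * m = k" "2 * m + 1 \<noteq> k" by (auto simp: m_def)
      then have "\<tau> (2 * m) = i" "\<tau> (2 * m + 1) \<noteq> i" using \<tau>k by blast+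
      then show ?thesis using lin1 by simp
    next
      case False
      then have "2 * m + 1 = k" by (simp add: m_def)
      then have "2 * m + 1 = k" "2 * m \<noteq> k" by auto
      then have "\<tau> (2 * m + 1) = i" "\<tau> (2 * m) \<noteq> i" using \<tau>k by blast+
      then show ?thesis using lin2 by simp
    qed
    ultimately show ?thesis by (simp add: linear_cmult mult.commute[of _ C])
  qed
  then have "linear (\<lambda>u. (1 / 2 ^ j) * (\<Sum>\<tau> | \<tau> permutes {..<2 * j}.
      of_int (sign \<tau>) * (\<Prod>m<j. \<alpha> m ((V(i := u)) (\<tau> (2 * m))) ((V(i := u)) (\<tau> (2 * m + 1))))))"
    by (intro linear_cmult linear_compose_sum ballI) auto
  then show ?thesis by (simp add: wedge_2forms_def)
qed

text \<open>Composing every permutation with the transposition of \<open>a\<close> and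
  \<open>b\<close> leaves the products unchanged and reverses the signs, so the sum equals its own
  negative.\<close>

lemma wedge_2forms_alternating:
  assumes ab: "a < b" "b < 2 * j" and V: "V a = V b"
  shows "wedge_2forms j \<alpha> V = 0"
proof -
  let ?f = "\<lambda>\<tau>. complex_of_int (sign \<tau>) * (\<Prod>m<j. \<alpha> m (V (\<tau> (2 * m))) (V (\<tau> (2 * m + 1))))"
  let ?t = "Transposition.transpose a b"
  have t: "?t permutes {..<2 * j}" using ab by (intro permutes_swap_id) auto
  have Vt: "V (?t x) = V x" for x using V by (auto simp: Transposition.transpose_def)
  have "sum ?f {\<tau>. \<tau> permutes {..<2 * j}} = sum (\<lambda>\<tau>. ?f (?t \<circ> \<tau>)) {\<tau>. \<tau> permutes {..<2 * j}}"
    by (rule setum_permutations_compose_left[OF t])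
  also have "\<dots> = sum (\<lambda>\<tau>. - ?f \<tau>) {\<tau>. \<tau> permutes {..<2 * j}}"
  proof (rule sum.cong[OF refl])
    fix \<tau> assume "\<tau> \<in> {\<tau>. \<tau> permutes {..<2 * j}}"
    then have "permutation \<tau>" "permutation ?t" using permutation_permutes t by blast+
    then have "sign (?t \<circ> \<tau>) = - sign \<tau>" using ab by (simp add: sign_compose sign_swap_id)
    then show "?f (?t \<circ> \<tau>) = - ?f \<tau>" by (simp add: Vt)
  qed
  also have "\<dots> = - sum ?f {\<tau>. \<tau> permutes {..<2 * j}}" by (rule sum_negf)
  finally have "sum ?f {\<tau>. \<tau> permutes {..<2 * j}} = 0" by (simp add: eq_neg_iff_add_eq_0)
  then show ?thesis by (simp add: wedge_2forms_def)
qed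

context
  fixes P :: "'n::finite torus \<Rightarrow> complex^'d^'d::finite"
  assumes smooth: "\<And>m. C_k_matrix m (\<lambda>x. P (abs_torus x))"
begin

lemma torus_deriv_matrix:
  "((\<lambda>x. P (abs_torus x)) has_derivative torus_deriv P (abs_torus x)) (at x)"
proof -
  have "torus_deriv P (abs_torus x) = (\<lambda>u. dir_deriv (\<lambda>x. P (abs_torus x)) u x)"
    by (auto simp: torus_deriv_abs)
  then show ?thesis using C_k_matrix_SucD(1)[OF smooth] by simp
qed

lemma linear_torus_deriv_matrix: "linear (torus_deriv P \<theta>)"
  using torus_deriv_matrix has_derivative_linear by (cases \<theta> rule: torus_cases) blast

lemma C_k_torus_deriv_matrix: "C_k_matrix m (\<lambda>x. torus_deriv P (abs_torus x) u)"
  unfolding torus_deriv_abs by (rule C_k_matrix_SucD(2)[OF smooth])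

lemma torus_deriv_scale_matrix:
  "torus_deriv (\<lambda>\<theta>. P (torus_scale l \<theta>)) \<theta> u = torus_deriv P (torus_scale l \<theta>) (of_nat l *\<^sub>R u)"
proof (cases \<theta> rule: torus_cases)
  case (1 x)
  have "((\<lambda>x. of_nat l *\<^sub>R x) has_derivative (\<lambda>u. of_nat l *\<^sub>R u)) (at x)"
    by (auto intro!: derivative_eq_intros)
  from has_derivative_compose[OF this torus_deriv_matrix]
  have "((\<lambda>x. P (torus_scale l (abs_torus x))) has_derivative
      (\<lambda>u. torus_deriv P (abs_torus (of_nat l *\<^sub>R x)) (of_nat l *\<^sub>R u))) (at x)"
    by (simp add: torus_scale_abs)
  from torus_deriv_eq[OF this] show ?thesis by (simp add: 1 torus_scale_abs)
qed

text \<open>At each point the form is a polynomial in \<open>P\<close> and its derivatives, and the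
  chain rule gives every tangent vector the factor \<open>l\<close>, as the pull-back does.\<close>

lemma chern_form_scale:
  "chern_form (\<lambda>\<theta>. P (torus_scale l \<theta>)) j = pullback_form (torus_scale l) (chern_form P j)"
  by (simp add: pullback_form_scale chern_form_def wedge_2forms_def berry_curvature_def torus_deriv_scale_matrix)

lemma C_k_berry_curvature: "C_k m (\<lambda>x. berry_curvature P (abs_torus x) u v $ a $ b)"
  unfolding berry_curvature_def
  by (intro C_k_matrix_entry C_k_matrix_mult C_k_matrix_diff smooth C_k_torus_deriv_matrix)

lemma linear_berry_curvature:
  "linear (\<lambda>u. berry_curvature P \<theta> u v $ a $ b)" "linear (\<lambda>v. berry_curvature P \<theta> u v $ a $ b)"
proof -
  note l = linear_torus_deriv_matrix[of \<theta>]
  show "linear (\<lambda>u. berry_curvature P \<theta> u v $ a $ b)"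
    unfolding berry_curvature_def
    by (rule linearI) (simp_all add: linear_add[OF l] linear_scale[OF l] matrix_distribs
        matrix_mult.scaleR_left matrix_mult.scaleR_right algebra_simps)
  show "linear (\<lambda>v. berry_curvature P \<theta> u v $ a $ b)"
    unfolding berry_curvature_def
    by (rule linearI) (simp_all add: linear_add[OF l] linear_scale[OF l] matrix_distribs
        matrix_mult.scaleR_left matrix_mult.scaleR_right algebra_simps)
qed

lemma smooth_form_chern_form: "smooth_form (2 * j) (chern_form P j)"
proof (rule smooth_formI)
  show "C_k m (\<lambda>x. chern_form P j (abs_torus x) V)" for m V
    unfolding chern_form_def wedge_2forms_def
    by (intro C_k_mult C_k_const C_k_sum C_k_divide C_k_prod C_k_berry_curvature) auto
  show "chern_form P j \<theta> V = chern_form P j \<theta> W" if "\<And>i. i < 2 * j \<Longrightarrow> V i = W i" for \<theta> V W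
    unfolding chern_form_def
    by (intro arg_cong2[where f = "(*)"] sum.cong refl wedge_2forms_cong that)
  show "linear (\<lambda>u. chern_form P j \<theta> (V(i := u)))" if "i < 2 * j" for \<theta> V i
    unfolding chern_form_def using that
    by (intro linear_cmult linear_compose_sum ballI wedge_2forms_linear linear_berry_curvature)
  show "chern_form P j \<theta> V = 0" if "a < b" "b < 2 * j" "V a = V b" for \<theta> V a b
    unfolding chern_form_def wedge_2forms_alternating[where V = V, OF that] by simp
qed

end

section \<open>Chern classes of isolated bands\<close>

lemma eigenbundle_eq_spectral_space: "eigenbundle H B \<theta> = spectral_space (H \<theta>) (band (H \<theta>) ` B)"
  by (simp add: eigenbundle_def spectral_space_def)

lemma smooth_eigenbundle_projection:
  fixes H :: "'n::finite torus \<Rightarrow> complex^'d^'d::finite"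
  assumes "\<And>\<theta>. hermitian (H \<theta>)" "\<And>m. C_k_matrix m (\<lambda>x. H (abs_torus x))" "isolated_bands H B"
  shows "C_k_matrix m (\<lambda>x. orthogonal_projection (eigenbundle H B (abs_torus x)))"
  unfolding eigenbundle_eq_spectral_space
  by (rule smooth_spectral_projection) (use assms in \<open>auto simp: isolated_bands_def\<close>)

lemma pullback_top_degree_class:
  fixes \<omega> :: "'n::finite form"
  assumes "smooth_form p \<omega>" "p = CARD('n)" "l > 0"
  shows "deRham_class p (pullback_form (torus_scale l) \<omega>) = scale_class (of_nat l ^ p) p (deRham_class p \<omega>)"
proof -
  have "p > 0" using assms(2) by simp
  then obtain q where q: "p = Suc q" using gr0_implies_Suc by blast
  have "exact_form p (\<lambda>\<theta> V. of_nat l ^ p * (\<omega> (torus_scale l \<theta>) V - \<omega> \<theta> V))"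
    using assms unfolding q by (intro exact_form_scale exact_form_scale_difference) auto
  then show ?thesis
    unfolding scale_class_deRham_class
    by (intro deRham_class_eqI)
      (simp add: pullback_form_scale_eq[OF assms(1)] scale_form_def right_diff_distrib)
qed

theorem proposition2p1:
  fixes \<Gamma> :: "(real^'n::finite) set" and v w :: "'n \<Rightarrow> real^'n" and k :: nat
    and t :: "'d::finite \<Rightarrow> 'd \<Rightarrow> real^'n \<Rightarrow> complex"
  defines "H \<equiv> lattice_hamiltonian \<Gamma> v t"
    and "Hk \<equiv> neighbour_hamiltonian \<Gamma> v w t"
  assumes "lattice_basis v \<Gamma>"
    and "range v \<subseteq> neighbours \<Gamma> 1"
    and "\<forall>\<theta>. hermitian (H \<theta>)"
    and "k \<ge> 1"
    and "commensurate \<Gamma> k"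
    and "\<forall>i. w i = neighbour_scale \<Gamma> k *\<^sub>R v i"
  shows "\<exists>l::nat. l > 0 \<and> real l = neighbour_scale \<Gamma> k \<and>
    (\<forall>\<theta>. hermitian (Hk \<theta>)) \<and>
    Hk = H \<circ> torus_scale l \<and>
    torus_degree (torus_scale l :: 'n torus \<Rightarrow> 'n torus) = int l ^ CARD('n) \<and>
    (\<forall>B. isolated_bands Hk B \<longleftrightarrow> isolated_bands H B) \<and>
    (\<forall>B j. isolated_bands H B \<longrightarrow>
       chern_class Hk B j = pullback_class (torus_scale l) (2 * j) (chern_class H B j) \<and>
       (2 * j = CARD('n) \<longrightarrow>
          chern_class Hk B j = scale_class (of_nat l ^ CARD('n)) (2 * j) (chern_class H B j)))"
proof -
  obtain l :: nat where l: "l > 0" "real l = neighbour_scale \<Gamma> k"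
    using neighbour_scale_nat[OF assms(3,6,7)] .
  have Hk: "Hk \<theta> = H (torus_scale l \<theta>)" for \<theta>
    unfolding H_def Hk_def using assms(8) l(2) by (intro neighbour_hamiltonian_eq[OF assms(3)]) simp
  have isolated: "isolated_bands Hk B \<longleftrightarrow> isolated_bands H B" for B
  proof -
    \<comment> \<open>Surjectivity of the scaling map carries a condition at all points back from
      \<open>Hk\<close> to \<open>H\<close>.\<close>
    have "(\<forall>\<theta>. Q (torus_scale l \<theta>)) \<longleftrightarrow> (\<forall>\<theta>. Q \<theta>)" for Q :: "'n torus \<Rightarrow> bool"
      using torus_scale_surj[OF l(1), where 'a='n] by (metis surjD)
    from this[of "\<lambda>\<theta>. \<forall>i\<in>B. \<forall>j\<in>{1..CARD('d)} - B. band (H \<theta>) i \<noteq> band (H \<theta>) j"]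
    show ?thesis unfolding isolated_bands_def Hk by simp
  qed
  have chern: "chern_class Hk B j = pullback_class (torus_scale l) (2 * j) (chern_class H B j) \<and>
       (2 * j = CARD('n) \<longrightarrow>
          chern_class Hk B j = scale_class (of_nat l ^ CARD('n)) (2 * j) (chern_class H B j))"
    if B: "isolated_bands H B" for B j
  proof -
    define P where "P \<theta> = orthogonal_projection (eigenbundle H B \<theta>)" for \<theta>
    have smooth: "C_k_matrix m (\<lambda>x. P (abs_torus x))" for m
      unfolding P_def
      by (rule smooth_eigenbundle_projection[OF _ _ B])
        (use assms(5) in \<open>auto simp: H_def C_k_matrix_lattice_hamiltonian\<close>)
    \<comment> \<open>Bands and eigenspaces depend only on the matrix at the point, so the
      eigenbundle is pulled back together with the Hamiltonian.\<close>
    have "orthogonal_projection (eigenbundle Hk B \<theta>) = P (torus_scale l \<theta>)" for \<theta>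
      by (simp add: P_def eigenbundle_def Hk)
    then have k: "chern_class Hk B j = deRham_class (2 * j) (pullback_form (torus_scale l) (chern_form P j))"
      by (simp add: chern_class_def chern_form_scale[OF smooth])
    have H: "chern_class H B j = deRham_class (2 * j) (chern_form P j)"
      by (simp add: chern_class_def P_def[abs_def])
    show ?thesis
      unfolding k H pullback_class_deRham_class
      using pullback_top_degree_class[OF smooth_form_chern_form[OF smooth, of j] _ l(1)] by auto
  qed
  show ?thesis
  proof (intro exI[of _ l] conjI)
    show "\<forall>\<theta>. hermitian (Hk \<theta>)" using assms(5) by (simp add: Hk)
    show "Hk = H \<circ> torus_scale l" by (simp add: fun_eq_iff Hk)
    show "torus_degree (torus_scale l :: 'n torus \<Rightarrow> 'n torus) = int l ^ CARD('n)"
      by (rule torus_degree_scale[OF l(1)])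
  qed (use l isolated chern in blast)+
qed

end
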